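(* Let $(X,T)$ be a $\mathbb{Z}^2$-t.d.s. with metric $d$, let $\mu\in M(X,T)$, and let $\vec{v}=(1,\beta)\in\mathbb{R}^2$ be a direction vector. Then the following statements are all equivalent, where in each of (a), (b), (d), (e) both the version "for some $b\in(0,\infty)$" and the version "for any (i.e. every) $b\in(0,\infty)$" are included among the equivalent statements: (a) $\mu$ has bounded complexity with respect to $\{\hat{d}_k^{\vec{v},b}\}_{k=1}^\infty$ for some $b\in(0,\infty)$ (or for any $b\in(0,\infty)$); (b) $\mu$ has bounded complexity with respect to $\{\bar{d}_k^{\vec{v},b}\}_{k=1}^\infty$ for some $b\in(0,\infty)$ (or for any $b\in(0,\infty)$); (c) $\mu$ has $\vec{v}$-discrete spectrum; (d) $T$ is $(\mu,\vec{v},b)$-equicontinuous in the mean for some $b\in(0,\infty)$ (or for any $b\in(0,\infty)$); (e) $T$ is $(\mu,\vec{v},b)$-mean equicontinuous for some $b\in(0,\infty)$ (or for any $b\in(0,\infty)$).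
   Context: A $\mathbb{Z}^2$-t.d.s. $(X,T)$ is a compact metric space $(X,d)$ with a group homomorphism $\vec{w}\mapsto T^{\vec{w}}$ from $\mathbb{Z}^2$ to the group of homeomorphisms of $X$. $\mathcal{B}_X$ is the Borel $\sigma$-algebra, and $M(X,T)$ is the set of Borel probability measures $\mu$ on $X$ with $\mu(T^{-\vec{w}}A)=\mu(A)$ for all $\vec{w}\in\mathbb{Z}^2$, $A\in\mathcal{B}_X$. For $b>0$ let $\Lambda^{\vec{v}}(b)=\{(m,n)\in\mathbb{Z}^2:\beta m-b\le n\le\beta m+b\}$ and, for $k\in\mathbb{N}=\{1,2,\dots\}$, $\Lambda_k^{\vec{v}}(b)=\Lambda^{\vec{v}}(b)\cap(\{0,1,\dots,k-1\}\times\mathbb{Z})$. For $x,y\in X$ define $$\bar{d}_k^{\vec{v},b}(x,y)=\frac{1}{\#(\Lambda_k^{\vec{v}}(b))}\sum_{(m,n)\in\Lambda_k^{\vec{v}}(b)}d(T^{(m,n)}x,T^{(m,n)}y),\qquad \hat{d}_k^{\vec{v},b}(x,y)=\max_{1\le i\le k}\bar{d}_i^{\vec{v},b}(x,y).$$ For a sequence $\{\rho_k\}$ of metrics on $X$ write $B_{\rho_k}(x,\epsilon)=\{y\in X:\rho_k(x,y)<\epsilon\}$. $\mu$ has bounded complexity with respect to $\{\rho_k\}$ if for every $\epsilon>0$ there is a positive integer $C=C(\epsilon)$ such that for every $k\in\mathbb{N}$ there is a finite $F\subset X$ with $\#(F)\le C$ and $\mu\big(\bigcup_{x\in F}B_{\rho_k}(x,\epsilon)\big)>1-\epsilon$.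 For $(m,n)\in\mathbb{Z}^2$ let $U_T^{(m,n)}f=f\circ T^{(m,n)}$ on $L^2(X,\mathcal{B}_X,\mu)$. The $\vec{v}$-directional Kronecker algebra is $$\mathcal{K}_\mu^{\vec{v}}(b)=\Big\{B\in\mathcal{B}_X:\overline{\{U_T^{(m,n)}1_B:(m,n)\in\Lambda^{\vec{v}}(b)\}}\text{ is compact in }L^2(X,\mathcal{B}_X,\mu)\Big\}.$$ It is a known fact that it does not depend on $b\in(0,\infty)$, so it is written $\mathcal{K}_\mu^{\vec{v}}$. $\mu$ has $\vec{v}$-discrete spectrum if $\mathcal{K}_\mu^{\vec{v}}=\mathcal{B}_X$. A subset $K\subset X$ is $(\vec{v},b)$-equicontinuous in the mean if for every $\epsilon>0$ there is $\delta>0$ such that $\hat{d}_k^{\vec{v},b}(x,y)<\epsilon$ for all $k\in\mathbb{N}$ and all $x,y\in K$ with $d(x,y)<\delta$. It is $(\vec{v},b)$-mean equicontinuous if for every $\epsilon>0$ there is $\delta>0$ such that $\limsup_{k\to\infty}\bar{d}_k^{\vec{v},b}(x,y)<\epsilon$ for all $x,y\in K$ with $d(x,y)<\delta$. $T$ is $(\mu,\vec{v},b)$-equicontinuous in the mean (resp. $(\mu,\vec{v},b)$-mean equicontinuous) if for every $\tau>0$ there is a Borel measurable $K\subset X$ with $\mu(K)>1-\tau$ that is $(\vec{v},b)$-equicontinuous in the mean (resp. $(\vec{v},b)$-mean equicontinuous). *)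

theory Defs
  imports "HOL-Analysis.Analysis" "HOL-Probability.Probability_Measure"
begin

section \<open>Actions of $\mathbb{Z}^2$ and invariant measures\<close>

text \<open>The phase space is a type: the metric is \<^const>\<open>dist\<close> and the Borel sets are those of
  \<^const>\<open>borel\<close>. The clause \<open>T 0 = id\<close> follows from the two stated clauses on \<open>T\<close>, see
  \<open>Z2_tds_zero\<close> below.\<close>

definition Z2_tds :: "(int \<times> int \<Rightarrow> 'a::metric_space \<Rightarrow> 'a) \<Rightarrow> bool" where
  "Z2_tds T \<longleftrightarrow> compact (UNIV :: 'a set)
     \<and> (\<forall>w. \<exists>S. homeomorphism UNIV UNIV (T w) S)
     \<and> (\<forall>w w'. T (w + w') = T w \<circ> T w')"

definition invariant_measures ::
    "(int \<times> int \<Rightarrow> 'a::metric_space \<Rightarrow> 'a) \<Rightarrow> 'a measure set" where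
  "invariant_measures T = {\<mu>. prob_space \<mu> \<and> sets \<mu> = sets borel
     \<and> (\<forall>w. \<forall>A\<in>sets borel. emeasure \<mu> (T (- w) ` A) = emeasure \<mu> A)}"

section \<open>Strips and averaged metrics in the direction $(1,\beta)$\<close>

text \<open>A direction vector $\vec v = (1,\beta)$ is represented by its slope \<open>\<beta>\<close>.\<close>

definition strip :: "real \<Rightarrow> real \<Rightarrow> (int \<times> int) set" where
  "strip \<beta> b = {(m, n). \<beta> * of_int m - b \<le> of_int n \<and> of_int n \<le> \<beta> * of_int m + b}"

definition strip_upto :: "real \<Rightarrow> real \<Rightarrow> nat \<Rightarrow> (int \<times> int) set" where
  "strip_upto \<beta> b k = strip \<beta> b \<inter> ({0..<int k} \<times> UNIV)"

definition dbar ::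
    "(int \<times> int \<Rightarrow> 'a::metric_space \<Rightarrow> 'a) \<Rightarrow> real \<Rightarrow> real \<Rightarrow> nat \<Rightarrow> 'a \<Rightarrow> 'a \<Rightarrow> real" where
  "dbar T \<beta> b k x y =
     (\<Sum>w\<in>strip_upto \<beta> b k. dist (T w x) (T w y)) / real (card (strip_upto \<beta> b k))"

text \<open>Only indices \<open>k \<ge> 1\<close> are meaningful here and in \<open>bounded_complexity\<close>.\<close>

definition dhat ::
    "(int \<times> int \<Rightarrow> 'a::metric_space \<Rightarrow> 'a) \<Rightarrow> real \<Rightarrow> real \<Rightarrow> nat \<Rightarrow> 'a \<Rightarrow> 'a \<Rightarrow> real" where
  "dhat T \<beta> b k x y = Max ((\<lambda>i. dbar T \<beta> b i x y) ` {1..k})"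

definition bounded_complexity :: "'a measure \<Rightarrow> (nat \<Rightarrow> 'a \<Rightarrow> 'a \<Rightarrow> real) \<Rightarrow> bool" where
  "bounded_complexity \<mu> \<rho> \<longleftrightarrow>
     (\<forall>\<epsilon>>0. \<exists>C>0. \<forall>k\<ge>1. \<exists>F. finite F \<and> card F \<le> C
        \<and> measure \<mu> (\<Union>x\<in>F. {y. \<rho> k x y < \<epsilon>}) > 1 - \<epsilon>)"

section \<open>The space $L^2(X,\mathcal{B}_X,\mu)$\<close>

text \<open>Elements of the complex $L^2$ space are classes of square-integrable functions modulo
  equality almost everywhere. The metric is computed on chosen representatives; that this choice
  does not matter and that one obtains a metric space is shown in \<open>L2_dist_class\<close> and
  \<open>Metric_space_L2\<close>.\<close>

definition L2_funs :: "'a measure \<Rightarrow> ('a \<Rightarrow> complex) set" where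
  "L2_funs M = {f. f \<in> borel_measurable M \<and> integrable M (\<lambda>x. (cmod (f x))\<^sup>2)}"

definition L2_class :: "'a measure \<Rightarrow> ('a \<Rightarrow> complex) \<Rightarrow> ('a \<Rightarrow> complex) set" where
  "L2_class M f = {g \<in> L2_funs M. AE x in M. g x = f x}"

definition L2_space :: "'a measure \<Rightarrow> ('a \<Rightarrow> complex) set set" where
  "L2_space M = L2_class M ` L2_funs M"

definition L2_rep :: "('a \<Rightarrow> complex) set \<Rightarrow> 'a \<Rightarrow> complex" where
  "L2_rep F = (SOME f. f \<in> F)"

definition L2_dist :: "'a measure \<Rightarrow> ('a \<Rightarrow> complex) set \<Rightarrow> ('a \<Rightarrow> complex) set \<Rightarrow> real" where
  "L2_dist M F G = sqrt (\<integral>x. (cmod (L2_rep F x - L2_rep G x))\<^sup>2 \<partial>M)"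

abbreviation L2_topology :: "'a measure \<Rightarrow> ('a \<Rightarrow> complex) set topology" where
  "L2_topology M \<equiv> Metric_space.mtopology (L2_space M) (L2_dist M)"

text \<open>The unitary operator $U_T^{w}f = f\circ T^{w}$ on classes, see \<open>koopman_class\<close>.\<close>

definition koopman :: "'a measure \<Rightarrow> (int \<times> int \<Rightarrow> 'a \<Rightarrow> 'a) \<Rightarrow> int \<times> int
    \<Rightarrow> ('a \<Rightarrow> complex) set \<Rightarrow> ('a \<Rightarrow> complex) set" where
  "koopman M T w F = L2_class M (L2_rep F \<circ> T w)"

section \<open>Directional Kronecker algebra and discrete spectrum\<close>

definition Kronecker_strip :: "(int \<times> int \<Rightarrow> 'a::metric_space \<Rightarrow> 'a) \<Rightarrow> real \<Rightarrow> real
    \<Rightarrow> 'a measure \<Rightarrow> 'a set set" where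
  "Kronecker_strip T \<beta> b \<mu> = {B \<in> sets borel.
     compactin (L2_topology \<mu>)
       (L2_topology \<mu> closure_of ((\<lambda>w. koopman \<mu> T w (L2_class \<mu> (indicator B))) ` strip \<beta> b))}"

text \<open>For an invariant measure the algebra does not depend on the width \<open>b > 0\<close>
  (\<open>Kronecker_strip_width\<close> below), so width 1 stands for every width.\<close>

definition Kronecker_algebra :: "(int \<times> int \<Rightarrow> 'a::metric_space \<Rightarrow> 'a) \<Rightarrow> real
    \<Rightarrow> 'a measure \<Rightarrow> 'a set set" where
  "Kronecker_algebra T \<beta> \<mu> = Kronecker_strip T \<beta> 1 \<mu>"

definition discrete_spectrum :: "(int \<times> int \<Rightarrow> 'a::metric_space \<Rightarrow> 'a) \<Rightarrow> real
    \<Rightarrow> 'a measure \<Rightarrow> bool" where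
  "discrete_spectrum T \<beta> \<mu> \<longleftrightarrow> Kronecker_algebra T \<beta> \<mu> = sets borel"

section \<open>Equicontinuity in the mean and mean equicontinuity\<close>

definition equicontinuous_in_mean_on :: "(int \<times> int \<Rightarrow> 'a::metric_space \<Rightarrow> 'a) \<Rightarrow> real \<Rightarrow> real
    \<Rightarrow> 'a set \<Rightarrow> bool" where
  "equicontinuous_in_mean_on T \<beta> b K \<longleftrightarrow>
     (\<forall>\<epsilon>>0. \<exists>\<delta>>0. \<forall>k\<ge>1. \<forall>x\<in>K. \<forall>y\<in>K. dist x y < \<delta> \<longrightarrow> dhat T \<beta> b k x y < \<epsilon>)"

definition mean_equicontinuous_on :: "(int \<times> int \<Rightarrow> 'a::metric_space \<Rightarrow> 'a) \<Rightarrow> real \<Rightarrow> real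
    \<Rightarrow> 'a set \<Rightarrow> bool" where
  "mean_equicontinuous_on T \<beta> b K \<longleftrightarrow>
     (\<forall>\<epsilon>>0. \<exists>\<delta>>0. \<forall>x\<in>K. \<forall>y\<in>K. dist x y < \<delta> \<longrightarrow>
        limsup (\<lambda>k. ereal (dbar T \<beta> b k x y)) < ereal \<epsilon>)"

definition equicontinuous_in_mean :: "(int \<times> int \<Rightarrow> 'a::metric_space \<Rightarrow> 'a) \<Rightarrow> 'a measure
    \<Rightarrow> real \<Rightarrow> real \<Rightarrow> bool" where
  "equicontinuous_in_mean T \<mu> \<beta> b \<longleftrightarrow>
     (\<forall>\<tau>>0. \<exists>K\<in>sets borel. measure \<mu> K > 1 - \<tau> \<and> equicontinuous_in_mean_on T \<beta> b K)"

definition mean_equicontinuous :: "(int \<times> int \<Rightarrow> 'a::metric_space \<Rightarrow> 'a) \<Rightarrow> 'a measure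
    \<Rightarrow> real \<Rightarrow> real \<Rightarrow> bool" where
  "mean_equicontinuous T \<mu> \<beta> b \<longleftrightarrow>
     (\<forall>\<tau>>0. \<exists>K\<in>sets borel. measure \<mu> K > 1 - \<tau> \<and> mean_equicontinuous_on T \<beta> b K)"

section \<open>Well-definedness\<close>

lemma Z2_tds_zero:
  assumes "Z2_tds T"
  shows "T 0 = id"
proof
  fix x
  obtain S where S: "homeomorphism UNIV UNIV (T 0) S"
    using assms unfolding Z2_tds_def by blast
  have "T (0 + 0) = T 0 \<circ> T 0" using assms unfolding Z2_tds_def by blast
  hence "T 0 (T 0 x) = T 0 x" by (metis add_0 comp_apply)
  thus "T 0 x = id x" using S by (metis homeomorphism_apply1 UNIV_I id_apply)
qed

lemma strip_upto_origin:
  assumes "b > 0" "k \<ge> 1"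
  shows "(0, 0) \<in> strip_upto \<beta> b k"
  using assms by (simp add: strip_upto_def strip_def)

lemma finite_strip_upto: "finite (strip_upto \<beta> b k)"
proof (rule finite_subset)
  show "finite (SIGMA m : {0..<int k}. {\<lceil>\<beta> * of_int m - b\<rceil>..\<lfloor>\<beta> * of_int m + b\<rfloor>})"
    by auto
  show "strip_upto \<beta> b k \<subseteq> (SIGMA m : {0..<int k}. {\<lceil>\<beta> * of_int m - b\<rceil>..\<lfloor>\<beta> * of_int m + b\<rfloor>})"
    by (auto simp: strip_upto_def strip_def ceiling_le_iff le_floor_iff)
qed

lemma L2_scale_ineq:
  fixes u v :: complex
  assumes "t > 0"
  shows "(cmod (u + v))\<^sup>2 \<le> (1 + t) * (cmod u)\<^sup>2 + (1 + 1/t) * (cmod v)\<^sup>2"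
proof -
  have "0 \<le> (t * cmod u - cmod v)\<^sup>2 / t" using assms by simp
  also have "\<dots> = t * (cmod u)\<^sup>2 + (cmod v)\<^sup>2 / t - 2 * cmod u * cmod v"
    using assms by (simp add: power2_eq_square field_simps)
  finally have *: "2 * cmod u * cmod v \<le> t * (cmod u)\<^sup>2 + (cmod v)\<^sup>2 / t" by simp
  have "(cmod (u + v))\<^sup>2 \<le> (cmod u + cmod v)\<^sup>2"
    by (intro power_mono norm_triangle_ineq) auto
  thus ?thesis using * by (simp add: power2_sum algebra_simps)
qed

lemma L2_funs_add:
  assumes "f \<in> L2_funs M" "g \<in> L2_funs M"
  shows "(\<lambda>x. f x + g x) \<in> L2_funs M"
proof -
  have [measurable]: "f \<in> borel_measurable M" "g \<in> borel_measurable M"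
    and i: "integrable M (\<lambda>x. (cmod (f x))\<^sup>2)" "integrable M (\<lambda>x. (cmod (g x))\<^sup>2)"
    using assms by (auto simp: L2_funs_def)
  have "integrable M (\<lambda>x. (cmod (f x + g x))\<^sup>2)"
  proof (rule Bochner_Integration.integrable_bound)
    show "integrable M (\<lambda>x. 2 * (cmod (f x))\<^sup>2 + 2 * (cmod (g x))\<^sup>2)" using i by auto
    show "AE x in M. norm ((cmod (f x + g x))\<^sup>2) \<le> norm (2 * (cmod (f x))\<^sup>2 + 2 * (cmod (g x))\<^sup>2)"
      using L2_scale_ineq[of 1] by (auto intro!: AE_I2)
  qed measurable
  thus ?thesis by (auto simp: L2_funs_def)
qed

lemma L2_funs_diff:
  assumes "f \<in> L2_funs M" "g \<in> L2_funs M"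
  shows "(\<lambda>x. f x - g x) \<in> L2_funs M"
proof -
  have "(\<lambda>x. - g x) \<in> L2_funs M" using assms by (auto simp: L2_funs_def)
  from L2_funs_add[OF assms(1) this] show ?thesis by simp
qed

lemma L2_minkowski:
  assumes f: "f \<in> L2_funs M" and g: "g \<in> L2_funs M"
  shows "sqrt (\<integral>x. (cmod (f x + g x))\<^sup>2 \<partial>M)
    \<le> sqrt (\<integral>x. (cmod (f x))\<^sup>2 \<partial>M) + sqrt (\<integral>x. (cmod (g x))\<^sup>2 \<partial>M)"
proof (rule field_le_epsilon)
  fix e :: real assume "e > 0"
  define A where "A = (\<integral>x. (cmod (f x))\<^sup>2 \<partial>M)"
  define B where "B = (\<integral>x. (cmod (g x))\<^sup>2 \<partial>M)"
  define a where "a = sqrt A + e / 2"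
  define b where "b = sqrt B + e / 2"
  have AB: "A \<ge> 0" "B \<ge> 0" by (auto simp: A_def B_def)
  hence pos: "a > 0" "b > 0" using \<open>e > 0\<close> by (auto simp: a_def b_def add_nonneg_pos)
  have "sqrt A \<le> a" "sqrt B \<le> b" using \<open>e > 0\<close> by (auto simp: a_def b_def)
  hence le: "A \<le> a\<^sup>2" "B \<le> b\<^sup>2" using AB by (auto simp: sqrt_le_D)
  have i: "integrable M (\<lambda>x. (cmod (f x))\<^sup>2)" "integrable M (\<lambda>x. (cmod (g x))\<^sup>2)"
    "integrable M (\<lambda>x. (cmod (f x + g x))\<^sup>2)"
    using f g L2_funs_add[OF f g] by (auto simp: L2_funs_def)
  have "(\<integral>x. (cmod (f x + g x))\<^sup>2 \<partial>M)
      \<le> (\<integral>x. (1 + b/a) * (cmod (f x))\<^sup>2 + (1 + 1/(b/a)) * (cmod (g x))\<^sup>2 \<partial>M)"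
    using pos i by (intro integral_mono L2_scale_ineq) auto
  also have "\<dots> = (1 + b/a) * A + (1 + a/b) * B"
    using i by (simp add: A_def B_def)
  also have "\<dots> \<le> (1 + b/a) * a\<^sup>2 + (1 + a/b) * b\<^sup>2"
    using pos le by (intro add_mono mult_left_mono) auto
  also have "\<dots> = (a + b)\<^sup>2"
    using pos by (simp add: power2_eq_square field_simps)
  finally have "sqrt (\<integral>x. (cmod (f x + g x))\<^sup>2 \<partial>M) \<le> a + b"
    using pos by (simp add: real_le_lsqrt)
  thus "sqrt (\<integral>x. (cmod (f x + g x))\<^sup>2 \<partial>M)
    \<le> sqrt (\<integral>x. (cmod (f x))\<^sup>2 \<partial>M) + sqrt (\<integral>x. (cmod (g x))\<^sup>2 \<partial>M) + e"
    by (simp add: a_def b_def A_def B_def)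
qed

lemma L2_rep_class:
  assumes "f \<in> L2_funs M"
  shows "L2_rep (L2_class M f) \<in> L2_funs M" "AE x in M. L2_rep (L2_class M f) x = f x"
proof -
  have "f \<in> L2_class M f" using assms by (simp add: L2_class_def)
  hence "L2_rep (L2_class M f) \<in> L2_class M f" unfolding L2_rep_def by (rule someI[of "\<lambda>h. h \<in> L2_class M f"])
  thus "L2_rep (L2_class M f) \<in> L2_funs M" "AE x in M. L2_rep (L2_class M f) x = f x"
    by (auto simp: L2_class_def)
qed

lemma L2_class_cong:
  assumes "AE x in M. f x = g x"
  shows "L2_class M f = L2_class M g"
proof -
  have "(AE x in M. h x = f x) \<longleftrightarrow> (AE x in M. h x = g x)" for h
    using assms by (intro iffI; elim AE_mp) (auto elim!: eventually_mono)
  thus ?thesis by (simp add: L2_class_def)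
qed

lemma L2_dist_class:
  assumes "f \<in> L2_funs M" "g \<in> L2_funs M"
  shows "L2_dist M (L2_class M f) (L2_class M g) = sqrt (\<integral>x. (cmod (f x - g x))\<^sup>2 \<partial>M)"
proof -
  have "(\<integral>x. (cmod (L2_rep (L2_class M f) x - L2_rep (L2_class M g) x))\<^sup>2 \<partial>M)
      = (\<integral>x. (cmod (f x - g x))\<^sup>2 \<partial>M)"
    using assms L2_rep_class[OF assms(1)] L2_rep_class[OF assms(2)]
    by (intro integral_cong_AE) (auto simp: L2_funs_def)
  thus ?thesis by (simp add: L2_dist_def)
qed

lemma Metric_space_L2: "Metric_space (L2_space M) (L2_dist M)"
proof
  show "0 \<le> L2_dist M F G" for F G by (simp add: L2_dist_def)
  show "L2_dist M F G = L2_dist M G F" for F G by (simp add: L2_dist_def norm_minus_commute)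
  show "L2_dist M F G = 0 \<longleftrightarrow> F = G" if FG: "F \<in> L2_space M" "G \<in> L2_space M" for F G
  proof -
    obtain f g where fg: "f \<in> L2_funs M" "g \<in> L2_funs M" "F = L2_class M f" "G = L2_class M g"
      using FG unfolding L2_space_def by blast
    have d: "L2_dist M F G = sqrt (\<integral>x. (cmod (f x - g x))\<^sup>2 \<partial>M)"
      using fg L2_dist_class by blast
    have i: "integrable M (\<lambda>x. (cmod (f x - g x))\<^sup>2)"
      using L2_funs_diff[OF fg(1,2)] by (simp add: L2_funs_def)
    show ?thesis
    proof
      assume "L2_dist M F G = 0"
      hence "(\<integral>x. (cmod (f x - g x))\<^sup>2 \<partial>M) = 0" using d by simp
      hence "AE x in M. (cmod (f x - g x))\<^sup>2 = 0"
        using integral_nonneg_eq_0_iff_AE[OF i] by simp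
      thus "F = G" unfolding fg(3,4) by (intro L2_class_cong) simp
    qed (simp add: L2_dist_def)
  qed
  show "L2_dist M F H \<le> L2_dist M F G + L2_dist M G H"
    if FGH: "F \<in> L2_space M" "G \<in> L2_space M" "H \<in> L2_space M" for F G H
  proof -
    obtain f g h where fgh: "f \<in> L2_funs M" "g \<in> L2_funs M" "h \<in> L2_funs M"
      "F = L2_class M f" "G = L2_class M g" "H = L2_class M h"
      using FGH unfolding L2_space_def by blast
    show ?thesis
      using L2_minkowski[OF L2_funs_diff[OF fgh(1,2)] L2_funs_diff[OF fgh(2,3)]]
      by (simp add: fgh L2_dist_class)
  qed
qed

lemma distr_invariant:
  assumes "Z2_tds T" "\<mu> \<in> invariant_measures T"
  shows "T w \<in> measurable \<mu> \<mu>" "distr \<mu> \<mu> (T w) = \<mu>"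
proof -
  have sets: "sets \<mu> = sets borel" using assms by (simp add: invariant_measures_def)
  hence sp: "space \<mu> = UNIV" by (metis sets_eq_imp_space_eq space_borel)
  have "continuous_on UNIV (T w)"
    using assms(1) unfolding Z2_tds_def homeomorphism_def by blast
  hence "T w \<in> borel_measurable borel" by (rule borel_measurable_continuous_onI)
  thus meas: "T w \<in> measurable \<mu> \<mu>" using measurable_cong_sets[OF sets sets] by blast
  have "T (w + - w) = T w \<circ> T (- w)" "T (- w + w) = T (- w) \<circ> T w"
    using assms(1) unfolding Z2_tds_def by blast+
  hence inv: "T w (T (- w) x) = x" "T (- w) (T w x) = x" for x
    using Z2_tds_zero[OF assms(1)] by (metis ab_left_minus add.right_inverse comp_apply id_apply)+
  have vim: "T w -` A = T (- w) ` A" for A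
    by (auto simp: inv image_iff) (metis inv(2))
  show "distr \<mu> \<mu> (T w) = \<mu>"
  proof (rule measure_eqI)
    fix A assume "A \<in> sets (distr \<mu> \<mu> (T w))"
    hence A: "A \<in> sets \<mu>" by simp
    have "emeasure \<mu> (T (- w) ` A) = emeasure \<mu> A"
      using assms(2) A sets unfolding invariant_measures_def by blast
    thus "emeasure (distr \<mu> \<mu> (T w)) A = emeasure \<mu> A"
      using meas A by (simp add: emeasure_distr sp vim)
  qed simp
qed

lemma L2_funs_compose:
  assumes "Z2_tds T" "\<mu> \<in> invariant_measures T" "f \<in> L2_funs \<mu>"
  shows "f \<circ> T w \<in> L2_funs \<mu>"
    "(\<integral>x. (cmod (f (T w x)))\<^sup>2 \<partial>\<mu>) = (\<integral>x. (cmod (f x))\<^sup>2 \<partial>\<mu>)"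
proof -
  note [measurable] = distr_invariant(1)[OF assms(1,2), of w]
  note d = distr_invariant(2)[OF assms(1,2), of w]
  have [measurable]: "f \<in> borel_measurable \<mu>" using assms by (simp add: L2_funs_def)
  have "integrable (distr \<mu> \<mu> (T w)) (\<lambda>x. (cmod (f x))\<^sup>2)"
    using assms(3) d by (simp add: L2_funs_def)
  hence "integrable \<mu> (\<lambda>x. (cmod (f (T w x)))\<^sup>2)"
    by (subst (asm) integrable_distr_eq) auto
  thus "f \<circ> T w \<in> L2_funs \<mu>" by (simp add: L2_funs_def comp_def)
  have "(\<integral>x. (cmod (f x))\<^sup>2 \<partial>distr \<mu> \<mu> (T w)) = (\<integral>x. (cmod (f (T w x)))\<^sup>2 \<partial>\<mu>)"
    by (rule integral_distr) auto
  thus "(\<integral>x. (cmod (f (T w x)))\<^sup>2 \<partial>\<mu>) = (\<integral>x. (cmod (f x))\<^sup>2 \<partial>\<mu>)" using d by simp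
qed

lemma koopman_class:
  assumes "Z2_tds T" "\<mu> \<in> invariant_measures T" "f \<in> L2_funs \<mu>"
  shows "koopman \<mu> T w (L2_class \<mu> f) = L2_class \<mu> (f \<circ> T w)"
  unfolding koopman_def
proof (rule L2_class_cong)
  note d = distr_invariant[OF assms(1,2), of w]
  have "AE x in distr \<mu> \<mu> (T w). L2_rep (L2_class \<mu> f) x = f x"
    unfolding d(2) by (rule L2_rep_class(2)[OF assms(3)])
  from AE_distrD[OF d(1) this]
  show "AE x in \<mu>. (L2_rep (L2_class \<mu> f) \<circ> T w) x = (f \<circ> T w) x" by simp
qed

lemma koopman_isometry:
  assumes "Z2_tds T" "\<mu> \<in> invariant_measures T" "F \<in> L2_space \<mu>" "G \<in> L2_space \<mu>"
  shows "koopman \<mu> T w F \<in> L2_space \<mu>"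
    "L2_dist \<mu> (koopman \<mu> T w F) (koopman \<mu> T w G) = L2_dist \<mu> F G"
proof -
  obtain f g where fg: "f \<in> L2_funs \<mu>" "g \<in> L2_funs \<mu>" "F = L2_class \<mu> f" "G = L2_class \<mu> g"
    using assms(3,4) unfolding L2_space_def by blast
  note c = L2_funs_compose(1)[OF assms(1,2)]
  show "koopman \<mu> T w F \<in> L2_space \<mu>"
    using koopman_class[OF assms(1,2) fg(1)] c[OF fg(1)] fg by (auto simp: L2_space_def)
  show "L2_dist \<mu> (koopman \<mu> T w F) (koopman \<mu> T w G) = L2_dist \<mu> F G"
    using L2_funs_compose(2)[OF assms(1,2) L2_funs_diff[OF fg(1,2)], of w]
    by (simp add: fg koopman_class[OF assms(1,2)] L2_dist_class c)
qed

lemma continuous_koopman: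
  assumes "Z2_tds T" "\<mu> \<in> invariant_measures T"
  shows "continuous_map (L2_topology \<mu>) (L2_topology \<mu>) (koopman \<mu> T w)"
proof (subst Metric_space.metric_continuous_map[OF Metric_space_L2 Metric_space_L2], intro conjI ballI allI impI)
  show "koopman \<mu> T w ` L2_space \<mu> \<subseteq> L2_space \<mu>"
    using koopman_isometry(1)[OF assms, where w = w] by blast
  fix F e assume F: "F \<in> L2_space \<mu>" and e: "e > (0::real)"
  show "\<exists>d>0. \<forall>G. G \<in> L2_space \<mu> \<and> L2_dist \<mu> F G < d
      \<longrightarrow> L2_dist \<mu> (koopman \<mu> T w F) (koopman \<mu> T w G) < e"
    using e koopman_isometry(2)[OF assms F] by (intro exI[of _ e]) auto
qed

lemma strip_cover:
  assumes "b > 0" "b' > 0"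
  obtains W where "finite W" "strip \<beta> b' \<subseteq> (\<Union>w\<in>W. (\<lambda>u. u + w) ` strip \<beta> b)"
proof -
  define p where "p = (\<lambda>(m::int, n::int). \<lfloor>(of_int n - \<beta> * of_int m) / b\<rfloor>)"
  define P where "P = p ` strip \<beta> b'"
  define r where "r = (\<lambda>i. SOME w. w \<in> strip \<beta> b' \<and> p w = i)"
  have "P \<subseteq> {\<lfloor>- b' / b\<rfloor>..\<lfloor>b' / b\<rfloor>}"
    using assms(1)
    by (auto simp: P_def p_def strip_def pos_le_divide_eq divide_right_mono
        simp del: minus_divide_left intro!: floor_mono)
  hence fin: "finite (r ` P)" by (meson finite_atLeastAtMost_int finite_imageI finite_subset)
  have "strip \<beta> b' \<subseteq> (\<Union>w\<in>r ` P. (\<lambda>u. u + w) ` strip \<beta> b)"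
  proof
    fix u assume u: "u \<in> strip \<beta> b'"
    define w where "w = r (p u)"
    have "w \<in> strip \<beta> b' \<and> p w = p u"
      unfolding w_def r_def by (rule someI) (use u in auto)
    hence pw: "p w = p u" by simp
    obtain m n m' n' where mn: "u = (m, n)" "w = (m', n')" by (metis surj_pair)
    define s where "s = (of_int n - \<beta> * of_int m) / b"
    define s' where "s' = (of_int n' - \<beta> * of_int m') / b"
    have "\<lfloor>s\<rfloor> = \<lfloor>s'\<rfloor>" using pw by (simp add: mn p_def s_def s'_def)
    hence "\<bar>s - s'\<bar> \<le> 1" by linarith
    hence "\<bar>s - s'\<bar> * b \<le> b" using assms(1) by simp
    moreover have "\<bar>s - s'\<bar> * b = \<bar>(s - s') * b\<bar>" using assms(1) by (simp add: abs_mult)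
    moreover have "(s - s') * b = of_int (n - n') - \<beta> * of_int (m - m')"
      using assms(1) by (simp add: s_def s'_def field_simps)
    ultimately have "u - w \<in> strip \<beta> b" by (auto simp: strip_def mn)
    moreover have "u = (u - w) + w" by simp
    ultimately show "u \<in> (\<Union>w\<in>r ` P. (\<lambda>u. u + w) ` strip \<beta> b)"
      using u by (auto simp: P_def w_def intro!: bexI[of _ u] image_eqI)
  qed
  with fin show thesis using that by blast
qed

lemma Kronecker_strip_subset:
  assumes "Z2_tds T" "\<mu> \<in> invariant_measures T" "b > 0" "b' > 0"
  shows "Kronecker_strip T \<beta> b \<mu> \<subseteq> Kronecker_strip T \<beta> b' \<mu>"
proof
  fix B assume B: "B \<in> Kronecker_strip T \<beta> b \<mu>"
  interpret L2: Metric_space "L2_space \<mu>" "L2_dist \<mu>" by (rule Metric_space_L2)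
  have sets: "sets \<mu> = sets borel" and "prob_space \<mu>"
    using assms by (auto simp: invariant_measures_def)
  then interpret prob_space \<mu> by simp
  define f :: "'a \<Rightarrow> complex" where "f = indicator B"
  have Bb: "B \<in> sets \<mu>" using B sets by (simp add: Kronecker_strip_def)
  have f: "f \<in> L2_funs \<mu>"
  proof -
    have [measurable]: "f \<in> borel_measurable \<mu>" using Bb by (simp add: f_def)
    have "AE x in \<mu>. norm ((cmod (f x))\<^sup>2) \<le> 1"
      by (intro AE_I2) (simp add: f_def indicator_def)
    hence "integrable \<mu> (\<lambda>x. (cmod (f x))\<^sup>2)"
      by (rule integrable_const_bound) measurable
    thus ?thesis by (simp add: L2_funs_def)
  qed
  define orb where "orb = (\<lambda>w. koopman \<mu> T w (L2_class \<mu> f))"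
  define S where "S = L2.mtopology closure_of (orb ` strip \<beta> b)"
  have S: "compactin L2.mtopology S" using B by (simp add: Kronecker_strip_def S_def orb_def f_def)
  have orb_space: "orb w \<in> L2_space \<mu>" for w
    unfolding orb_def by (rule koopman_isometry(1)[OF assms(1,2)]) (use f in \<open>auto simp: L2_space_def\<close>)
  have oS: "orb ` strip \<beta> b \<subseteq> S" unfolding S_def by (rule closure_of_subset) (use orb_space in auto)
  have orb_add: "orb (u + w) = koopman \<mu> T w (orb u)" for u w
  proof -
    have "T (u + w) = T u \<circ> T w" using assms(1) unfolding Z2_tds_def by blast
    thus ?thesis
      unfolding orb_def
      by (simp add: koopman_class[OF assms(1,2)] f L2_funs_compose(1)[OF assms(1,2) f] comp_assoc)
  qed
  obtain W where W: "finite W" "strip \<beta> b' \<subseteq> (\<Union>w\<in>W. (\<lambda>u. u + w) ` strip \<beta> b)"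
    using strip_cover[OF assms(3,4)] .
  define Q where "Q = (\<Union>w\<in>W. koopman \<mu> T w ` S)"
  have Q: "compactin L2.mtopology Q"
    unfolding Q_def using W(1) image_compactin[OF S continuous_koopman[OF assms(1,2)]]
    by (intro compactin_Union) auto
  have "orb ` strip \<beta> b' \<subseteq> Q"
  proof
    fix F assume "F \<in> orb ` strip \<beta> b'"
    then obtain u w where "w \<in> W" "u \<in> strip \<beta> b" "F = orb (u + w)" using W(2) by blast
    thus "F \<in> Q" using oS by (auto simp: Q_def orb_add)
  qed
  hence "L2.mtopology closure_of (orb ` strip \<beta> b') \<subseteq> Q"
    by (intro closure_of_minimal compactin_imp_closedin[OF L2.Hausdorff_space_mtopology Q])
  hence "compactin L2.mtopology (L2.mtopology closure_of (orb ` strip \<beta> b'))"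
    using Q by (intro closed_compactin[OF Q]) auto
  thus "B \<in> Kronecker_strip T \<beta> b' \<mu>"
    using Bb sets by (simp add: Kronecker_strip_def orb_def f_def)
qed

lemma Kronecker_strip_width:
  assumes "Z2_tds T" "\<mu> \<in> invariant_measures T" "b > 0" "b' > 0"
  shows "Kronecker_strip T \<beta> b \<mu> = Kronecker_strip T \<beta> b' \<mu>"
  using Kronecker_strip_subset[OF assms] Kronecker_strip_subset[OF assms(1,2,4,3)] by blast

end

(*
  Mean equicontinuity and bounded complexity follow from one another by compactness, so the
  substance lies in two implications, both reduced to finite nets of the orbit pieces
  { 1_B o T^w : w in a strip } in L^1.

  Bounded complexity implies discrete spectrum.  For a Lipschitz f, bounded complexity gives colours
  whose number does not depend on k, such that all but a small proportion of the w in the k-th strip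
  piece are coloured and equally coloured f o T^w are close in L^1.  If f o T^(w_1), ..., f o T^(w_M)
  were separated with M large, then so would be all their translates by u in a thinner strip; every u
  would thus produce many uncoloured points w_j + u, too many on average.

  Discrete spectrum implies equicontinuity in the mean.  Averaging 1_B o T^u over the return times u
  of 1_B, weighted by Lipschitz functions of the L^1 distance and of the offset from the line of
  slope beta, and passing to a limit gives h close to 1_B in L^1 with
  |h(T^u x) - h(T^w x)| <= C (|| 1_B o T^u - 1_B o T^w ||_1 + |offset u - offset w|)
  for almost every x and all u, w simultaneously.  Hence finitely many h o T^v control all h o T^w,
  and Lusin's theorem makes these equicontinuous on a large set.  The error |h - 1_B| is stationary,
  so its averages along the strip are small for all k off a small set by a maximal inequality.
  No spectral theory and no pointwise ergodic theorem is needed.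
*)

theory Submission
  imports Defs "HOL-Complex_Analysis.Great_Picard"
begin

section \<open>Completeness of $L^2$\<close>

text \<open>A strip is not closed under addition, so every sum of two of its points costs width.
  Discrete spectrum is the statement known not to depend on the width
  (\<open>Kronecker_strip_width\<close>), and for this reason every implication between different
  \<open>b\<close> passes through it.

  Compactness of an orbit closure becomes the existence of finite nets because L^2 is complete, and
  for indicators the squared L^2 distance equals the L^1 distance.

  The obstacle on the way to equicontinuity is that a net in L^1 controls only averages over x, with
  an exceptional set that varies with w, and infinitely many such sets cannot be discarded. The
  function h removes this: its values at T^w x and T^v x are close outside a single null set, so
  only the finitely many h o T^v of a net need Lusin's theorem. The constant C may be large, since
  the net is chosen after h. A bound for \<open>dhat\<close> concerns all k at once, so the error
  |1_B - h| calls for a maximal inequality instead of convergence of averages.\<close>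

lemma L1_Cauchy_AE_convergent_subseq:
  fixes u :: "nat \<Rightarrow> 'a \<Rightarrow> 'b::{banach, second_countable_topology}"
  assumes int [measurable]: "\<And>n. integrable M (u n)"
    and Cauchy: "\<And>e. e > 0 \<Longrightarrow> \<exists>N. \<forall>m\<ge>N. \<forall>n\<ge>N. (\<integral>x. norm (u m x - u n x) \<partial>M) < e"
  obtains r :: "nat \<Rightarrow> nat" where "strict_mono r" "AE x in M. convergent (\<lambda>n. u (r n) x)"
proof -
  have "\<exists>N. \<forall>m\<ge>N. \<forall>n\<ge>N. (\<integral>x. norm (u m x - u n x) \<partial>M) < (1/2)^i" for i :: nat
    by (rule Cauchy) simp
  then obtain N where N: "\<And>i m n. m \<ge> N i \<Longrightarrow> n \<ge> N i \<Longrightarrow> (\<integral>x. norm (u m x - u n x) \<partial>M) < (1/2)^i"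
    by metis
  \<comment> \<open>Riesz-Fischer: along \<open>r\<close> consecutive L^1 distances are at most
    2^-n, so the telescoping series converges absolutely almost everywhere. The maximum in the
    recursion makes \<open>r\<close> strictly increasing and \<open>r n\<close> at least
    \<open>N n\<close>.\<close>
  define r where "r = rec_nat (N 0) (\<lambda>n p. max (N (Suc n)) (Suc p))"
  have rSuc: "r (Suc n) = max (N (Suc n)) (Suc (r n))" for n by (simp add: r_def)
  have r: "strict_mono r" unfolding strict_mono_Suc_iff rSuc by (simp add: less_max_iff_disj)
  have rN: "r n \<ge> N n" for n by (cases n) (auto simp: r_def)
  define v where "v = (\<lambda>n x. u (r (Suc n)) x - u (r n) x)"
  have vint [measurable]: "integrable M (v n)" for n unfolding v_def using int by auto
  have "(\<integral>\<^sup>+x. ennreal (norm (v n x)) \<partial>M) \<le> ennreal ((1/2)^n)" for n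
  proof -
    have "r (Suc n) \<ge> N n" using rN[of n] rSuc[of n] by linarith
    hence "(\<integral>x. norm (v n x) \<partial>M) \<le> (1/2)^n" unfolding v_def using N[OF _ rN] by (simp add: less_imp_le)
    thus ?thesis by (subst nn_integral_eq_integral) (auto intro!: ennreal_leI vint)
  qed
  hence "(\<Sum>n. \<integral>\<^sup>+x. ennreal (norm (v n x)) \<partial>M) \<le> (\<Sum>n. ennreal ((1/2)^n))"
    by (intro suminf_le) auto
  also have "\<dots> = ennreal (\<Sum>n. (1/2)^n)"
    by (rule suminf_ennreal2) (auto intro!: summable_geometric)
  also have "\<dots> < \<infinity>" by simp
  finally have "(\<Sum>n. \<integral>\<^sup>+x. ennreal (norm (v n x)) \<partial>M) \<noteq> \<infinity>" by (rule less_imp_neq)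
  moreover have "(\<integral>\<^sup>+x. (\<Sum>n. ennreal (norm (v n x))) \<partial>M) = (\<Sum>n. \<integral>\<^sup>+x. ennreal (norm (v n x)) \<partial>M)"
    by (rule nn_integral_suminf) measurable
  ultimately have "AE x in M. (\<Sum>n. ennreal (norm (v n x))) \<noteq> \<infinity>"
    by (intro nn_integral_noteq_infinite) auto
  hence "AE x in M. convergent (\<lambda>n. u (r n) x)"
  proof (rule AE_mp, intro AE_I2 impI)
    fix x assume "(\<Sum>n. ennreal (norm (v n x))) \<noteq> \<infinity>"
    hence "summable (\<lambda>n. norm (v n x))" by (intro summable_suminf_not_top) auto
    hence "convergent (\<lambda>n. \<Sum>i<n. v i x)" using summable_norm_cancel[of "\<lambda>n. v n x"] unfolding summable_iff_convergent by simp
    moreover have "(\<Sum>i<n. v i x) = u (r n) x - u (r 0) x" for n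
      unfolding v_def by (rule sum_lessThan_telescope)
    ultimately have "convergent (\<lambda>n. (u (r n) x - u (r 0) x) + u (r 0) x)"
      by (intro convergent_add convergent_const) auto
    thus "convergent (\<lambda>n. u (r n) x)" by simp
  qed
  thus thesis using r that by blast
qed

text \<open>The arithmetic-geometric mean inequality, pointwise. Leaving \<open>t\<close> free gives
  integrability at once and, after optimising, Cauchy-Schwarz against the constant 1 in the next
  lemma.\<close>

lemma (in prob_space) integral_norm_le_eps:
  fixes f :: "'a \<Rightarrow> 'b::{banach, second_countable_topology}"
  assumes [measurable]: "f \<in> borel_measurable M" and i: "integrable M (\<lambda>x. (norm (f x))\<^sup>2)"
    and "t > 0"
  shows "integrable M f" "(\<integral>x. norm (f x) \<partial>M) \<le> t / 2 + (\<integral>x. (norm (f x))\<^sup>2 \<partial>M) / (2 * t)"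
proof -
  have le: "norm (f x) \<le> t / 2 + (norm (f x))\<^sup>2 / (2 * t)" for x
  proof -
    have "0 \<le> (norm (f x) - t)\<^sup>2" by simp
    thus ?thesis using \<open>t > 0\<close> by (simp add: power2_eq_square field_simps)
  qed
  have j: "integrable M (\<lambda>x. t / 2 + (norm (f x))\<^sup>2 / (2 * t))" using i by auto
  show f: "integrable M f"
    by (rule Bochner_Integration.integrable_bound[OF j]) (auto intro!: order_trans[OF le])
  have "(\<integral>x. norm (f x) \<partial>M) \<le> (\<integral>x. t / 2 + (norm (f x))\<^sup>2 / (2 * t) \<partial>M)"
    by (intro integral_mono j le integrable_norm f)
  thus "(\<integral>x. norm (f x) \<partial>M) \<le> t / 2 + (\<integral>x. (norm (f x))\<^sup>2 \<partial>M) / (2 * t)"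
    using i by (simp add: prob_space)
qed

lemma (in prob_space) integral_norm_le_sqrt:
  fixes f :: "'a \<Rightarrow> 'b::{banach, second_countable_topology}"
  assumes "f \<in> borel_measurable M" "integrable M (\<lambda>x. (norm (f x))\<^sup>2)"
  shows "(\<integral>x. norm (f x) \<partial>M) \<le> sqrt (\<integral>x. (norm (f x))\<^sup>2 \<partial>M)"
proof (rule field_le_epsilon)
  fix e :: real assume "e > 0"
  define A where "A = (\<integral>x. (norm (f x))\<^sup>2 \<partial>M)"
  \<comment> \<open>The optimal value is \<open>sqrt A\<close>; the extra \<open>e\<close> keeps
    \<open>t\<close> positive when \<open>A = 0\<close>.\<close>
  define t where "t = sqrt A + e"
  have A: "A \<ge> 0" by (simp add: A_def)
  have t: "t > 0" using A \<open>e > 0\<close> by (simp add: t_def add_nonneg_pos)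
  have "A \<le> t * t" using A \<open>e > 0\<close> by (simp add: t_def algebra_simps)
  hence "A / (2 * t) \<le> t / 2" using t by (simp add: field_simps)
  with integral_norm_le_eps(2)[OF assms t] have "(\<integral>x. norm (f x) \<partial>M) \<le> t"
    unfolding A_def by linarith
  thus "(\<integral>x. norm (f x) \<partial>M) \<le> sqrt (\<integral>x. (norm (f x))\<^sup>2 \<partial>M) + e"
    unfolding A_def t_def .
qed

text \<open>Completeness is what lets \<open>Kronecker_strip_iff\<close> replace compact closure by
  total boundedness. A Cauchy sequence in L^2 is Cauchy in L^1, hence converges almost everywhere
  along a subsequence, and Fatou's lemma identifies the limit in L^2.\<close>

lemma mcomplete_L2:
  assumes "prob_space M"
  shows "Metric_space.mcomplete (L2_space M) (L2_dist M)"
proof -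
  interpret prob_space M by fact
  interpret L2: Metric_space "L2_space M" "L2_dist M" by (rule Metric_space_L2)
  show ?thesis unfolding L2.mcomplete_def
  proof (intro allI impI)
    fix \<sigma> assume \<sigma>: "L2.MCauchy \<sigma>"
    hence "\<sigma> n \<in> L2_space M" for n
      unfolding L2.MCauchy_def by (simp add: subset_eq)
    hence "\<forall>n. \<exists>f. f \<in> L2_funs M \<and> \<sigma> n = L2_class M f"
      unfolding L2_space_def image_iff by blast
    then obtain f where f: "\<And>n. f n \<in> L2_funs M" and \<sigma>f: "\<And>n. \<sigma> n = L2_class M (f n)" by metis
    have fm [measurable]: "f n \<in> borel_measurable M" for n using f[of n] by (simp add: L2_funs_def)
    have fi: "integrable M (\<lambda>x. (cmod (f n x))\<^sup>2)" for n using f[of n] by (simp add: L2_funs_def)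
    have di: "integrable M (\<lambda>x. (cmod (f m x - f n x))\<^sup>2)" for m n
      using L2_funs_diff[OF f f] by (simp add: L2_funs_def)
    have d: "L2_dist M (\<sigma> m) (\<sigma> n) = sqrt (\<integral>x. (cmod (f m x - f n x))\<^sup>2 \<partial>M)" for m n
      unfolding \<sigma>f by (rule L2_dist_class[OF f f])
    have C: "\<exists>N. \<forall>m\<ge>N. \<forall>n\<ge>N. L2_dist M (\<sigma> m) (\<sigma> n) < e" if e: "e > 0" for e
    proof -
      have "\<forall>e>0. \<exists>N. \<forall>m n. N \<le> m \<longrightarrow> N \<le> n \<longrightarrow> L2_dist M (\<sigma> m) (\<sigma> n) < e"
        using \<sigma> unfolding L2.MCauchy_def by (rule conjunct2)
      note this[rule_format, OF e]
      thus ?thesis by (rule ex_forward) simp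
    qed
    have int: "integrable M (f n)" for n
      by (rule integral_norm_le_eps(1)[of _ 1]) (use fi in auto)
    have le: "(\<integral>x. cmod (f m x - f n x) \<partial>M) \<le> L2_dist M (\<sigma> m) (\<sigma> n)" for m n
      unfolding d by (rule integral_norm_le_sqrt) (use di in auto)
    have "\<exists>N. \<forall>m\<ge>N. \<forall>n\<ge>N. (\<integral>x. cmod (f m x - f n x) \<partial>M) < e" if e: "e > 0" for e
    proof -
      obtain N where "\<forall>m\<ge>N. \<forall>n\<ge>N. L2_dist M (\<sigma> m) (\<sigma> n) < e" using C[OF e] ..
      thus ?thesis by (intro exI[of _ N] allI impI le_less_trans[OF le]) simp
    qed
    from L1_Cauchy_AE_convergent_subseq[OF int this]
    obtain r where r: "strict_mono r" and conv: "AE x in M. convergent (\<lambda>n. f (r n) x)" by blast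
    define g where "g = (\<lambda>x. lim (\<lambda>n. f (r n) x))"
    have [measurable]: "g \<in> borel_measurable M" unfolding g_def by measurable
    \<comment> \<open>Fatou's lemma along the subsequence. The bound is used with
      \<open>e = 1\<close> to put \<open>g\<close> into L^2 and with \<open>e / 2\<close> for the
      convergence.\<close>
    have bound: "(\<integral>\<^sup>+x. ennreal ((cmod (f n x - g x))\<^sup>2) \<partial>M) \<le> ennreal (e\<^sup>2)"
      if "e > 0" and N: "\<forall>m\<ge>N. \<forall>n\<ge>N. L2_dist M (\<sigma> m) (\<sigma> n) < e" and "n \<ge> N" for e N n
    proof -
      have "(\<integral>\<^sup>+x. ennreal ((cmod (f n x - g x))\<^sup>2) \<partial>M)
          = (\<integral>\<^sup>+x. liminf (\<lambda>i. ennreal ((cmod (f n x - f (r i) x))\<^sup>2)) \<partial>M)"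
      proof (rule nn_integral_cong_AE)
        show "AE x in M. ennreal ((cmod (f n x - g x))\<^sup>2) = liminf (\<lambda>i. ennreal ((cmod (f n x - f (r i) x))\<^sup>2))"
          using conv
        proof (rule AE_mp, intro AE_I2 impI)
          fix x assume "convergent (\<lambda>n. f (r n) x)"
          hence "(\<lambda>i. f (r i) x) \<longlonglongrightarrow> g x" by (simp add: g_def convergent_LIMSEQ_iff)
          hence "(\<lambda>i. ennreal ((cmod (f n x - f (r i) x))\<^sup>2)) \<longlonglongrightarrow> ennreal ((cmod (f n x - g x))\<^sup>2)"
            by (intro tendsto_intros)
          thus "ennreal ((cmod (f n x - g x))\<^sup>2) = liminf (\<lambda>i. ennreal ((cmod (f n x - f (r i) x))\<^sup>2))"
            by (rule lim_imp_Liminf[OF sequentially_bot, symmetric])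
        qed
      qed
      also have "\<dots> \<le> liminf (\<lambda>i. \<integral>\<^sup>+x. ennreal ((cmod (f n x - f (r i) x))\<^sup>2) \<partial>M)"
        by (rule nn_integral_liminf) measurable
      also have "\<dots> \<le> liminf (\<lambda>i. ennreal (e\<^sup>2))"
      proof (rule Liminf_mono, rule eventually_mono[OF eventually_ge_at_top[of N]])
        fix i assume "i \<ge> N"
        hence "r i \<ge> N" using seq_suble[OF r, of i] by linarith
        hence "sqrt (\<integral>x. (cmod (f n x - f (r i) x))\<^sup>2 \<partial>M) < e" using N \<open>n \<ge> N\<close> d by auto
        hence "(\<integral>x. (cmod (f n x - f (r i) x))\<^sup>2 \<partial>M) \<le> e\<^sup>2"
          using sqrt_le_D by fastforce
        thus "(\<integral>\<^sup>+x. ennreal ((cmod (f n x - f (r i) x))\<^sup>2) \<partial>M) \<le> ennreal (e\<^sup>2)"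
          by (subst nn_integral_eq_integral[OF di]) (auto intro!: ennreal_leI)
      qed
      finally show ?thesis by (simp add: Liminf_const)
    qed
    have g: "g \<in> L2_funs M"
    proof -
      obtain N where N: "\<forall>m\<ge>N. \<forall>n\<ge>N. L2_dist M (\<sigma> m) (\<sigma> n) < 1" using C[of 1] by auto
      have "integrable M (\<lambda>x. (cmod (f N x - g x))\<^sup>2)"
        by (rule integrableI_bounded) (use bound[OF _ N, of N] in \<open>auto simp: le_less_trans\<close>)
      hence "(\<lambda>x. f N x - g x) \<in> L2_funs M" by (simp add: L2_funs_def)
      from L2_funs_diff[OF f[of N] this] show ?thesis by simp
    qed
    have "limitin L2.mtopology \<sigma> (L2_class M g) sequentially"
      unfolding L2.limit_metric_sequentially
    proof (intro conjI allI impI)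
      show "L2_class M g \<in> L2_space M" using g by (auto simp: L2_space_def)
      fix e :: real assume "e > 0"
      then obtain N where N: "\<forall>m\<ge>N. \<forall>n\<ge>N. L2_dist M (\<sigma> m) (\<sigma> n) < e/2" using C[of "e/2"] by auto
      show "\<exists>N. \<forall>n\<ge>N. \<sigma> n \<in> L2_space M \<and> L2_dist M (\<sigma> n) (L2_class M g) < e"
      proof (intro exI[of _ N] allI impI conjI)
        fix n assume "n \<ge> N"
        show "\<sigma> n \<in> L2_space M" using f \<sigma>f by (auto simp: L2_space_def)
        have i: "integrable M (\<lambda>x. (cmod (f n x - g x))\<^sup>2)"
          using L2_funs_diff[OF f g] by (simp add: L2_funs_def)
        have "(\<integral>x. (cmod (f n x - g x))\<^sup>2 \<partial>M) \<le> (e/2)\<^sup>2"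
          using bound[OF _ N \<open>n \<ge> N\<close>] \<open>e > 0\<close> nn_integral_eq_integral[OF i] by simp
        hence "L2_dist M (\<sigma> n) (L2_class M g) \<le> e / 2"
          using \<open>e > 0\<close> unfolding \<sigma>f L2_dist_class[OF f g] by (intro real_le_lsqrt) auto
        thus "L2_dist M (\<sigma> n) (L2_class M g) < e" using \<open>e > 0\<close> by linarith
      qed
    qed
    thus "\<exists>x. limitin L2.mtopology \<sigma> x sequentially" by blast
  qed
qed

section \<open>Lipschitz functions in $L^1$ and Lusin's theorem\<close>

text \<open>A Lipschitz constant, more than continuity, turns a bound on \<open>dbar\<close> into a
  bound on the mean of |f(T^w x) - f(T^w y)| over the strip; boundedness gives
  integrability.\<close>

definition Lipschitz_bounded :: "('a::metric_space \<Rightarrow> real) \<Rightarrow> bool" where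
  "Lipschitz_bounded g \<longleftrightarrow> (\<exists>L\<ge>0. \<forall>x y. \<bar>g x - g y\<bar> \<le> L * dist x y) \<and> (\<exists>B. \<forall>x. \<bar>g x\<bar> \<le> B)"

lemma Lipschitz_bounded_continuous:
  assumes "Lipschitz_bounded g"
  shows "continuous_on UNIV g"
proof -
  obtain L where L: "L \<ge> 0" "\<And>x y. \<bar>g x - g y\<bar> \<le> L * dist x y"
    using assms by (auto simp: Lipschitz_bounded_def)
  hence "L-lipschitz_on UNIV g" by (intro lipschitz_onI) (auto simp: dist_real_def)
  thus ?thesis by (rule lipschitz_on_continuous_on)
qed

lemma Lipschitz_bounded_const: "Lipschitz_bounded (\<lambda>x. c)"
  by (auto simp: Lipschitz_bounded_def intro: exI[of _ "0::real"])

lemma Lipschitz_bounded_add: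
  assumes "Lipschitz_bounded f" "Lipschitz_bounded g"
  shows "Lipschitz_bounded (\<lambda>x. f x + g x)"
proof -
  obtain L B where f: "L \<ge> 0" "\<And>x y. \<bar>f x - f y\<bar> \<le> L * dist x y" "\<And>x. \<bar>f x\<bar> \<le> B"
    using assms(1) by (auto simp: Lipschitz_bounded_def)
  obtain K C where g: "K \<ge> 0" "\<And>x y. \<bar>g x - g y\<bar> \<le> K * dist x y" "\<And>x. \<bar>g x\<bar> \<le> C"
    using assms(2) by (auto simp: Lipschitz_bounded_def)
  have "\<bar>(f x + g x) - (f y + g y)\<bar> \<le> (L + K) * dist x y" for x y
    using f(2)[of x y] g(2)[of x y] by (simp add: algebra_simps)
  moreover have "\<bar>f x + g x\<bar> \<le> B + C" for x using f(3)[of x] g(3)[of x] by linarith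
  ultimately show ?thesis unfolding Lipschitz_bounded_def using f(1) g(1) by (meson add_nonneg_nonneg)
qed

lemma Lipschitz_bounded_cmult:
  assumes "Lipschitz_bounded f"
  shows "Lipschitz_bounded (\<lambda>x. c * f x)"
proof -
  obtain L B where f: "L \<ge> 0" "\<And>x y. \<bar>f x - f y\<bar> \<le> L * dist x y" "\<And>x. \<bar>f x\<bar> \<le> B"
    using assms by (auto simp: Lipschitz_bounded_def)
  have "\<bar>c * f x - c * f y\<bar> \<le> (\<bar>c\<bar> * L) * dist x y" for x y
    using mult_left_mono[OF f(2)[of x y], of "\<bar>c\<bar>"] by (simp add: abs_mult[symmetric] algebra_simps)
  moreover have "\<bar>c * f x\<bar> \<le> \<bar>c\<bar> * B" for x
    using mult_left_mono[OF f(3)[of x], of "\<bar>c\<bar>"] by (simp add: abs_mult)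
  ultimately show ?thesis unfolding Lipschitz_bounded_def using f(1) by (meson abs_ge_zero mult_nonneg_nonneg)
qed

locale borel_prob = prob_space M for M :: "'a::metric_space measure" +
  assumes sets_M: "sets M = sets borel"
begin

lemma space_M [simp]: "space M = UNIV"
  using sets_M by (metis sets_eq_imp_space_eq space_borel)

lemma prob_UNIV [simp]: "prob UNIV = 1"
  using prob_space by simp

lemma borel_measurable_M: "f \<in> borel_measurable borel \<Longrightarrow> f \<in> borel_measurable M"
  using measurable_cong_sets[OF sets_M refl] by blast

lemma integrable_ind: "A \<in> sets M \<Longrightarrow> integrable M (indicat_real A)"
  by (rule integrable_real_indicator) (auto simp: less_top[symmetric])

lemma Lipschitz_bounded_integrable:
  assumes "Lipschitz_bounded g"
  shows "g \<in> borel_measurable M" "integrable M g"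
proof -
  show m: "g \<in> borel_measurable M"
    by (intro borel_measurable_M borel_measurable_continuous_onI Lipschitz_bounded_continuous assms)
  obtain B where "\<And>x. \<bar>g x\<bar> \<le> B" using assms by (auto simp: Lipschitz_bounded_def)
  thus "integrable M g" using m by (intro integrable_const_bound[of _ B]) auto
qed

lemma open_indicator_Lipschitz_L1:
  assumes "open U" "e > 0"
  shows "\<exists>g. Lipschitz_bounded g \<and> (\<integral>x. \<bar>indicator U x - g x\<bar> \<partial>M) < e"
\<comment> \<open>\<open>infdist x {}\<close> is 0 by definition, so the functions
  \<open>g n\<close> below would vanish for the whole space.\<close>
proof (cases "U = UNIV")
  case True
  thus ?thesis using assms by (intro exI[of _ "\<lambda>x. 1"]) (auto simp: Lipschitz_bounded_const)
next
  case False
  \<comment> \<open>These increase to the indicator of \<open>U\<close>: a point of \<open>U\<close>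
    has positive distance to the closed complement.\<close>
  define g where "g = (\<lambda>n x. min 1 (real n * infdist x (- U)))"
  have g: "Lipschitz_bounded (g n)" for n
  proof -
    have "\<bar>g n x - g n y\<bar> \<le> real n * dist x y" for x y
    proof -
      have "\<bar>g n x - g n y\<bar> \<le> \<bar>real n * infdist x (- U) - real n * infdist y (- U)\<bar>"
        by (simp add: g_def min_def)
      also have "\<dots> = real n * \<bar>infdist x (- U) - infdist y (- U)\<bar>"
        by (simp add: abs_mult right_diff_distrib[symmetric])
      also have "\<dots> \<le> real n * dist x y" by (intro mult_left_mono infdist_triangle_abs) auto
      finally show ?thesis .
    qed
    moreover have "\<bar>g n x\<bar> \<le> 1" for x by (simp add: g_def infdist_nonneg min_def)
    ultimately show ?thesis unfolding Lipschitz_bounded_def by (meson of_nat_0_le_iff)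
  qed
  have "(\<lambda>n. \<integral>x. \<bar>indicator U x - g n x\<bar> \<partial>M) \<longlonglongrightarrow> (\<integral>x. 0 \<partial>M)"
  proof (rule integral_dominated_convergence[where w = "\<lambda>x. 2"])
    have "U \<in> sets M" using assms sets_M by auto
    thus "(\<lambda>x. \<bar>indicator U x - g n x\<bar>) \<in> borel_measurable M" for n
      using Lipschitz_bounded_integrable[OF g] by (intro measurable) auto
    show "AE x in M. norm \<bar>indicator U x - g n x\<bar> \<le> 2" for n
    proof (intro AE_I2)
      fix x
      have "0 \<le> g n x" "g n x \<le> 1" by (auto simp: g_def infdist_nonneg)
      moreover have "0 \<le> indicat_real U x" "indicat_real U x \<le> 1" by (auto simp: indicator_def)
      ultimately show "norm \<bar>indicator U x - g n x\<bar> \<le> 2" unfolding real_norm_def abs_abs abs_le_iff by linarith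
    qed
    show "AE x in M. (\<lambda>n. \<bar>indicator U x - g n x\<bar>) \<longlonglongrightarrow> 0"
    proof (intro AE_I2)
      fix x
      show "(\<lambda>n. \<bar>indicator U x - g n x\<bar>) \<longlonglongrightarrow> 0"
      proof (cases "x \<in> U")
        case True
        have "infdist x (- U) \<noteq> 0"
          using in_closed_iff_infdist_zero[of "- U" x] True False assms by auto
        hence pos: "infdist x (- U) > 0" using infdist_nonneg[of x "- U"] by linarith
        obtain N :: nat where "N * infdist x (- U) > 1" using pos reals_Archimedean3 by blast
        hence "g n x = 1" if "n \<ge> N" for n
        proof -
          have "real N * infdist x (- U) \<le> real n * infdist x (- U)"
            using that pos by (intro mult_right_mono) auto
          thus ?thesis using \<open>N * infdist x (- U) > 1\<close> by (simp add: g_def)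
        qed
        thus ?thesis using True
          by (intro tendsto_eventually) (auto simp: eventually_sequentially intro!: exI[of _ N])
      next
        case False
        hence "g n x = 0" for n by (simp add: g_def)
        thus ?thesis using False by simp
      qed
    qed
  qed auto
  hence "eventually (\<lambda>n. (\<integral>x. \<bar>indicator U x - g n x\<bar> \<partial>M) < e) sequentially"
    using assms(2) by (intro order_tendstoD) auto
  thus ?thesis using g eventually_happens'[OF sequentially_bot] by fast
qed

lemma Lipschitz_L1_close:
  assumes "integrable M (f :: 'a \<Rightarrow> real)" "integrable M f'" "Lipschitz_bounded g"
    and "(\<integral>x. \<bar>f x - f' x\<bar> \<partial>M) < e / 2" "(\<integral>x. \<bar>f' x - g x\<bar> \<partial>M) < e / 2"
  shows "(\<integral>x. \<bar>f x - g x\<bar> \<partial>M) < e"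
proof -
  note g = Lipschitz_bounded_integrable[OF assms(3)]
  have "(\<integral>x. \<bar>f x - g x\<bar> \<partial>M) \<le> (\<integral>x. \<bar>f x - f' x\<bar> + \<bar>f' x - g x\<bar> \<partial>M)"
    using assms g by (intro integral_mono) auto
  also have "\<dots> = (\<integral>x. \<bar>f x - f' x\<bar> \<partial>M) + (\<integral>x. \<bar>f' x - g x\<bar> \<partial>M)"
    using assms g by (intro Bochner_Integration.integral_add) auto
  finally show ?thesis using assms by linarith
qed

lemma Lipschitz_L1_add:
  assumes "integrable M f" "\<And>e. e > 0 \<Longrightarrow> \<exists>g. Lipschitz_bounded g \<and> (\<integral>x. \<bar>f x - g x\<bar> \<partial>M) < e"
    and "integrable M f'" "\<And>e. e > 0 \<Longrightarrow> \<exists>g. Lipschitz_bounded g \<and> (\<integral>x. \<bar>f' x - g x\<bar> \<partial>M) < e"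
    and "e > 0"
  shows "\<exists>g. Lipschitz_bounded g \<and> (\<integral>x. \<bar>(f x + f' x) - g x\<bar> \<partial>M) < e"
proof -
  obtain g where g: "Lipschitz_bounded g" "(\<integral>x. \<bar>f x - g x\<bar> \<partial>M) < e / 2" using assms(2)[of "e/2"] \<open>e > 0\<close> by auto
  obtain g' where g': "Lipschitz_bounded g'" "(\<integral>x. \<bar>f' x - g' x\<bar> \<partial>M) < e / 2" using assms(4)[of "e/2"] \<open>e > 0\<close> by auto
  note i = Lipschitz_bounded_integrable[OF g(1)] Lipschitz_bounded_integrable[OF g'(1)]
  have "(\<integral>x. \<bar>(f x + f' x) - (g x + g' x)\<bar> \<partial>M) \<le> (\<integral>x. \<bar>f x - g x\<bar> + \<bar>f' x - g' x\<bar> \<partial>M)"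
    using assms i by (intro integral_mono) auto
  also have "\<dots> = (\<integral>x. \<bar>f x - g x\<bar> \<partial>M) + (\<integral>x. \<bar>f' x - g' x\<bar> \<partial>M)"
    using assms i by (intro Bochner_Integration.integral_add) auto
  finally show ?thesis using g g' Lipschitz_bounded_add[OF g(1) g'(1)]
    by (intro exI[of _ "\<lambda>x. g x + g' x"]) auto
qed

lemma Lipschitz_L1_cmult:
  assumes "integrable M f" "\<And>e. e > 0 \<Longrightarrow> \<exists>g. Lipschitz_bounded g \<and> (\<integral>x. \<bar>f x - g x\<bar> \<partial>M) < e"
    and "e > 0"
  shows "\<exists>g. Lipschitz_bounded g \<and> (\<integral>x. \<bar>c * f x - g x\<bar> \<partial>M) < e"
proof -
  obtain g where g: "Lipschitz_bounded g" "(\<integral>x. \<bar>f x - g x\<bar> \<partial>M) < e / (\<bar>c\<bar> + 1)"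
    using assms(2)[of "e / (\<bar>c\<bar> + 1)"] \<open>e > 0\<close> by auto
  have "(\<integral>x. \<bar>c * f x - c * g x\<bar> \<partial>M) = \<bar>c\<bar> * (\<integral>x. \<bar>f x - g x\<bar> \<partial>M)"
    by (simp add: right_diff_distrib[symmetric] abs_mult)
  also have "\<dots> \<le> \<bar>c\<bar> * (e / (\<bar>c\<bar> + 1))" using g by (intro mult_left_mono) auto
  also have "\<dots> < e" using \<open>e > 0\<close> by (simp add: field_simps)
  finally show ?thesis using Lipschitz_bounded_cmult[OF g(1)] by blast
qed

text \<open>Dynkin's argument: open sets are stable under intersection and generate the Borel sets,
  while approximability survives complements, as 1 minus the indicator, and countable disjoint
  unions, as limits of partial sums.\<close>

lemma indicator_Lipschitz_L1:
  assumes "A \<in> sets borel" "e > 0"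
  shows "\<exists>g. Lipschitz_bounded g \<and> (\<integral>x. \<bar>indicator A x - g x\<bar> \<partial>M) < e"
proof -
  have A: "A \<in> sigma_sets UNIV {S. open S}" using assms(1) by (simp add: borel_def)
  have "Int_stable {S::'a set. open S}" "{S::'a set. open S} \<subseteq> Pow UNIV"
    by (auto simp: Int_stable_def)
  from this A have "\<forall>e>0. \<exists>g. Lipschitz_bounded g \<and> (\<integral>x. \<bar>indicator A x - g x\<bar> \<partial>M) < e"
  proof (induction rule: sigma_sets_induct_disjoint)
    case (basic A)
    thus ?case using open_indicator_Lipschitz_L1 by auto
  next
    case empty
    thus ?case using open_indicator_Lipschitz_L1[of "{}"] by auto
  next
    case (compl A)
    hence A: "A \<in> sets M" unfolding sets_M borel_def by simp
    show ?case
    proof (intro allI impI)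
      fix e :: real assume "e > 0"
      have "\<exists>g. Lipschitz_bounded g \<and> (\<integral>x. \<bar>1 + (- 1) * indicator A x - g x\<bar> \<partial>M) < e"
      proof (rule Lipschitz_L1_add[OF _ _ _ _ \<open>e > 0\<close>])
        show "\<exists>g. Lipschitz_bounded g \<and> (\<integral>x. \<bar>1 - g x\<bar> \<partial>M) < e" if "e > 0" for e
          using that by (intro exI[of _ "\<lambda>x. 1"]) (auto simp: Lipschitz_bounded_const)
        show "\<exists>g. Lipschitz_bounded g \<and> (\<integral>x. \<bar>- 1 * indicat_real A x - g x\<bar> \<partial>M) < e" if "e > 0" for e
          by (rule Lipschitz_L1_cmult) (use A compl that in \<open>auto intro: integrable_const_bound[of _ 1]\<close>)
      qed (use A in \<open>auto intro!: integrable_ind\<close>)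
      moreover have "indicator (UNIV - A) x = 1 + (- 1) * indicat_real A x" for x by (simp add: indicator_def)
      ultimately show "\<exists>g. Lipschitz_bounded g \<and> (\<integral>x. \<bar>indicator (UNIV - A) x - g x\<bar> \<partial>M) < e" by simp
    qed
  next
    case (union A)
    hence A: "A i \<in> sets M" for i unfolding sets_M borel_def by auto
    hence int: "integrable M (indicat_real (A i))" for i by (intro integrable_ind A)
    have sum: "\<exists>g. Lipschitz_bounded g \<and> (\<integral>x. \<bar>(\<Sum>i<n. indicat_real (A i) x) - g x\<bar> \<partial>M) < e" if "e > 0" for n e
      using that
    proof (induction n arbitrary: e)
      case 0
      thus ?case by (intro exI[of _ "\<lambda>x. 0"]) (auto simp: Lipschitz_bounded_const)
    next
      case (Suc n)
      show ?case unfolding sum.lessThan_Suc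
        by (rule Lipschitz_L1_add) (use Suc union int in auto)
    qed
    show ?case
    proof (intro allI impI)
      fix e :: real assume "e > 0"
      have "(\<lambda>n. \<integral>x. \<bar>indicator (\<Union>i. A i) x - (\<Sum>i<n. indicat_real (A i) x)\<bar> \<partial>M) \<longlonglongrightarrow> (\<integral>x. 0 \<partial>M)"
      proof (rule integral_dominated_convergence[where w = "\<lambda>x. 1"])
        have ind: "(\<Sum>i<n. indicat_real (A i) x) = indicator (\<Union>i<n. A i) x" for n x
          using union(1) by (subst indicator_UN_disjoint) (auto simp: disjoint_family_on_def)
        show "(\<lambda>x. \<bar>indicator (\<Union>i. A i) x - (\<Sum>i<n. indicat_real (A i) x)\<bar>) \<in> borel_measurable M" for n
          using A by measurable
        show "AE x in M. norm \<bar>indicator (\<Union>i. A i) x - (\<Sum>i<n. indicat_real (A i) x)\<bar> \<le> 1" for n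
          unfolding ind by (intro AE_I2) (auto simp: indicator_def)
        show "AE x in M. (\<lambda>n. \<bar>indicator (\<Union>i. A i) x - (\<Sum>i<n. indicat_real (A i) x)\<bar>) \<longlonglongrightarrow> 0"
        proof (intro AE_I2)
          fix x
          show "(\<lambda>n. \<bar>indicator (\<Union>i. A i) x - (\<Sum>i<n. indicat_real (A i) x)\<bar>) \<longlonglongrightarrow> 0"
          proof (cases "x \<in> (\<Union>i. A i)")
            case True
            then obtain i where i: "x \<in> A i" by blast
            have "\<bar>indicator (\<Union>i. A i) x - indicat_real (\<Union>i<n. A i) x\<bar> = 0" if "n \<ge> Suc i" for n
              using that i by (auto simp: indicator_def)
            thus ?thesis unfolding ind
              by (intro tendsto_eventually) (simp only: eventually_sequentially, blast)
          qed (auto simp: ind)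
        qed
      qed auto
      hence "eventually (\<lambda>n. (\<integral>x. \<bar>indicator (\<Union>i. A i) x - (\<Sum>i<n. indicat_real (A i) x)\<bar> \<partial>M) < e / 2) sequentially"
        using \<open>e > 0\<close> by (intro order_tendstoD) auto
      then obtain n where n: "(\<integral>x. \<bar>indicator (\<Union>i. A i) x - (\<Sum>i<n. indicat_real (A i) x)\<bar> \<partial>M) < e / 2"
        using eventually_happens'[OF sequentially_bot] by fast
      obtain g where g: "Lipschitz_bounded g" "(\<integral>x. \<bar>(\<Sum>i<n. indicat_real (A i) x) - g x\<bar> \<partial>M) < e / 2"
        using sum[of "e/2" n] \<open>e > 0\<close> by auto
      have "(\<integral>x. \<bar>indicator (\<Union>i. A i) x - g x\<bar> \<partial>M) < e"
        by (rule Lipschitz_L1_close[OF _ _ g(1) n g(2)])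
          (use A in \<open>auto intro!: integrable_ind Bochner_Integration.integrable_sum int\<close>)
      thus "\<exists>g. Lipschitz_bounded g \<and> (\<integral>x. \<bar>indicator (\<Union>i. A i) x - g x\<bar> \<partial>M) < e" using g(1) by blast
    qed
  qed
  thus ?thesis using assms(2) by blast
qed

lemma Lipschitz_L1_dense:
  assumes "integrable M (f :: 'a \<Rightarrow> real)" "e > 0"
  shows "\<exists>g. Lipschitz_bounded g \<and> (\<integral>x. \<bar>f x - g x\<bar> \<partial>M) < e"
proof -
  from assms(1) have "\<forall>e>0. \<exists>g. Lipschitz_bounded g \<and> (\<integral>x. \<bar>f x - g x\<bar> \<partial>M) < e"
  proof (induction rule: integrable_induct)
    case (base A c)
    have "\<exists>g. Lipschitz_bounded g \<and> (\<integral>x. \<bar>c * indicat_real A x - g x\<bar> \<partial>M) < e" if "e > 0" for e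
      by (rule Lipschitz_L1_cmult) (use base that indicator_Lipschitz_L1 sets_M in auto)
    thus ?case by (simp add: mult.commute)
  next
    case (add f g)
    thus ?case using Lipschitz_L1_add[of f g] by blast
  next
    case (lim f s)
    show ?case
    proof (intro allI impI)
      fix e :: real assume "e > 0"
      have "(\<lambda>n. \<integral>x. \<bar>f x - s n x\<bar> \<partial>M) \<longlonglongrightarrow> (\<integral>x. 0 \<partial>M)"
      \<comment> \<open>The approximants of \<open>integrable_induct\<close> satisfy |s n x| \<le> 2
        |f x|, hence the factor 3.\<close>
      proof (rule integral_dominated_convergence[where w = "\<lambda>x. 3 * \<bar>f x\<bar>"])
        show "AE x in M. (\<lambda>n. \<bar>f x - s n x\<bar>) \<longlonglongrightarrow> 0"
        proof (intro AE_I2 tendsto_rabs_zero)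
          fix x assume "x \<in> space M"
          from tendsto_diff[OF tendsto_const[of "f x"] lim.hyps(2)[OF this]]
          show "(\<lambda>n. f x - s n x) \<longlonglongrightarrow> 0" by simp
        qed
        show "AE x in M. norm \<bar>f x - s n x\<bar> \<le> 3 * \<bar>f x\<bar>" for n
        proof (intro AE_I2)
          fix x assume "x \<in> space M"
          from lim.hyps(3)[OF this, of n] show "norm \<bar>f x - s n x\<bar> \<le> 3 * \<bar>f x\<bar>"
            using abs_triangle_ineq4[of "f x" "s n x"] by simp
        qed
      qed (use lim.hyps in auto)
      hence "eventually (\<lambda>n. (\<integral>x. \<bar>f x - s n x\<bar> \<partial>M) < e / 2) sequentially"
        using \<open>e > 0\<close> by (intro order_tendstoD) auto
      then obtain n where n: "(\<integral>x. \<bar>f x - s n x\<bar> \<partial>M) < e / 2"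
        using eventually_happens'[OF sequentially_bot] by fast
      obtain g where g: "Lipschitz_bounded g" "(\<integral>x. \<bar>s n x - g x\<bar> \<partial>M) < e / 2"
        using lim.IH[of n] \<open>e > 0\<close> by (meson half_gt_zero)
      show "\<exists>g. Lipschitz_bounded g \<and> (\<integral>x. \<bar>f x - g x\<bar> \<partial>M) < e"
        using Lipschitz_L1_close[OF lim.hyps(4) lim.hyps(1) g(1) n g(2)] g(1) by blast
    qed
  qed
  thus ?thesis using assms(2) by blast
qed

text \<open>Off a set of measure below \<open>\<tau>\<close> the function is a uniform limit of
  Lipschitz functions, whose Lipschitz constants give uniform continuity on \<open>K\<close>
  directly; \<open>K\<close> is measurable, not necessarily closed.\<close>

lemma Lusin:
  assumes f: "integrable M (f :: 'a \<Rightarrow> real)" and "\<tau> > 0"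
  shows "\<exists>K\<in>sets M. prob K > 1 - \<tau> \<and> uniformly_continuous_on K f"
proof -
  \<comment> \<open>In Markov's inequality the factor 4^-(n+1) splits into the threshold 2^-(n+1)
    and the measure \<open>\<tau>\<close> 2^-(n+1).\<close>
  have "\<exists>g. Lipschitz_bounded g \<and> (\<integral>x. \<bar>f x - g x\<bar> \<partial>M) < \<tau> * (1/4) ^ Suc n" for n
    using \<open>\<tau> > 0\<close> by (intro Lipschitz_L1_dense f) auto
  then obtain g where g: "\<And>n. Lipschitz_bounded (g n)"
    and fg: "\<And>n. (\<integral>x. \<bar>f x - g n x\<bar> \<partial>M) < \<tau> * (1/4) ^ Suc n" by metis
  note gi [measurable] = Lipschitz_bounded_integrable[OF g]
  have fm [measurable]: "f \<in> borel_measurable M" using f by auto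
  define E where "E = (\<lambda>n. {x \<in> space M. \<bar>f x - g n x\<bar> \<ge> (1/2) ^ Suc n})"
  have [measurable]: "E n \<in> sets M" for n unfolding E_def by measurable
  have E: "prob (E n) \<le> \<tau> * (1/2) ^ Suc n" for n
  proof -
    have "prob (E n) \<le> (\<integral>x. \<bar>f x - g n x\<bar> \<partial>M) / (1/2) ^ Suc n"
      unfolding E_def by (rule integral_Markov_inequality_measure[where A = "{}"]) (use f gi in auto)
    also have "\<dots> \<le> (\<tau> * (1/4) ^ Suc n) / (1/2) ^ Suc n"
      using fg[of n] by (intro divide_right_mono) auto
    also have "\<dots> = \<tau> * (1/2) ^ Suc n" by (simp add: power_divide field_simps power_mult_distrib[symmetric])
    finally show ?thesis .
  qed
  \<comment> \<open>Omitting \<open>E 0\<close> brings the total measure removed down to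
    \<open>\<tau> / 2\<close>, which yields the strict inequality.\<close>
  define K where "K = space M - (\<Union>n. E (Suc n))"
  have K: "K \<in> sets M" unfolding K_def by measurable
  have geo: "(\<lambda>n. \<tau> * (1/2) ^ Suc (Suc n)) sums (\<tau> * (1/2))"
  proof -
    have "(\<lambda>n. (1/2) ^ Suc n) sums (1::real)" by (rule power_half_series)
    from sums_mult[OF this, of "\<tau> * (1/2)"] show ?thesis by (simp add: mult_ac)
  qed
  have sm: "summable (\<lambda>n. prob (E (Suc n)))"
    by (rule summable_comparison_test'[OF sums_summable[OF geo], of 0]) (use E[of "Suc _"] in auto)
  have "prob (\<Union>n. E (Suc n)) \<le> (\<Sum>n. prob (E (Suc n)))"
    by (rule finite_measure_subadditive_countably[OF _ sm]) auto
  also have "\<dots> \<le> \<tau> * (1/2)"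
    unfolding sums_unique[OF geo] by (intro suminf_le sm sums_summable[OF geo] E)
  also have "\<dots> < \<tau>" using \<open>\<tau> > 0\<close> by simp
  finally have "prob K > 1 - \<tau>" unfolding K_def by (subst prob_compl) auto
  moreover have "uniformly_continuous_on K f"
    unfolding uniformly_continuous_on_def
  proof (intro allI impI)
    fix e :: real assume "e > 0"
    obtain n where n: "(1/2::real) ^ n < e / 3"
      using real_arch_pow_inv[of "e/3" "1/2"] \<open>e > 0\<close> by auto
    have close: "\<bar>f x - g (Suc n) x\<bar> < e / 3" if "x \<in> K" for x
    proof -
      have "x \<notin> E (Suc n)" using that by (auto simp: K_def)
      hence "\<bar>f x - g (Suc n) x\<bar> < (1/2) ^ Suc (Suc n)" by (simp add: E_def)
      also have "\<dots> \<le> (1/2) ^ n" by (intro power_decreasing) auto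
      finally show ?thesis using n by linarith
    qed
    obtain L where L: "L \<ge> 0" "\<And>x y. \<bar>g (Suc n) x - g (Suc n) y\<bar> \<le> L * dist x y"
      using g[of "Suc n"] by (auto simp: Lipschitz_bounded_def)
    show "\<exists>d>0. \<forall>x\<in>K. \<forall>x'\<in>K. dist x' x < d \<longrightarrow> dist (f x') (f x) < e"
    proof (intro exI[of _ "e / (3 * (L + 1))"] conjI ballI impI)
      show "e / (3 * (L + 1)) > 0" using L \<open>e > 0\<close> by simp
      fix x y assume xy: "x \<in> K" "y \<in> K" "dist y x < e / (3 * (L + 1))"
      have "\<bar>g (Suc n) y - g (Suc n) x\<bar> \<le> (L + 1) * dist y x"
        using L(2)[of y x] zero_le_dist[of y x] unfolding distrib_right by linarith
      also have "\<dots> < e / 3" using xy(3) L(1) by (simp add: field_simps)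
      finally have "\<bar>g (Suc n) y - g (Suc n) x\<bar> < e / 3" .
      thus "dist (f y) (f x) < e"
        using close[OF xy(1)] close[OF xy(2)] unfolding dist_real_def by linarith
    qed
  qed
  ultimately show ?thesis using K by blast
qed

end

section \<open>Strips, return times and a maximal inequality\<close>

text \<open>Pigeonhole principle: take a fibre of maximal size.\<close>

lemma card_le_card_fibre:
  assumes "finite A" "finite Y" "f ` A \<subseteq> Y" "A \<noteq> {}"
  obtains y where "y \<in> Y" "{a \<in> A. f a = y} \<noteq> {}" "card A \<le> card Y * card {a \<in> A. f a = y}"
proof -
  define g where "g = (\<lambda>y. card {a \<in> A. f a = y})"
  have "Y \<noteq> {}" using assms by blast
  then obtain y where y: "y \<in> Y" "\<And>z. z \<in> Y \<Longrightarrow> g z \<le> g y"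
  proof -
    have "Max (g ` Y) \<in> g ` Y" using \<open>finite Y\<close> \<open>Y \<noteq> {}\<close> by (intro Max_in) auto
    then obtain y where "y \<in> Y" "g y = Max (g ` Y)" by auto
    thus thesis using \<open>finite Y\<close> by (intro that[of y]) auto
  qed
  have "card A = (\<Sum>y\<in>Y. sum (\<lambda>_. 1) {a \<in> A. f a = y})"
    by (subst sum.group) (use assms in auto)
  hence "card A = (\<Sum>y\<in>Y. g y)" by (simp add: g_def)
  also have "\<dots> \<le> card Y * g y" using sum_bounded_above[of Y g "g y"] y(2) by simp
  finally have le: "card A \<le> card Y * g y" .
  moreover have "{a \<in> A. f a = y} \<noteq> {}"
  proof
    assume e: "{a \<in> A. f a = y} = {}"
    have "g y = 0" unfolding g_def e by simp
    thus False using le assms by simp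
  qed
  ultimately show thesis using that y(1) unfolding g_def by blast
qed

text \<open>Vitali covering is not needed on the line: scan from left to right, jumping over the interval
  attached to each point of \<open>A\<close> that is met.\<close>

lemma interval_covering:
  fixes G :: "nat \<Rightarrow> real" and A :: "nat set"
  assumes G: "\<And>i. G i \<ge> 0" and "\<theta> \<ge> 0"
    and A: "\<And>m. m \<in> A \<Longrightarrow> \<exists>k\<in>{1..N}. \<theta> * real k \<le> (\<Sum>i\<in>{m..<m + k}. G i)"
  shows "\<theta> * real (card (A \<inter> {m..<R})) \<le> (\<Sum>i\<in>{m..<R + N}. G i)"
proof (induction "R - m" arbitrary: m rule: less_induct)
  case less
  show ?case
  proof (cases "m < R")
    case False
    hence "A \<inter> {m..<R} = {}" by auto
    thus ?thesis using G by (auto intro: sum_nonneg)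
  next
    case mR: True
    show ?thesis
    proof (cases "m \<in> A")
      case False
      have "\<theta> * real (card (A \<inter> {Suc m..<R})) \<le> (\<Sum>i\<in>{Suc m..<R + N}. G i)"
        by (rule less) (use mR in auto)
      moreover have "A \<inter> {m..<R} = A \<inter> {Suc m..<R}" using False by (auto simp: Suc_le_eq le_less)
      moreover have "(\<Sum>i\<in>{m..<R + N}. G i) = G m + (\<Sum>i\<in>{Suc m..<R + N}. G i)"
        using mR by (intro sum.atLeast_Suc_lessThan) auto
      ultimately show ?thesis using G[of m] by simp
    next
      case True
      then obtain k where k: "1 \<le> k" "k \<le> N" "\<theta> * real k \<le> (\<Sum>i\<in>{m..<m + k}. G i)" using A[OF True] by auto
      have IH: "\<theta> * real (card (A \<inter> {m + k..<R})) \<le> (\<Sum>i\<in>{m + k..<R + N}. G i)"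
        by (rule less) (use mR k in auto)
      have "A \<inter> {m..<R} \<subseteq> {m..<m + k} \<union> (A \<inter> {m + k..<R})" by auto
      hence "card (A \<inter> {m..<R}) \<le> card ({m..<m + k} \<union> (A \<inter> {m + k..<R}))" by (intro card_mono) auto
      also have "\<dots> \<le> k + card (A \<inter> {m + k..<R})" using card_Un_le[of "{m..<m + k}"] by simp
      finally have "\<theta> * real (card (A \<inter> {m..<R})) \<le> \<theta> * (real k + real (card (A \<inter> {m + k..<R})))"
        using \<open>\<theta> \<ge> 0\<close> by (intro mult_left_mono) auto
      also have "\<dots> \<le> (\<Sum>i\<in>{m..<m + k}. G i) + (\<Sum>i\<in>{m + k..<R + N}. G i)"
        using k(3) IH by (simp add: distrib_left)
      \<comment> \<open>The jump from \<open>m < R\<close> may pass \<open>R\<close>, but by at most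
        \<open>N\<close>; hence the range up to \<open>R + N\<close>.\<close>
      also have "\<dots> = (\<Sum>i\<in>{m..<R + N}. G i)"
        using mR k by (intro sum.atLeastLessThan_concat) auto
      finally show ?thesis .
    qed
  qed
qed

text \<open>Divide by \<open>R\<close> and let \<open>R\<close> grow. This discards the boundary
  terms of the two counting arguments, in \<open>maximal_inequality\<close> and in
  \<open>bounded_complexity_imp_net\<close>.\<close>

lemma le_of_asymptotic:
  fixes a c d :: real
  assumes "\<And>R :: nat. R \<ge> 1 \<Longrightarrow> real R * a \<le> real R * c + d"
  shows "a \<le> c"
proof (rule ccontr)
  assume "\<not> a \<le> c"
  then obtain R :: nat where R: "real R * (a - c) > max d 0"
    using reals_Archimedean3[of "a - c"] by (meson diff_gt_0_iff_gt not_le)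
  hence "R \<ge> 1" by (cases R) auto
  from assms[OF this] R show False by (simp add: algebra_simps)
qed

locale Z2_system =
  fixes T :: "int \<times> int \<Rightarrow> 'a::metric_space \<Rightarrow> 'a" and \<mu> :: "'a measure" and \<beta> :: real
  assumes tds: "Z2_tds T" and inv: "\<mu> \<in> invariant_measures T"
begin

sublocale borel_prob \<mu>
  using inv by (auto simp: borel_prob_def borel_prob_axioms_def invariant_measures_def)

lemma T_add: "T (u + w) x = T u (T w x)"
proof -
  have "T (u + w) = T u \<circ> T w" using tds unfolding Z2_tds_def by blast
  thus ?thesis by simp
qed

lemma T_zero [simp]: "T 0 x = x"
  using Z2_tds_zero[OF tds] by simp

lemma continuous_T: "continuous_on UNIV (T w)"
  using tds unfolding Z2_tds_def homeomorphism_def by blast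

lemma T_measurable [measurable]: "T w \<in> measurable \<mu> \<mu>"
  by (rule distr_invariant(1)[OF tds inv])

lemma integral_T:
  fixes f :: "'a \<Rightarrow> real"
  assumes [measurable]: "f \<in> borel_measurable \<mu>"
  shows "(\<integral>x. f (T w x) \<partial>\<mu>) = (\<integral>x. f x \<partial>\<mu>)"
proof -
  have "(\<integral>x. f x \<partial>\<mu>) = (\<integral>x. f x \<partial>distr \<mu> \<mu> (T w))" by (simp add: distr_invariant(2)[OF tds inv])
  also have "\<dots> = (\<integral>x. f (T w x) \<partial>\<mu>)" by (rule integral_distr) auto
  finally show ?thesis ..
qed

lemma integrable_T:
  fixes f :: "'a \<Rightarrow> real"
  assumes f: "integrable \<mu> f"
  shows "integrable \<mu> (\<lambda>x. f (T w x))"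
proof -
  have [measurable]: "f \<in> borel_measurable \<mu>" using f by auto
  have "integrable (distr \<mu> \<mu> (T w)) f" using f by (simp add: distr_invariant(2)[OF tds inv])
  thus ?thesis by (subst (asm) integrable_distr_eq) auto
qed

lemma AE_T:
  assumes "AE x in \<mu>. P x"
  shows "AE x in \<mu>. P (T w x)"
proof (rule AE_distrD[OF T_measurable[of w]])
  show "AE x in distr \<mu> \<mu> (T w). P x" unfolding distr_invariant(2)[OF tds inv] by fact
qed

section \<open>Slabs around the line of slope \<beta>\<close>

definition offset :: "int \<times> int \<Rightarrow> real" where
  "offset w = of_int (snd w) - \<beta> * of_int (fst w)"

definition slab :: "int \<Rightarrow> int \<Rightarrow> real \<Rightarrow> (int \<times> int) set" where
  "slab l r b = {w. l \<le> fst w \<and> fst w < r \<and> \<bar>offset w\<bar> \<le> b}"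

lemma offset_add: "offset (u + w) = offset u + offset w"
  and offset_diff: "offset (u - w) = offset u - offset w"
  by (simp_all add: offset_def algebra_simps)

lemma strip_offset: "strip \<beta> b = {w. \<bar>offset w\<bar> \<le> b}"
  by (auto simp: strip_def offset_def abs_le_iff)

lemma strip_upto_slab: "strip_upto \<beta> b k = slab 0 (int k) b"
  by (auto simp: strip_upto_def strip_offset slab_def)

lemma slab_cover: "slab l r b \<subseteq> (SIGMA m : {l..<r}. {\<lceil>\<beta> * of_int m - b\<rceil>..\<lfloor>\<beta> * of_int m + b\<rfloor>})"
  by (auto simp: slab_def offset_def ceiling_le_iff le_floor_iff abs_le_iff)

lemma finite_slab [simp]: "finite (slab l r b)"
  by (rule finite_subset[OF slab_cover]) auto

lemma card_slab_le:
  assumes "l \<le> r" "b \<ge> 0"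
  shows "real (card (slab l r b)) \<le> (2 * b + 1) * of_int (r - l)"
proof -
  have col: "real (card {\<lceil>\<beta> * of_int m - b\<rceil>..\<lfloor>\<beta> * of_int m + b\<rfloor>}) \<le> 2 * b + 1" for m
  proof -
    have "of_int (\<lfloor>\<beta> * of_int m + b\<rfloor> - \<lceil>\<beta> * of_int m - b\<rceil> + 1) \<le> 2 * b + 1"
      using of_int_floor_le[of "\<beta> * of_int m + b"] le_of_int_ceiling[of "\<beta> * of_int m - b"]
      unfolding of_int_add of_int_diff of_int_1 by linarith
    thus ?thesis using assms(2) by (cases "\<lfloor>\<beta> * of_int m + b\<rfloor> - \<lceil>\<beta> * of_int m - b\<rceil> + 1 \<ge> 0") auto
  qed
  have "card (slab l r b) \<le> card (SIGMA m : {l..<r}. {\<lceil>\<beta> * of_int m - b\<rceil>..\<lfloor>\<beta> * of_int m + b\<rfloor>})"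
    by (rule card_mono[OF _ slab_cover]) auto
  also have "\<dots> = (\<Sum>m\<in>{l..<r}. card {\<lceil>\<beta> * of_int m - b\<rceil>..\<lfloor>\<beta> * of_int m + b\<rfloor>})"
    by (rule card_SigmaI) auto
  finally have "real (card (slab l r b)) \<le> (\<Sum>m\<in>{l..<r}. real (card {\<lceil>\<beta> * of_int m - b\<rceil>..\<lfloor>\<beta> * of_int m + b\<rfloor>}))"
    by (simp only: of_nat_sum[symmetric] of_nat_le_iff)
  also have "\<dots> \<le> (\<Sum>m\<in>{l..<r}. 2 * b + 1)" by (intro sum_mono col)
  also have "\<dots> = (2 * b + 1) * of_int (r - l)" using assms(1) by (simp add: mult.commute)
  finally show ?thesis .
qed

text \<open>The highest lattice point of its column not above the line. It exists in every column,
  whereas a strip with 2b < 1 can miss columns altogether.\<close>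

definition column :: "nat \<Rightarrow> int \<times> int" where
  "column m = (int m, \<lfloor>\<beta> * of_int (int m)\<rfloor>)"

lemma fst_column [simp]: "fst (column m) = int m"
  by (simp add: column_def)

lemma offset_column: "- 1 < offset (column m)" "offset (column m) \<le> 0"
  by (simp_all add: column_def offset_def) linarith+

text \<open>Equal to the squared L^2 distance of 1_B o T^u and 1_B o T^w, since the differences are
  0, 1 or -1; as an L^1 distance it still satisfies the triangle inequality.\<close>

definition orbit_dist :: "'a set \<Rightarrow> int \<times> int \<Rightarrow> int \<times> int \<Rightarrow> real" where
  "orbit_dist B u w = (\<integral>x. \<bar>indicator B (T u x) - indicator B (T w x)\<bar> \<partial>\<mu>)"

definition orbit_tb :: "'a set \<Rightarrow> real \<Rightarrow> bool" where
  "orbit_tb B b \<longleftrightarrow> (\<forall>e>0. \<exists>W. finite W \<and> W \<subseteq> strip \<beta> b \<and> (\<forall>w\<in>strip \<beta> b. \<exists>v\<in>W. orbit_dist B w v < e))"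

lemma integrable_ind_T:
  assumes "B \<in> sets borel"
  shows "integrable \<mu> (\<lambda>x. indicat_real B (T w x))"
  by (intro integrable_T integrable_ind) (use assms sets_M in auto)

lemma orbit_dist_nonneg: "orbit_dist B u w \<ge> 0"
  by (simp add: orbit_dist_def)

lemma orbit_dist_commute: "orbit_dist B u w = orbit_dist B w u"
  by (simp add: orbit_dist_def abs_minus_commute)

lemma orbit_dist_triangle:
  assumes "B \<in> sets borel"
  shows "orbit_dist B u w \<le> orbit_dist B u v + orbit_dist B v w"
proof -
  note i = integrable_ind_T[OF assms]
  have "orbit_dist B u w \<le> (\<integral>x. \<bar>indicator B (T u x) - indicator B (T v x)\<bar> + \<bar>indicator B (T v x) - indicator B (T w x)\<bar> \<partial>\<mu>)"
    unfolding orbit_dist_def by (intro integral_mono) (use i in auto)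
  also have "\<dots> = orbit_dist B u v + orbit_dist B v w"
    unfolding orbit_dist_def by (intro Bochner_Integration.integral_add) (use i in auto)
  finally show ?thesis .
qed

lemma orbit_dist_shift:
  assumes "B \<in> sets borel"
  shows "orbit_dist B (u + v) (w + v) = orbit_dist B u w"
proof -
  note i = integrable_ind_T[OF assms]
  show ?thesis unfolding orbit_dist_def T_add
    by (rule integral_T[where w = v and f = "\<lambda>x. \<bar>indicator B (T u x) - indicator B (T w x)\<bar>"]) (use i in auto)
qed

text \<open>Differences of equally coloured points of the strip are return times.\<close>

lemma return_times_density:
  assumes B: "B \<in> sets borel" "orbit_tb B 1" and "\<delta> > 0"
  obtains c where "c > 0" "\<And>k. k \<ge> 1 \<Longrightarrow> c * real k \<le> card {u \<in> slab 0 (int k) \<delta>. orbit_dist B u 0 < \<delta>}"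
proof -
  obtain W where W: "finite W" "\<forall>w\<in>strip \<beta> 1. \<exists>v\<in>W. orbit_dist B w v < \<delta> / 2"
    using B(2) \<open>\<delta> > 0\<close> unfolding orbit_tb_def by (meson half_gt_zero)
  have "column m \<in> strip \<beta> 1" for m
    using offset_column[of m] by (simp add: strip_offset abs_le_iff)
  hence "\<forall>m. \<exists>v\<in>W. orbit_dist B (column m) v < \<delta> / 2" using W(2) by blast
  then obtain \<nu> where \<nu>: "\<And>m. \<nu> m \<in> W" "\<And>m. orbit_dist B (column m) (\<nu> m) < \<delta> / 2" by metis
  \<comment> \<open>A colour is a nearby net point together with the offset cell of length
    \<open>\<delta>\<close>. Offsets of columns lie in (-1, 0], so finitely many cells
    suffice.\<close>
  define Y where "Y = W \<times> {\<lfloor>- 1 / \<delta>\<rfloor>..0}"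
  define \<kappa> where "\<kappa> = (\<lambda>m. (\<nu> m, \<lfloor>offset (column m) / \<delta>\<rfloor>))"
  have Y: "finite Y" using W(1) by (simp add: Y_def)
  have \<kappa>: "\<kappa> m \<in> Y" for m
  proof -
    have "- 1 / \<delta> \<le> offset (column m) / \<delta>" using offset_column(1)[of m] \<open>\<delta> > 0\<close> by (intro divide_right_mono) auto
    moreover have "offset (column m) / \<delta> \<le> 0" using offset_column(2)[of m] \<open>\<delta> > 0\<close> by (simp add: divide_le_0_iff)
    ultimately have "\<lfloor>- 1 / \<delta>\<rfloor> \<le> \<lfloor>offset (column m) / \<delta>\<rfloor>" "\<lfloor>offset (column m) / \<delta>\<rfloor> \<le> 0"
      by - (rule floor_mono, assumption, linarith)
    thus ?thesis using \<nu>(1) by (simp add: Y_def \<kappa>_def)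
  qed
  have Ypos: "card Y > 0" using Y \<kappa>[of 0] card_gt_0_iff by blast
  show thesis
  proof (rule that)
    show "1 / real (card Y) > 0" using Ypos by simp
    fix k :: nat assume "k \<ge> 1"
    have ne: "{..<k} \<noteq> {}" using \<open>k \<ge> 1\<close> by (simp add: lessThan_empty_iff)
    have "\<kappa> ` {..<k} \<subseteq> Y" using \<kappa> by auto
    then obtain y where y: "{m \<in> {..<k}. \<kappa> m = y} \<noteq> {}"
        "card {..<k} \<le> card Y * card {m \<in> {..<k}. \<kappa> m = y}"
      by (rule card_le_card_fibre[OF finite_lessThan Y _ ne])
    define F where "F = {m \<in> {..<k}. \<kappa> m = y}"
    \<comment> \<open>Subtracting the leftmost point of the class places all differences in columns
      0 to \<open>k - 1\<close>.\<close>
    define m0 where "m0 = Min F"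
    have F: "finite F" "F \<noteq> {}" using y by (auto simp: F_def)
    have m0: "m0 \<in> F" "\<And>m. m \<in> F \<Longrightarrow> m0 \<le> m" unfolding m0_def using F by auto
    have inj: "inj_on (\<lambda>m. column m - column m0) F"
      by (rule inj_onI) (metis diff_right_commute diff_eq_diff_eq diff_add_cancel fst_column of_nat_eq_iff)
    have sub: "(\<lambda>m. column m - column m0) ` F \<subseteq> {u \<in> slab 0 (int k) \<delta>. orbit_dist B u 0 < \<delta>}"
    proof (intro image_subsetI CollectI conjI)
      fix m assume m: "m \<in> F"
      have eq: "\<nu> m = \<nu> m0" "\<lfloor>offset (column m) / \<delta>\<rfloor> = \<lfloor>offset (column m0) / \<delta>\<rfloor>"
        using m m0(1) by (auto simp: F_def \<kappa>_def)
      have "\<bar>offset (column m) / \<delta> - offset (column m0) / \<delta>\<bar> \<le> 1" using eq(2) by linarith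
      hence "\<bar>offset (column m) - offset (column m0)\<bar> / \<delta> \<le> 1"
        using \<open>\<delta> > 0\<close> by (simp add: diff_divide_distrib[symmetric])
      hence "\<bar>offset (column m - column m0)\<bar> \<le> \<delta>" using \<open>\<delta> > 0\<close> by (simp add: offset_diff)
      moreover have "int m0 \<le> int m" "int m < int k" using m m0(2)[OF m] by (auto simp: F_def)
      ultimately show "column m - column m0 \<in> slab 0 (int k) \<delta>" by (simp add: slab_def)
      have "orbit_dist B (column m - column m0) 0 = orbit_dist B (column m) (column m0)"
        using orbit_dist_shift[OF B(1), of "column m - column m0" "column m0" 0] by simp
      also have "\<dots> \<le> orbit_dist B (column m) (\<nu> m) + orbit_dist B (\<nu> m0) (column m0)"
        using orbit_dist_triangle[OF B(1)] eq(1) by metis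
      also have "\<dots> < \<delta>" using \<nu>(2)[of m] \<nu>(2)[of m0] orbit_dist_commute[of B "\<nu> m0" "column m0"] by linarith
      finally show "orbit_dist B (column m - column m0) 0 < \<delta>" .
    qed
    have "card F = card ((\<lambda>m. column m - column m0) ` F)" by (simp add: card_image[OF inj])
    also have "\<dots> \<le> card {u \<in> slab 0 (int k) \<delta>. orbit_dist B u 0 < \<delta>}"
      by (rule card_mono[OF _ sub]) auto
    finally have "card Y * card F \<le> card Y * card {u \<in> slab 0 (int k) \<delta>. orbit_dist B u 0 < \<delta>}" by simp
    moreover have "k \<le> card Y * card F" using y(2) unfolding F_def by simp
    ultimately have "k \<le> card Y * card {u \<in> slab 0 (int k) \<delta>. orbit_dist B u 0 < \<delta>}" by linarith
    hence "real k \<le> real (card Y) * real (card {u \<in> slab 0 (int k) \<delta>. orbit_dist B u 0 < \<delta>})"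
      unfolding of_nat_mult[symmetric] of_nat_le_iff .
    thus "1 / real (card Y) * real k \<le> card {u \<in> slab 0 (int k) \<delta>. orbit_dist B u 0 < \<delta>}"
      using Ypos by (simp add: field_simps)
  qed
qed

text \<open>A strip with 2b < 1 can miss columns, so counting column by column gives no lower bound.
  For \<open>B = {}\<close> every point is a return time, and \<open>return_times_density\<close>
  counts the slab itself.\<close>

lemma slab_density:
  assumes "b > 0"
  obtains c where "c > 0" "\<And>k. k \<ge> 1 \<Longrightarrow> c * real k \<le> card (slab 0 (int k) b)"
proof -
  have "orbit_tb {} 1"
    unfolding orbit_tb_def by (auto simp: orbit_dist_def strip_offset offset_def zero_prod_def intro!: exI[of _ "{(0, 0)}"])
  then obtain c where c: "c > 0" "\<And>k. k \<ge> 1 \<Longrightarrow> c * real k \<le> card {u \<in> slab 0 (int k) b. orbit_dist {} u 0 < b}"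
    using return_times_density[of "{}" b] assms by auto
  have "c * real k \<le> card (slab 0 (int k) b)" if "k \<ge> 1" for k
    by (rule order_trans[OF c(2)[OF that]]) (auto intro!: card_mono)
  thus thesis using c(1) that by blast
qed

text \<open>Transference: the points \<open>column m\<close> follow the line of slope \<open>\<beta>\<close> within distance 1, so the strip
  pieces of width \<open>b\<close> based at them lie in a strip of width \<open>b + 1\<close> around the line, and the
  two-dimensional sums reduce to sums over intervals of columns.\<close>

lemma maximal_inequality:
  fixes g :: "'a \<Rightarrow> real" and b c \<theta> :: real
  assumes g: "integrable \<mu> g" "\<And>x. g x \<ge> 0" and "b > 0" "\<theta> > 0" "c > 0"
    and c: "\<And>k. k \<ge> 1 \<Longrightarrow> c * real k \<le> card (slab 0 (int k) b)"
  defines "E \<equiv> {x. \<exists>k\<ge>1. \<theta> * card (slab 0 (int k) b) < (\<Sum>w\<in>slab 0 (int k) b. g (T w x))}"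
  shows "E \<in> sets \<mu>" "\<theta> * c * prob E \<le> (2 * b + 3) * (\<integral>x. g x \<partial>\<mu>)"
proof -
  have [measurable]: "g \<in> borel_measurable \<mu>" using g by auto
  \<comment> \<open>Truncating at \<open>k \<le> N\<close> bounds the lengths of the intervals in
    \<open>interval_covering\<close>; \<open>N\<close> tends to infinity at the end.\<close>
  define E' where "E' = (\<lambda>N. {x\<in>space \<mu>. \<exists>k\<in>{1..N}. \<theta> * card (slab 0 (int k) b) < (\<Sum>w\<in>slab 0 (int k) b. g (T w x))})"
  have E'm [measurable]: "E' N \<in> sets \<mu>" for N unfolding E'_def by measurable
  have EU: "E = (\<Union>N. E' N)" by (fastforce simp: E_def E'_def)
  show "E \<in> sets \<mu>" unfolding EU by measurable
  have E'_bound: "\<theta> * c * prob (E' N) \<le> (2 * b + 3) * (\<integral>x. g x \<partial>\<mu>)" for N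
  proof (rule le_of_asymptotic)
    fix R :: nat assume "R \<ge> 1"
    \<comment> \<open>The sum over a single column of the strip widened to \<open>b + 1\<close>; the
      extra 1 absorbs the offset of \<open>column m\<close>.\<close>
    define G where "G = (\<lambda>i x. \<Sum>w\<in>slab (int i) (int i + 1) (b + 1). g (T w x))"
    have G0: "G i x \<ge> 0" for i x unfolding G_def by (intro sum_nonneg g)
    have Gi: "integrable \<mu> (G i)" for i unfolding G_def by (intro Bochner_Integration.integrable_sum integrable_T g)
    have block: "\<exists>k\<in>{1..N}. (\<theta> * c) * real k \<le> (\<Sum>i\<in>{m..<m + k}. G i x)" if Em: "T (column m) x \<in> E' N" for m x
    proof -
      obtain k where k: "k \<in> {1..N}" "\<theta> * card (slab 0 (int k) b) < (\<Sum>w\<in>slab 0 (int k) b. g (T w (T (column m) x)))"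
        using Em by (auto simp: E'_def)
      \<comment> \<open>The density \<open>c\<close> converts the number of points into the length
        \<open>k\<close> of an interval of columns.\<close>
      have "(\<theta> * c) * real k \<le> \<theta> * card (slab 0 (int k) b)"
        using c[of k] k(1) \<open>\<theta> > 0\<close> by (simp add: mult.assoc)
      also have "\<dots> \<le> (\<Sum>w\<in>slab 0 (int k) b. g (T (w + column m) x))"
        using k(2) by (simp add: T_add)
      also have "\<dots> = (\<Sum>w\<in>(\<lambda>w. w + column m) ` slab 0 (int k) b. g (T w x))"
        by (subst sum.reindex) (auto simp: inj_on_def)
      also have "\<dots> \<le> (\<Sum>w\<in>slab (int m) (int m + int k) (b + 1). g (T w x))"
      proof (rule sum_mono2)
        show "(\<lambda>w. w + column m) ` slab 0 (int k) b \<subseteq> slab (int m) (int m + int k) (b + 1)"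
          using offset_column[of m] by (auto simp: slab_def offset_add abs_le_iff)
      qed (use g in auto)
      also have "slab (int m) (int m + int k) (b + 1) = (\<Union>i\<in>{m..<m + k}. slab (int i) (int i + 1) (b + 1))"
      proof (intro equalityI subsetI)
        fix w assume w: "w \<in> slab (int m) (int m + int k) (b + 1)"
        hence "w \<in> slab (int (nat (fst w))) (int (nat (fst w)) + 1) (b + 1)" "nat (fst w) \<in> {m..<m + k}"
          by (auto simp: slab_def)
        thus "w \<in> (\<Union>i\<in>{m..<m + k}. slab (int i) (int i + 1) (b + 1))" by blast
      qed (auto simp: slab_def)
      also have "(\<Sum>w\<in>(\<Union>i\<in>{m..<m + k}. slab (int i) (int i + 1) (b + 1)). g (T w x)) = (\<Sum>i\<in>{m..<m + k}. G i x)"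
        unfolding G_def
      proof (rule sum.UNION_disjoint)
        show "\<forall>i\<in>{m..<m + k}. finite (slab (int i) (int i + 1) (b + 1))" by simp
      qed (auto simp: slab_def)
      finally show ?thesis using k(1) by blast
    qed
    have pt: "(\<theta> * c) * (\<Sum>m<R. indicator (E' N) (T (column m) x)) \<le> (\<Sum>i<R + N. G i x)" for x
    proof -
      have "(\<Sum>m<R. indicat_real (E' N) (T (column m) x)) = real (card ({m. T (column m) x \<in> E' N} \<inter> {0..<R}))"
        by (simp add: indicator_def sum.If_cases Int_commute lessThan_atLeast0)
      thus ?thesis
        using interval_covering[of "\<lambda>i. G i x" "\<theta> * c" "{m. T (column m) x \<in> E' N}" N 0 R] G0 block \<open>\<theta> > 0\<close> \<open>c > 0\<close>
        by (simp add: lessThan_atLeast0)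
    qed
    have ei: "integrable \<mu> (\<lambda>x. indicat_real (E' N) (T w x))" for w
      by (intro integrable_ind_T) (use E'm sets_M in auto)
    \<comment> \<open>Integrate the covering inequality: by invariance each of the \<open>R\<close>
      columns contributes \<open>prob (E' N)\<close>, while the \<open>N\<close> overshooting
      columns cause an error independent of \<open>R\<close>.\<close>
    have "real R * (\<theta> * c * prob (E' N)) = (\<integral>x. (\<theta> * c) * (\<Sum>m<R. indicator (E' N) (T (column m) x)) \<partial>\<mu>)"
    proof -
      have "(\<integral>x. indicat_real (E' N) (T w x) \<partial>\<mu>) = prob (E' N)" for w
        by (subst integral_T) auto
      thus ?thesis using ei by (simp add: Bochner_Integration.integral_sum)
    qed
    also have "\<dots> \<le> (\<integral>x. (\<Sum>i<R + N. G i x) \<partial>\<mu>)"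
      by (intro integral_mono pt integrable_mult_right Bochner_Integration.integrable_sum ei Gi)
    also have "\<dots> = (\<Sum>i<R + N. \<integral>x. G i x \<partial>\<mu>)" by (intro Bochner_Integration.integral_sum Gi)
    also have "\<dots> = (\<Sum>i<R + N. card (slab (int i) (int i + 1) (b + 1)) * (\<integral>x. g x \<partial>\<mu>))"
      unfolding G_def using integrable_T[OF g(1)]
      by (simp add: Bochner_Integration.integral_sum integral_T)
    also have "\<dots> \<le> (\<Sum>i<R + N. (2 * b + 3) * (\<integral>x. g x \<partial>\<mu>))"
    proof (intro sum_mono mult_right_mono)
      \<comment> \<open>\<open>2 * b + 3\<close> is \<open>2 * (b + 1) + 1\<close>, the bound for
        one column of the widened strip.\<close>
      show "real (card (slab (int i) (int i + 1) (b + 1))) \<le> 2 * b + 3" for i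
        using card_slab_le[of "int i" "int i + 1" "b + 1"] \<open>b > 0\<close> by simp
    qed (use g in auto)
    also have "\<dots> = real R * ((2 * b + 3) * (\<integral>x. g x \<partial>\<mu>)) + real N * ((2 * b + 3) * (\<integral>x. g x \<partial>\<mu>))"
      by (simp add: algebra_simps)
    finally show "real R * (\<theta> * c * prob (E' N))
        \<le> real R * ((2 * b + 3) * (\<integral>x. g x \<partial>\<mu>)) + real N * ((2 * b + 3) * (\<integral>x. g x \<partial>\<mu>))" .
  qed
  have "incseq E'" by (fastforce simp: incseq_def E'_def)
  hence "(\<lambda>N. prob (E' N)) \<longlonglongrightarrow> prob (\<Union>N. E' N)" by (intro finite_Lim_measure_incseq) auto
  hence "(\<lambda>N. \<theta> * c * prob (E' N)) \<longlonglongrightarrow> \<theta> * c * prob E" unfolding EU by (intro tendsto_mult_left)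
  thus "\<theta> * c * prob E \<le> (2 * b + 3) * (\<integral>x. g x \<partial>\<mu>)"
    by (rule LIMSEQ_le_const2) (use E'_bound in auto)
qed

end

section \<open>Almost periodic smoothing of indicators\<close>

definition tent :: "real \<Rightarrow> real" where
  "tent t = max 0 (1 - \<bar>t\<bar>)"

lemma tent_bounds: "0 \<le> tent t" "tent t \<le> 1"
  by (auto simp: tent_def)

lemma tent_Lipschitz: "\<bar>tent s - tent t\<bar> \<le> \<bar>s - t\<bar>"
  by (auto simp: tent_def max_def)

lemma abs_diff_prod3_le:
  fixes a b c a' b' c' :: real
  assumes "0 \<le> a" "a \<le> 1" "0 \<le> b" "b \<le> 1" "0 \<le> c" "c \<le> 1"
    and "0 \<le> a'" "a' \<le> 1" "0 \<le> b'" "b' \<le> 1" "0 \<le> c'" "c' \<le> 1"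
  shows "\<bar>a * b * c - a' * b' * c'\<bar> \<le> \<bar>a - a'\<bar> + \<bar>b - b'\<bar> + \<bar>c - c'\<bar>"
proof -
  have *: "\<bar>x * y - x' * y'\<bar> \<le> \<bar>x - x'\<bar> + \<bar>y - y'\<bar>"
    if "0 \<le> x'" "x' \<le> 1" "0 \<le> y" "y \<le> 1" for x y x' y' :: real
  proof -
    have "x * y - x' * y' = (x - x') * y + x' * (y - y')" by (simp add: algebra_simps)
    also have "\<bar>\<dots>\<bar> \<le> \<bar>x - x'\<bar> * y + x' * \<bar>y - y'\<bar>"
      using abs_triangle_ineq[of "(x - x') * y" "x' * (y - y')"] that by (simp add: abs_mult)
    also have "\<dots> \<le> \<bar>x - x'\<bar> * 1 + 1 * \<bar>y - y'\<bar>"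
      using that by (intro add_mono mult_left_mono mult_right_mono) auto
    finally show ?thesis by simp
  qed
  have "\<bar>a * b * c - a' * b' * c'\<bar> \<le> \<bar>a * b - a' * b'\<bar> + \<bar>c - c'\<bar>"
    using assms by (intro *) (auto intro: mult_le_one)
  also have "\<bar>a * b - a' * b'\<bar> \<le> \<bar>a - a'\<bar> + \<bar>b - b'\<bar>"
    using assms by (intro *) auto
  finally show ?thesis by simp
qed

context Z2_system
begin

text \<open>In the complete space L^2 compact closure means total boundedness, with the centres of
  the nets taken on the orbit. As L^2 distances are square roots of \<open>orbit_dist\<close>, radii
  pass between \<open>e\<close> and its square.\<close>

lemma Kronecker_strip_iff:
  assumes B: "B \<in> sets borel"
  shows "B \<in> Kronecker_strip T \<beta> b \<mu> \<longleftrightarrow> orbit_tb B b"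
proof -
  interpret L2: Metric_space "L2_space \<mu>" "L2_dist \<mu>" by (rule Metric_space_L2)
  define f :: "'a \<Rightarrow> complex" where "f = indicator B"
  have [measurable]: "f \<in> borel_measurable \<mu>" using B sets_M by (simp add: f_def)
  have "integrable \<mu> (\<lambda>x. (cmod (f x))\<^sup>2)"
  proof (rule integrable_const_bound[of _ 1])
    show "AE x in \<mu>. norm ((cmod (f x))\<^sup>2) \<le> 1" by (intro AE_I2) (simp add: f_def indicator_def)
  qed measurable
  hence f: "f \<in> L2_funs \<mu>" by (simp add: L2_funs_def)
  define orb where "orb = (\<lambda>w. koopman \<mu> T w (L2_class \<mu> f))"
  have orb: "orb w = L2_class \<mu> (f \<circ> T w)" for w
    unfolding orb_def by (rule koopman_class[OF tds inv f])
  have fT: "f \<circ> T w \<in> L2_funs \<mu>" for w by (rule L2_funs_compose(1)[OF tds inv f])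
  have orbM: "orb w \<in> L2_space \<mu>" for w unfolding orb L2_space_def using fT by blast
  have d: "L2_dist \<mu> (orb u) (orb w) = sqrt (orbit_dist B u w)" for u w
  proof -
    have "(cmod (f (T u x) - f (T w x)))\<^sup>2 = \<bar>indicator B (T u x) - indicator B (T w x)\<bar>" for x
      by (simp add: f_def indicator_def)
    thus ?thesis unfolding orb L2_dist_class[OF fT fT] by (simp add: orbit_dist_def)
  qed
  have "B \<in> Kronecker_strip T \<beta> b \<mu> \<longleftrightarrow> compactin L2.mtopology (L2.mtopology closure_of (orb ` strip \<beta> b))"
    using B by (simp add: Kronecker_strip_def orb_def f_def)
  also have "\<dots> \<longleftrightarrow> L2.mtotally_bounded (orb ` strip \<beta> b)"
    using L2.mtotally_bounded_eq_compact_closure_of[OF mcomplete_L2[OF prob_space_axioms]] orbM by blast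
  also have "\<dots> \<longleftrightarrow> orbit_tb B b"
  proof
    assume L: "L2.mtotally_bounded (orb ` strip \<beta> b)"
    show "orbit_tb B b" unfolding orbit_tb_def
    proof (intro allI impI)
      fix e :: real assume "e > 0"
      hence "sqrt e > 0" by simp
      then obtain K where K: "finite K" "K \<subseteq> orb ` strip \<beta> b" "orb ` strip \<beta> b \<subseteq> (\<Union>x\<in>K. L2.mball x (sqrt e))"
        using L unfolding L2.mtotally_bounded_def by meson
      obtain W where W: "W \<subseteq> strip \<beta> b" "finite W" "K = orb ` W"
        using finite_subset_image[OF K(1,2)] by blast
      have "\<exists>v\<in>W. orbit_dist B w v < e" if w: "w \<in> strip \<beta> b" for w
      proof -
        have "orb w \<in> (\<Union>x\<in>K. L2.mball x (sqrt e))" using K(3) w by blast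
        then obtain v where "v \<in> W" "orb w \<in> L2.mball (orb v) (sqrt e)" using W(3) by auto
        hence "v \<in> W" "orbit_dist B v w < e" by (auto simp: d)
        thus ?thesis using orbit_dist_commute[of B v w] by auto
      qed
      thus "\<exists>W. finite W \<and> W \<subseteq> strip \<beta> b \<and> (\<forall>w\<in>strip \<beta> b. \<exists>v\<in>W. orbit_dist B w v < e)"
        using W by blast
    qed
  next
    assume R: "orbit_tb B b"
    show "L2.mtotally_bounded (orb ` strip \<beta> b)" unfolding L2.mtotally_bounded_def
    proof (intro allI impI)
      fix e :: real assume "e > 0"
      then obtain W where W: "finite W" "W \<subseteq> strip \<beta> b" "\<forall>w\<in>strip \<beta> b. \<exists>v\<in>W. orbit_dist B w v < e\<^sup>2"
        using R unfolding orbit_tb_def by (meson zero_less_power)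
      have "orb w \<in> (\<Union>x\<in>orb ` W. L2.mball x e)" if w: "w \<in> strip \<beta> b" for w
      proof -
        obtain v where v: "v \<in> W" "orbit_dist B w v < e\<^sup>2" using W(3) w by blast
        have "sqrt (orbit_dist B v w) < sqrt (e\<^sup>2)"
          using v(2) orbit_dist_commute[of B v w] by (intro real_sqrt_less_mono) simp
        hence "orb w \<in> L2.mball (orb v) e" using \<open>e > 0\<close> orbM by (simp add: d)
        thus ?thesis using v(1) by blast
      qed
      thus "\<exists>K. finite K \<and> K \<subseteq> orb ` strip \<beta> b \<and> orb ` strip \<beta> b \<subseteq> (\<Union>x\<in>K. L2.mball x e)"
        using W(1,2) by (intro exI[of _ "orb ` W"]) blast
    qed
  qed
  finally show ?thesis .
qed

text \<open>The weight must be Lipschitz also in the offset and in the column: \<open>w + window k\<close> differs from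
  \<open>window k\<close> in a non-negligible proportion of points even for small \<open>w\<close>, because the window is a
  thin strip.\<close>

definition weight :: "'a set \<Rightarrow> real \<Rightarrow> nat \<Rightarrow> int \<times> int \<Rightarrow> real" where
  "weight B \<eta> k u = max 0 (\<eta> - orbit_dist B u 0) * tent (offset u) * tent (of_int (fst u) / (2 * real k))"

text \<open>Contains the support of the weights, because both tents vanish outside [-1, 1]. Sums
  over it are thus sums over all of Z^2 and can be re-indexed after a shift.\<close>

definition window :: "nat \<Rightarrow> (int \<times> int) set" where
  "window k = slab (- 2 * int k) (2 * int k + 1) 1"

definition mass :: "'a set \<Rightarrow> real \<Rightarrow> nat \<Rightarrow> real" where
  "mass B \<eta> k = (\<Sum>u\<in>window k. weight B \<eta> k u)"

definition smoothing :: "'a set \<Rightarrow> real \<Rightarrow> nat \<Rightarrow> 'a \<Rightarrow> real" where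
  "smoothing B \<eta> k x = (\<Sum>u\<in>window k. weight B \<eta> k u * indicator B (T u x)) / mass B \<eta> k"

lemma finite_window [simp]: "finite (window k)"
  by (simp add: window_def)

lemma window_strip: "window k \<subseteq> strip \<beta> 1"
  by (auto simp: window_def slab_def strip_offset)

text \<open>At most 3 points in each of 4k + 1 \<le> 5k columns.\<close>

lemma card_window: "k \<ge> 1 \<Longrightarrow> real (card (window k)) \<le> 15 * real k"
  using card_slab_le[of "- 2 * int k" "2 * int k + 1" 1] by (simp add: window_def)

lemma weight_nonneg: "weight B \<eta> k u \<ge> 0"
  by (simp add: weight_def tent_bounds)

lemma weight_outside_window:
  assumes "k \<ge> 1" "u \<notin> window k"
  shows "weight B \<eta> k u = 0"
proof -
  consider "\<bar>offset u\<bar> > 1" | "\<bar>fst u\<bar> > 2 * int k"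
    using assms(2) by (fastforce simp: window_def slab_def)
  thus ?thesis
  proof cases
    case 2
    hence "\<bar>real_of_int (fst u)\<bar> > 2 * real k" by linarith
    hence "\<bar>of_int (fst u) / (2 * real k)\<bar> > 1" using assms(1) by (simp add: abs_divide)
    thus ?thesis by (simp add: weight_def tent_def)
  qed (simp add: weight_def tent_def)
qed

lemma weight_return:
  assumes "weight B \<eta> k u \<noteq> 0"
  shows "orbit_dist B u 0 \<le> \<eta>"
  using assms by (auto simp: weight_def max_def split: if_splits)

text \<open>By invariance \<open>orbit_dist B (v - t) 0\<close> is \<open>orbit_dist B v t\<close>,
  so the triangle inequality handles the first factor. With \<open>\<eta> \<le> 1\<close> all three
  factors lie in [0, 1], and their Lipschitz bounds add up.\<close>

lemma weight_shift_Lipschitz: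
  assumes B: "B \<in> sets borel" and "\<eta> \<le> 1" "k \<ge> 1"
  shows "\<bar>weight B \<eta> k (v - u) - weight B \<eta> k (v - w)\<bar>
    \<le> orbit_dist B u w + \<bar>offset u - offset w\<bar> + \<bar>of_int (fst u - fst w)\<bar> / (2 * real k)"
proof -
  have D: "orbit_dist B (v - t) 0 = orbit_dist B v t" for t
    using orbit_dist_shift[OF B, of "v - t" t 0] by simp
  have "\<bar>weight B \<eta> k (v - u) - weight B \<eta> k (v - w)\<bar>
    \<le> \<bar>max 0 (\<eta> - orbit_dist B (v - u) 0) - max 0 (\<eta> - orbit_dist B (v - w) 0)\<bar>
      + \<bar>tent (offset (v - u)) - tent (offset (v - w))\<bar>
      + \<bar>tent (of_int (fst (v - u)) / (2 * real k)) - tent (of_int (fst (v - w)) / (2 * real k))\<bar>"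
    unfolding weight_def
    using \<open>\<eta> \<le> 1\<close> orbit_dist_nonneg[of B "v - u" 0] orbit_dist_nonneg[of B "v - w" 0]
    by (intro abs_diff_prod3_le) (auto simp: tent_bounds)
  also have "\<bar>max 0 (\<eta> - orbit_dist B (v - u) 0) - max 0 (\<eta> - orbit_dist B (v - w) 0)\<bar> \<le> orbit_dist B u w"
    unfolding D using orbit_dist_triangle[OF B, of v u w] orbit_dist_triangle[OF B, of v w u] orbit_dist_commute[of B u w]
    unfolding max_def abs_le_iff by (auto split: if_splits)
  also have "\<bar>tent (offset (v - u)) - tent (offset (v - w))\<bar> \<le> \<bar>offset u - offset w\<bar>"
    by (rule order_trans[OF tent_Lipschitz]) (simp add: offset_diff)
  also have "\<bar>tent (of_int (fst (v - u)) / (2 * real k)) - tent (of_int (fst (v - w)) / (2 * real k))\<bar>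
      \<le> \<bar>of_int (fst (v - u)) / (2 * real k) - of_int (fst (v - w)) / (2 * real k)\<bar>"
    by (rule tent_Lipschitz)
  also have "\<dots> = \<bar>of_int (fst u - fst w)\<bar> / (2 * real k)"
    by (simp add: diff_divide_distrib[symmetric] abs_divide abs_minus_commute)
  finally show ?thesis by simp
qed

text \<open>Return times for \<open>\<eta> / 2\<close> keep every factor of the weight away from 0:
  each contributes at least \<open>(\<eta> / 2) * (1 / 2) * (1 / 2)\<close>, and their number grows
  linearly in \<open>k\<close>.\<close>

lemma mass_lower_bound:
  assumes B: "B \<in> sets borel" "orbit_tb B 1" and "0 < \<eta>" "\<eta> \<le> 1"
  obtains c where "c > 0" "\<And>k. k \<ge> 1 \<Longrightarrow> c * real k \<le> mass B \<eta> k"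
proof -
  obtain c where c: "c > 0" "\<And>k. k \<ge> 1 \<Longrightarrow> c * real k \<le> card {u \<in> slab 0 (int k) (\<eta> / 2). orbit_dist B u 0 < \<eta> / 2}"
    using return_times_density[OF B, of "\<eta> / 2"] \<open>0 < \<eta>\<close> by auto
  have "(\<eta> / 8 * c) * real k \<le> mass B \<eta> k" if k: "k \<ge> 1" for k
  proof -
    define R where "R = {u \<in> slab 0 (int k) (\<eta> / 2). orbit_dist B u 0 < \<eta> / 2}"
    have "(\<eta> / 8 * c) * real k \<le> \<eta> / 8 * real (card R)"
      using c(2)[OF k] \<open>0 < \<eta>\<close> unfolding R_def by (simp add: mult.assoc)
    also have "\<dots> = (\<Sum>u\<in>R. \<eta> / 8)" by simp
    also have "\<dots> \<le> (\<Sum>u\<in>R. weight B \<eta> k u)"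
    proof (rule sum_mono)
      fix u assume "u \<in> R"
      hence u: "0 \<le> fst u" "fst u < int k" "\<bar>offset u\<bar> \<le> \<eta> / 2" "orbit_dist B u 0 < \<eta> / 2"
        by (auto simp: R_def slab_def)
      have "real_of_int (fst u) / (2 * real k) \<le> 1 / 2" "real_of_int (fst u) / (2 * real k) \<ge> 0"
        using u(1,2) k by (simp_all add: divide_le_eq)
      hence "tent (of_int (fst u) / (2 * real k)) \<ge> 1 / 2" by (simp add: tent_def)
      moreover have "tent (offset u) \<ge> 1 / 2" using u(3) \<open>\<eta> \<le> 1\<close> by (simp add: tent_def)
      moreover have "max 0 (\<eta> - orbit_dist B u 0) \<ge> \<eta> / 2" using u(4) by (simp add: le_max_iff_disj)
      moreover have "(\<eta> / 2) * (1 / 2) * (1 / 2) \<le> a * b * c"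
        if "a \<ge> \<eta> / 2" "b \<ge> 1 / 2" "c \<ge> 1 / 2" for a b c :: real
        using that \<open>0 < \<eta>\<close> by (intro mult_mono) auto
      ultimately have "(\<eta> / 2) * (1 / 2) * (1 / 2) \<le> weight B \<eta> k u"
        unfolding weight_def by blast
      thus "\<eta> / 8 \<le> weight B \<eta> k u" by simp
    qed
    also have "\<dots> \<le> mass B \<eta> k" unfolding mass_def
    proof (rule sum_mono2)
      show "R \<subseteq> window k" using \<open>\<eta> \<le> 1\<close> by (auto simp: R_def window_def slab_def)
    qed (auto simp: weight_nonneg)
    finally show ?thesis .
  qed
  moreover have "\<eta> / 8 * c > 0" using c(1) \<open>0 < \<eta>\<close> by simp
  ultimately show thesis using that by blast
qed

lemma smoothing_measurable:
  assumes "B \<in> sets borel"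
  shows "smoothing B \<eta> k \<in> borel_measurable \<mu>"
proof -
  have [measurable]: "B \<in> sets \<mu>" using assms sets_M by simp
  show ?thesis unfolding smoothing_def by measurable
qed

lemma smoothing_bounds: "0 \<le> smoothing B \<eta> k x" "smoothing B \<eta> k x \<le> 1"
proof -
  have m: "mass B \<eta> k \<ge> 0" unfolding mass_def by (intro sum_nonneg weight_nonneg)
  show "0 \<le> smoothing B \<eta> k x" unfolding smoothing_def
    by (intro divide_nonneg_nonneg sum_nonneg mult_nonneg_nonneg weight_nonneg m) simp
  have "(\<Sum>u\<in>window k. weight B \<eta> k u * indicator B (T u x)) \<le> mass B \<eta> k"
    unfolding mass_def by (intro sum_mono) (auto simp: indicator_def weight_nonneg)
  \<comment> \<open>Division by 0 gives 0, so the bound also holds when the mass vanishes.\<close>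
  thus "smoothing B \<eta> k x \<le> 1" using m unfolding smoothing_def
    by (cases "mass B \<eta> k = 0") (simp_all only: divide_le_eq_1 div_by_0 zero_le_one less_le, simp)
qed

text \<open>The smoothing is a convex combination of functions 1_B o T^u, and only those within L^1
  distance \<open>\<eta>\<close> of 1_B carry weight.\<close>

lemma smoothing_close:
  assumes B: "B \<in> sets borel" and "mass B \<eta> k > 0"
  shows "(\<integral>x. \<bar>indicator B x - smoothing B \<eta> k x\<bar> \<partial>\<mu>) \<le> \<eta>"
proof -
  define m where "m = mass B \<eta> k"
  have m: "m > 0" using assms by (simp add: m_def)
  have i: "integrable \<mu> (\<lambda>x. \<bar>indicat_real B (T u x) - indicat_real B (T w x)\<bar>)" for u w
    using integrable_ind_T[OF B] by (intro integrable_abs Bochner_Integration.integrable_diff)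
  have pt: "\<bar>indicator B x - smoothing B \<eta> k x\<bar>
      \<le> (\<Sum>u\<in>window k. weight B \<eta> k u / m * \<bar>indicator B (T u x) - indicator B (T 0 x)\<bar>)" for x
  proof -
    have "(\<Sum>u\<in>window k. weight B \<eta> k u / m * indicat_real B x) = indicator B x"
      using m unfolding sum_distrib_right[symmetric] sum_divide_distrib[symmetric] m_def mass_def by simp
    moreover have "(\<Sum>u\<in>window k. weight B \<eta> k u / m * indicat_real B (T u x)) = smoothing B \<eta> k x"
      unfolding smoothing_def m_def by (simp only: sum_divide_distrib times_divide_eq_left)
    ultimately have "indicator B x - smoothing B \<eta> k x
        = (\<Sum>u\<in>window k. weight B \<eta> k u / m * (indicator B (T 0 x) - indicator B (T u x)))"
      by (simp only: sum_subtractf right_diff_distrib T_zero)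
    also have "\<bar>\<dots>\<bar> \<le> (\<Sum>u\<in>window k. \<bar>weight B \<eta> k u / m * (indicator B (T 0 x) - indicator B (T u x))\<bar>)"
      by (rule sum_abs)
    finally show ?thesis
      using m by (simp add: abs_mult weight_nonneg abs_minus_commute)
  qed
  have "(\<integral>x. \<bar>indicator B x - smoothing B \<eta> k x\<bar> \<partial>\<mu>)
      \<le> (\<integral>x. (\<Sum>u\<in>window k. weight B \<eta> k u / m * \<bar>indicator B (T u x) - indicator B (T 0 x)\<bar>) \<partial>\<mu>)"
  proof (intro integral_mono pt)
    show "integrable \<mu> (\<lambda>x. \<bar>indicator B x - smoothing B \<eta> k x\<bar>)"
    proof (rule integrable_const_bound[of _ 2])
      show "AE x in \<mu>. norm \<bar>indicator B x - smoothing B \<eta> k x\<bar> \<le> 2"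
      proof (intro AE_I2)
        fix x
        show "norm \<bar>indicator B x - smoothing B \<eta> k x\<bar> \<le> 2"
          using smoothing_bounds[of B \<eta> k x] by (cases "x \<in> B") auto
      qed
      have [measurable]: "B \<in> sets \<mu>" using B sets_M by simp
      note [measurable] = smoothing_measurable[OF B]
      show "(\<lambda>x. \<bar>indicator B x - smoothing B \<eta> k x\<bar>) \<in> borel_measurable \<mu>" by measurable
    qed
    show "integrable \<mu> (\<lambda>x. \<Sum>u\<in>window k. weight B \<eta> k u / m * \<bar>indicator B (T u x) - indicator B (T 0 x)\<bar>)"
      by (intro Bochner_Integration.integrable_sum integrable_mult_right i)
  qed
  also have "\<dots> = (\<Sum>u\<in>window k. weight B \<eta> k u / m * orbit_dist B u 0)"
  proof -
    have "(\<integral>x. (\<Sum>u\<in>window k. weight B \<eta> k u / m * \<bar>indicator B (T u x) - indicator B (T 0 x)\<bar>) \<partial>\<mu>)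
      = (\<Sum>u\<in>window k. \<integral>x. weight B \<eta> k u / m * \<bar>indicator B (T u x) - indicator B (T 0 x)\<bar> \<partial>\<mu>)"
      by (intro Bochner_Integration.integral_sum integrable_mult_right i)
    thus ?thesis by (simp only: integral_mult_right_zero orbit_dist_def)
  qed
  also have "\<dots> \<le> (\<Sum>u\<in>window k. weight B \<eta> k u / m * \<eta>)"
  proof (rule sum_mono)
    fix u
    show "weight B \<eta> k u / m * orbit_dist B u 0 \<le> weight B \<eta> k u / m * \<eta>"
      using weight_return[of B \<eta> k u] weight_nonneg[of B \<eta> k u] m
      by (cases "weight B \<eta> k u = 0") (auto intro!: mult_left_mono divide_right_mono)
  qed
  also have "\<dots> = \<eta>"
    using m unfolding sum_distrib_right[symmetric] sum_divide_distrib[symmetric] by (simp add: m_def mass_def)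
  finally show ?thesis .
qed

text \<open>Indexed by the point \<open>v\<close> at which the indicator is evaluated, the two sums
  carry the same indicator values and differ only in the weights. At most 30k points stand against a
  mass of at least ck, so the constant \<open>30 / c\<close> does not depend on
  \<open>k\<close>.\<close>

lemma smoothing_shift:
  assumes B: "B \<in> sets borel" and "\<eta> \<le> 1" "k \<ge> 1" and c: "c > 0" "c * real k \<le> mass B \<eta> k"
  shows "\<bar>smoothing B \<eta> k (T u x) - smoothing B \<eta> k (T w x)\<bar>
    \<le> 30 / c * (orbit_dist B u w + \<bar>offset u - offset w\<bar> + \<bar>of_int (fst u - fst w)\<bar> / (2 * real k))"
proof -
  define L where "L = orbit_dist B u w + \<bar>offset u - offset w\<bar> + \<bar>of_int (fst u - fst w)\<bar> / (2 * real k)"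
  have L: "L \<ge> 0" by (simp add: L_def orbit_dist_nonneg)
  define V where "V = (\<lambda>q. q + u) ` window k \<union> (\<lambda>q. q + w) ` window k"
  define m where "m = mass B \<eta> k"
  have "c * real k > 0" using c(1) \<open>k \<ge> 1\<close> by simp
  hence m: "m > 0" using c(2) by (simp add: m_def)
  have shift: "smoothing B \<eta> k (T t x) = (\<Sum>v\<in>V. weight B \<eta> k (v - t) * indicator B (T v x)) / m"
    if t: "(\<lambda>q. q + t) ` window k \<subseteq> V" for t
  proof -
    have "(\<Sum>q\<in>window k. weight B \<eta> k q * indicator B (T q (T t x)))
        = (\<Sum>v\<in>(\<lambda>q. q + t) ` window k. weight B \<eta> k (v - t) * indicator B (T v x))"
      by (subst sum.reindex) (auto simp: inj_on_def T_add)
    also have "\<dots> = (\<Sum>v\<in>V. weight B \<eta> k (v - t) * indicator B (T v x))"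
    proof (rule sum.mono_neutral_left)
      show "\<forall>v\<in>V - (\<lambda>q. q + t) ` window k. weight B \<eta> k (v - t) * indicator B (T v x) = 0"
      proof
        fix v assume "v \<in> V - (\<lambda>q. q + t) ` window k"
        hence "v - t \<notin> window k" by (metis DiffD2 diff_add_cancel image_eqI)
        thus "weight B \<eta> k (v - t) * indicator B (T v x) = 0"
          using weight_outside_window[OF \<open>k \<ge> 1\<close>] by simp
      qed
    qed (use t in \<open>auto simp: V_def\<close>)
    finally show ?thesis by (simp add: smoothing_def m_def)
  qed
  have "smoothing B \<eta> k (T u x) - smoothing B \<eta> k (T w x)
      = (\<Sum>v\<in>V. (weight B \<eta> k (v - u) - weight B \<eta> k (v - w)) * indicator B (T v x)) / m"
  proof -
    have "(\<lambda>q. q + u) ` window k \<subseteq> V" "(\<lambda>q. q + w) ` window k \<subseteq> V" by (auto simp: V_def)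
    from shift[OF this(1)] shift[OF this(2)] show ?thesis
      by (simp only: diff_divide_distrib sum_subtractf left_diff_distrib)
  qed
  also have "\<bar>\<dots>\<bar> \<le> (\<Sum>v\<in>V. \<bar>(weight B \<eta> k (v - u) - weight B \<eta> k (v - w)) * indicator B (T v x)\<bar>) / m"
    using m sum_abs[of "\<lambda>v. (weight B \<eta> k (v - u) - weight B \<eta> k (v - w)) * indicator B (T v x)" V]
    by (simp add: abs_divide divide_right_mono)
  also have "\<dots> \<le> (\<Sum>v\<in>V. L) / m"
  proof (intro divide_right_mono sum_mono)
    fix v
    have "\<bar>(weight B \<eta> k (v - u) - weight B \<eta> k (v - w)) * indicator B (T v x)\<bar>
        \<le> \<bar>weight B \<eta> k (v - u) - weight B \<eta> k (v - w)\<bar>" by (simp add: indicator_def)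
    also have "\<dots> \<le> L" unfolding L_def by (rule weight_shift_Lipschitz[OF B \<open>\<eta> \<le> 1\<close> \<open>k \<ge> 1\<close>])
    finally show "\<bar>(weight B \<eta> k (v - u) - weight B \<eta> k (v - w)) * indicator B (T v x)\<bar> \<le> L" .
  qed (use m in simp)
  also have "\<dots> \<le> (30 * real k) * L / m"
  proof -
    have "card V \<le> card (window k) + card (window k)"
      unfolding V_def by (intro order_trans[OF card_Un_le] add_mono card_image_le) auto
    hence "real (card V) \<le> 30 * real k" using card_window[OF \<open>k \<ge> 1\<close>] by linarith
    thus ?thesis using L m by (auto intro!: divide_right_mono mult_right_mono)
  qed
  also have "\<dots> \<le> (30 * real k) * L / (c * real k)"
    using c(2) L \<open>c * real k > 0\<close> m unfolding m_def[symmetric] by (intro divide_left_mono) auto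
  also have "\<dots> = 30 / c * L" using \<open>k \<ge> 1\<close> by simp
  finally show ?thesis unfolding L_def .
qed


text \<open>A diagonal subsequence makes all inner products with \<open>1\<^bsub>B\<^esub> \<circ> T w\<close> converge. As the smoothings are
  convex combinations of a precompact set of such functions, weak convergence upgrades to norm
  convergence.\<close>

lemma smoothing_L1_Cauchy_subseq:
  assumes B: "B \<in> sets borel" "orbit_tb B 1" and m: "\<And>k. k \<ge> 1 \<Longrightarrow> mass B \<eta> k > 0"
  obtains \<kappa> :: "nat \<Rightarrow> nat" where "strict_mono \<kappa>"
    "\<And>e. e > 0 \<Longrightarrow> \<exists>N. \<forall>i\<ge>N. \<forall>j\<ge>N.
      (\<integral>x. norm (smoothing B \<eta> (Suc (\<kappa> i)) x - smoothing B \<eta> (Suc (\<kappa> j)) x) \<partial>\<mu>) < e"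
proof -
  define h where "h = (\<lambda>n. smoothing B \<eta> (Suc n))"
  have hm [measurable]: "h n \<in> borel_measurable \<mu>" for n unfolding h_def by (rule smoothing_measurable[OF B(1)])
  have hb: "0 \<le> h n x" "h n x \<le> 1" for n x unfolding h_def by (rule smoothing_bounds)+
  have [measurable]: "B \<in> sets \<mu>" using B sets_M by simp
  have bdd: "integrable \<mu> f" if "f \<in> borel_measurable \<mu>" "\<And>x. \<bar>f x\<bar> \<le> 1" for f :: "'a \<Rightarrow> real"
    using that by (intro integrable_const_bound[of _ 1]) auto
  have hd: "\<bar>h i x - h j x\<bar> \<le> 1" for i j x
    using hb[of i x] hb[of j x] by (simp add: abs_le_iff)
  define a where "a = (\<lambda>n w. \<integral>x. h n x * indicator B (T w x) \<partial>\<mu>)"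
  have hi: "integrable \<mu> (\<lambda>x. h n x * indicator B (T w x))" for n w
    by (rule bdd) (use hb[of n] in \<open>auto simp: indicator_def\<close>)
  have "norm (a n w) \<le> 1" for n w
  proof -
    have "0 \<le> a n w" unfolding a_def by (intro Bochner_Integration.integral_nonneg mult_nonneg_nonneg hb) simp
    moreover have "a n w \<le> (\<integral>x. 1 \<partial>\<mu>)" unfolding a_def
      by (intro integral_mono hi) (use hb in \<open>auto simp: indicator_def\<close>)
    ultimately show ?thesis using prob_space by simp
  qed
  then obtain \<kappa> :: "nat \<Rightarrow> nat" where \<kappa>: "strict_mono \<kappa>" "\<And>w. \<exists>l. (\<lambda>n. a (\<kappa> n) w) \<longlonglongrightarrow> l"
    using function_convergent_subsequence[of "UNIV :: (int \<times> int) set" a 1 thesis] by (metis UNIV_I countableI_type)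
  have sq: "\<exists>N. \<forall>i\<ge>N. \<forall>j\<ge>N. (\<integral>x. (h (\<kappa> i) x - h (\<kappa> j) x)\<^sup>2 \<partial>\<mu>) \<le> 4 * e" if e: "e > 0" for e
  proof -
    obtain W where W: "finite W" "\<forall>w\<in>strip \<beta> 1. \<exists>v\<in>W. orbit_dist B w v < e"
      using B(2) e unfolding orbit_tb_def by meson
    have "\<forall>w. \<exists>N. \<forall>i\<ge>N. \<forall>j\<ge>N. \<bar>a (\<kappa> i) w - a (\<kappa> j) w\<bar> < e"
    proof
      fix w
      have "Cauchy (\<lambda>n. a (\<kappa> n) w)" using \<kappa>(2)[of w] by (auto intro: LIMSEQ_imp_Cauchy)
      thus "\<exists>N. \<forall>i\<ge>N. \<forall>j\<ge>N. \<bar>a (\<kappa> i) w - a (\<kappa> j) w\<bar> < e"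
        using e unfolding Cauchy_def dist_real_def by blast
    qed
    then obtain N where N: "\<And>w i j. i \<ge> N w \<Longrightarrow> j \<ge> N w \<Longrightarrow> \<bar>a (\<kappa> i) w - a (\<kappa> j) w\<bar> < e" by metis
    define N0 where "N0 = Max (insert 0 (N ` W))"
    have N0: "N w \<le> N0" if "w \<in> W" for w unfolding N0_def using W(1) that by (intro Max_ge) auto
    have "(\<integral>x. (h (\<kappa> i) x - h (\<kappa> j) x)\<^sup>2 \<partial>\<mu>) \<le> 4 * e" if ij: "i \<ge> N0" "j \<ge> N0" for i j
    proof -
      define f where "f = (\<lambda>x. h (\<kappa> i) x - h (\<kappa> j) x)"
      have fm [measurable]: "f \<in> borel_measurable \<mu>" unfolding f_def by measurable
      have fb: "\<bar>f x\<bar> \<le> 1" for x unfolding f_def by (rule hd)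
      have fi: "integrable \<mu> (\<lambda>x. f x * indicator B (T w x))" for w
        by (rule bdd) (use fb in \<open>auto simp: indicator_def\<close>)
      have fa: "(\<integral>x. f x * indicator B (T w x) \<partial>\<mu>) = a (\<kappa> i) w - a (\<kappa> j) w" for w
        unfolding f_def a_def left_diff_distrib by (intro Bochner_Integration.integral_diff hi)
      \<comment> \<open>For the finitely many net points convergence gives \<open>e\<close>, and
        moving from \<open>u\<close> to its net point costs another \<open>e\<close> because |f|
        \<le> 1.\<close>
      have small: "\<bar>\<integral>x. f x * indicator B (T u x) \<partial>\<mu>\<bar> \<le> 2 * e" if u: "u \<in> strip \<beta> 1" for u
      proof -
        obtain v where v: "v \<in> W" "orbit_dist B u v < e" using W(2) u by blast
        have "(\<integral>x. f x * indicator B (T u x) \<partial>\<mu>) - (\<integral>x. f x * indicator B (T v x) \<partial>\<mu>)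
            = (\<integral>x. f x * indicator B (T u x) - f x * indicator B (T v x) \<partial>\<mu>)"
          by (intro Bochner_Integration.integral_diff[symmetric] fi)
        also have "\<bar>\<dots>\<bar> \<le> (\<integral>x. \<bar>f x * indicator B (T u x) - f x * indicator B (T v x)\<bar> \<partial>\<mu>)"
          by (rule integral_abs_bound)
        also have "\<dots> \<le> orbit_dist B u v"
          unfolding orbit_dist_def
        proof (rule integral_mono)
          show "integrable \<mu> (\<lambda>x. \<bar>f x * indicator B (T u x) - f x * indicator B (T v x)\<bar>)"
            using fi by (intro integrable_abs Bochner_Integration.integrable_diff)
          show "integrable \<mu> (\<lambda>x. \<bar>indicat_real B (T u x) - indicat_real B (T v x)\<bar>)"
            using integrable_ind_T[OF B(1)] by (intro integrable_abs Bochner_Integration.integrable_diff)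
          show "\<bar>f x * indicator B (T u x) - f x * indicator B (T v x)\<bar>
              \<le> \<bar>indicat_real B (T u x) - indicat_real B (T v x)\<bar>" for x
            using fb[of x] by (simp add: indicator_def)
        qed
        finally have "\<bar>(\<integral>x. f x * indicator B (T u x) \<partial>\<mu>) - (\<integral>x. f x * indicator B (T v x) \<partial>\<mu>)\<bar> < e"
          using v(2) by linarith
        moreover have "\<bar>\<integral>x. f x * indicator B (T v x) \<partial>\<mu>\<bar> < e"
          unfolding fa using N[of v i j] N0[OF v(1)] ij by linarith
        ultimately show ?thesis by linarith
      qed
      \<comment> \<open>\<open>h n\<close> averages the functions 1_B o T^u over points
        \<open>u\<close> of the strip, so it inherits the bound of \<open>small\<close>, uniformly
        in \<open>n\<close>.\<close>
      have inner: "integrable \<mu> (\<lambda>x. f x * h n x)" "\<bar>\<integral>x. f x * h n x \<partial>\<mu>\<bar> \<le> 2 * e" for n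
      proof -
        define M where "M = mass B \<eta> (Suc n)"
        have M: "M > 0" unfolding M_def by (rule m) simp
        have eq: "f x * h n x = (\<Sum>u\<in>window (Suc n). weight B \<eta> (Suc n) u / M * (f x * indicator B (T u x)))" for x
          unfolding h_def smoothing_def M_def[symmetric] sum_divide_distrib sum_distrib_left
          by (intro sum.cong) auto
        show "integrable \<mu> (\<lambda>x. f x * h n x)"
          unfolding eq by (intro Bochner_Integration.integrable_sum integrable_mult_right fi)
        have "(\<integral>x. f x * h n x \<partial>\<mu>)
            = (\<Sum>u\<in>window (Suc n). \<integral>x. weight B \<eta> (Suc n) u / M * (f x * indicator B (T u x)) \<partial>\<mu>)"
          unfolding eq by (intro Bochner_Integration.integral_sum integrable_mult_right fi)
        also have "\<dots> = (\<Sum>u\<in>window (Suc n). weight B \<eta> (Suc n) u / M * (\<integral>x. f x * indicator B (T u x) \<partial>\<mu>))"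
          by (simp only: integral_mult_right_zero)
        also have "\<bar>\<dots>\<bar> \<le> (\<Sum>u\<in>window (Suc n). \<bar>weight B \<eta> (Suc n) u / M * (\<integral>x. f x * indicator B (T u x) \<partial>\<mu>)\<bar>)"
          by (rule sum_abs)
        also have "\<dots> \<le> (\<Sum>u\<in>window (Suc n). weight B \<eta> (Suc n) u / M * (2 * e))"
        proof (rule sum_mono)
          fix u assume "u \<in> window (Suc n)"
          hence "\<bar>\<integral>x. f x * indicator B (T u x) \<partial>\<mu>\<bar> \<le> 2 * e" using window_strip by (intro small) blast
          moreover have "weight B \<eta> (Suc n) u / M \<ge> 0" using M weight_nonneg[of B \<eta> "Suc n" u] by simp
          ultimately show "\<bar>weight B \<eta> (Suc n) u / M * (\<integral>x. f x * indicator B (T u x) \<partial>\<mu>)\<bar>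
              \<le> weight B \<eta> (Suc n) u / M * (2 * e)"
            unfolding abs_mult by (simp only: abs_of_nonneg mult_left_mono)
        qed
        also have "\<dots> = 2 * e"
          using M unfolding sum_distrib_right[symmetric] sum_divide_distrib[symmetric] M_def mass_def by simp
        finally show "\<bar>\<integral>x. f x * h n x \<partial>\<mu>\<bar> \<le> 2 * e" .
      qed
      \<comment> \<open>One factor \<open>f\<close> is written as a difference of two smoothings,
        and \<open>inner\<close> bounds both products. Uniformity in \<open>n\<close> matters here,
        since \<open>i\<close> and \<open>j\<close> also determine \<open>f\<close>.\<close>
      have "(\<integral>x. (f x)\<^sup>2 \<partial>\<mu>) = (\<integral>x. f x * h (\<kappa> i) x - f x * h (\<kappa> j) x \<partial>\<mu>)"
        by (intro Bochner_Integration.integral_cong refl) (simp add: f_def power2_eq_square algebra_simps)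
      also have "\<dots> = (\<integral>x. f x * h (\<kappa> i) x \<partial>\<mu>) - (\<integral>x. f x * h (\<kappa> j) x \<partial>\<mu>)"
        by (intro Bochner_Integration.integral_diff inner)
      finally show ?thesis using inner(2)[of "\<kappa> i"] inner(2)[of "\<kappa> j"] unfolding f_def by linarith
    qed
    thus ?thesis by blast
  qed
  show thesis
  proof (rule that[OF \<kappa>(1)])
    fix e :: real assume e: "e > 0"
    \<comment> \<open>Makes \<open>sqrt (4 * e')\<close> equal to \<open>e / 2\<close>.\<close>
    define e' where "e' = e\<^sup>2 / 16"
    have "e' > 0" using e by (simp add: e'_def)
    then obtain N where N: "\<forall>i\<ge>N. \<forall>j\<ge>N. (\<integral>x. (h (\<kappa> i) x - h (\<kappa> j) x)\<^sup>2 \<partial>\<mu>) \<le> 4 * e'" using sq by blast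
    show "\<exists>N. \<forall>i\<ge>N. \<forall>j\<ge>N. (\<integral>x. norm (smoothing B \<eta> (Suc (\<kappa> i)) x - smoothing B \<eta> (Suc (\<kappa> j)) x) \<partial>\<mu>) < e"
    proof (intro exI[of _ N] allI impI)
      fix i j assume ij: "i \<ge> N" "j \<ge> N"
      have "integrable \<mu> (\<lambda>x. (norm (h (\<kappa> i) x - h (\<kappa> j) x))\<^sup>2)"
        by (rule bdd) (use hd in \<open>auto simp: abs_square_le_1\<close>)
      hence "(\<integral>x. norm (h (\<kappa> i) x - h (\<kappa> j) x) \<partial>\<mu>) \<le> sqrt (\<integral>x. (norm (h (\<kappa> i) x - h (\<kappa> j) x))\<^sup>2 \<partial>\<mu>)"
        by (intro integral_norm_le_sqrt) auto
      also have "\<dots> \<le> sqrt (4 * e')" using N ij by (intro real_sqrt_le_mono) auto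
      also have "\<dots> = e / 2" using e by (simp add: e'_def real_sqrt_divide)
      also have "\<dots> < e" using e by simp
      finally show "(\<integral>x. norm (smoothing B \<eta> (Suc (\<kappa> i)) x - smoothing B \<eta> (Suc (\<kappa> j)) x) \<partial>\<mu>) < e"
        unfolding h_def .
    qed
  qed
qed

text \<open>The shift estimate of the smoothings contains a column term |fst u - fst w| / 2k, which
  is useless along an infinite strip at fixed k. Passing to the limit removes it and keeps the
  constant.\<close>

lemma almost_periodic_approximation:
  assumes B: "B \<in> sets borel" "orbit_tb B 1" and "\<epsilon> > 0"
  obtains h C where "C \<ge> 0" "integrable \<mu> h" "(\<integral>x. \<bar>indicator B x - h x\<bar> \<partial>\<mu>) \<le> \<epsilon>"
    "AE x in \<mu>. \<forall>u w. \<bar>h (T u x) - h (T w x)\<bar> \<le> C * (orbit_dist B u w + \<bar>offset u - offset w\<bar>)"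
proof -
  \<comment> \<open>The shift estimate needs \<open>\<eta> \<le> 1\<close>, so that the factors of
    the weights stay in [0, 1].\<close>
  define \<eta> where "\<eta> = min \<epsilon> 1"
  have \<eta>: "0 < \<eta>" "\<eta> \<le> 1" "\<eta> \<le> \<epsilon>" using \<open>\<epsilon> > 0\<close> by (auto simp: \<eta>_def)
  obtain c where c: "c > 0" "\<And>k. k \<ge> 1 \<Longrightarrow> c * real k \<le> mass B \<eta> k"
    using mass_lower_bound[OF B \<eta>(1,2)] by blast
  have mpos: "mass B \<eta> k > 0" if "k \<ge> 1" for k
    using c(2)[OF that] mult_pos_pos[OF c(1), of "real k"] that by linarith
  obtain \<kappa> :: "nat \<Rightarrow> nat" where \<kappa>: "strict_mono \<kappa>" and
    Cauchy: "\<And>e. e > 0 \<Longrightarrow> \<exists>N. \<forall>i\<ge>N. \<forall>j\<ge>N.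
      (\<integral>x. norm (smoothing B \<eta> (Suc (\<kappa> i)) x - smoothing B \<eta> (Suc (\<kappa> j)) x) \<partial>\<mu>) < e"
    by (rule smoothing_L1_Cauchy_subseq[OF B mpos]) auto
  define s where "s = (\<lambda>i. smoothing B \<eta> (Suc (\<kappa> i)))"
  have sm [measurable]: "s i \<in> borel_measurable \<mu>" for i unfolding s_def by (rule smoothing_measurable[OF B(1)])
  have sb: "0 \<le> s i x" "s i x \<le> 1" for i x unfolding s_def by (rule smoothing_bounds)+
  have si: "integrable \<mu> (s i)" for i
    using sb by (intro integrable_const_bound[of _ 1]) auto
  obtain r where r: "strict_mono r" and conv: "AE x in \<mu>. convergent (\<lambda>n. s (r n) x)"
    by (rule L1_Cauchy_AE_convergent_subseq[OF si]) (use Cauchy in \<open>auto simp: s_def\<close>)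
  define h where "h = (\<lambda>x. lim (\<lambda>n. s (r n) x))"
  have [measurable]: "h \<in> borel_measurable \<mu>" unfolding h_def by measurable
  have lim: "AE x in \<mu>. (\<lambda>n. s (r n) x) \<longlonglongrightarrow> h x"
    using conv by (rule eventually_mono) (simp add: h_def convergent_LIMSEQ_iff)
  have [measurable]: "B \<in> sets \<mu>" using B sets_M by simp
  show thesis
  proof (rule that[of "30 / c" h])
    show "30 / c \<ge> 0" using c by simp
    show "integrable \<mu> h"
      by (rule integrable_dominated_convergence[where w = "\<lambda>x. 1" and s = "\<lambda>n. s (r n)"]) (use sb lim in auto)
    have "(\<lambda>n. \<integral>x. \<bar>indicator B x - s (r n) x\<bar> \<partial>\<mu>) \<longlonglongrightarrow> (\<integral>x. \<bar>indicator B x - h x\<bar> \<partial>\<mu>)"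
    proof (rule integral_dominated_convergence[where w = "\<lambda>x. 1"])
      show "AE x in \<mu>. norm \<bar>indicator B x - s (r n) x\<bar> \<le> 1" for n
      proof (intro AE_I2)
        fix x show "norm \<bar>indicator B x - s (r n) x\<bar> \<le> 1"
          using sb[of "r n" x] by (cases "x \<in> B") auto
      qed
      show "AE x in \<mu>. (\<lambda>n. \<bar>indicator B x - s (r n) x\<bar>) \<longlonglongrightarrow> \<bar>indicator B x - h x\<bar>"
        using lim by (rule eventually_mono) (intro tendsto_intros)
    qed auto
    moreover have "(\<integral>x. \<bar>indicator B x - s (r n) x\<bar> \<partial>\<mu>) \<le> \<epsilon>" for n
      using smoothing_close[OF B(1) mpos, of "Suc (\<kappa> (r n))"] \<eta>(3) unfolding s_def by simp
    ultimately show "(\<integral>x. \<bar>indicator B x - h x\<bar> \<partial>\<mu>) \<le> \<epsilon>" by (intro LIMSEQ_le_const2) auto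
    \<comment> \<open>Z^2 is countable and each \<open>T w\<close> preserves the measure, so one
      null set serves all \<open>w\<close>.\<close>
    have "AE x in \<mu>. \<forall>w. (\<lambda>n. s (r n) (T w x)) \<longlonglongrightarrow> h (T w x)"
      unfolding AE_all_countable using AE_T[OF lim] by blast
    thus "AE x in \<mu>. \<forall>u w. \<bar>h (T u x) - h (T w x)\<bar> \<le> 30 / c * (orbit_dist B u w + \<bar>offset u - offset w\<bar>)"
    proof (rule eventually_mono, intro allI)
      fix x u w assume *: "\<forall>w. (\<lambda>n. s (r n) (T w x)) \<longlonglongrightarrow> h (T w x)"
      define D where "D = orbit_dist B u w + \<bar>offset u - offset w\<bar>"
      define m where "m = \<bar>real_of_int (fst u - fst w)\<bar>"
      have bound: "\<bar>s (r n) (T u x) - s (r n) (T w x)\<bar> \<le> 30 / c * (D + m * inverse (real (Suc n)))" for n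
      proof -
        define k where "k = Suc (\<kappa> (r n))"
        \<comment> \<open>Both subsequences are strictly increasing; the window index is therefore
          at least \<open>Suc n\<close>, and the column term tends to 0.\<close>
        have "n \<le> \<kappa> (r n)" using seq_suble[OF \<kappa>, of "r n"] seq_suble[OF r, of n] by linarith
        hence k: "k \<ge> 1" "real (Suc n) \<le> real k" by (auto simp: k_def)
        have "\<bar>s (r n) (T u x) - s (r n) (T w x)\<bar> \<le> 30 / c * (D + m / (2 * real k))"
          unfolding s_def k_def[symmetric] D_def m_def
          by (rule smoothing_shift[OF B(1) \<eta>(2) k(1) c(1) c(2)[OF k(1)]])
        also have "\<dots> \<le> 30 / c * (D + m * inverse (real (Suc n)))"
        proof (intro mult_left_mono add_left_mono)
          have "m / (2 * real k) \<le> m / real (Suc n)"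
            using k by (intro divide_left_mono) (auto simp: m_def)
          thus "m / (2 * real k) \<le> m * inverse (real (Suc n))" by (simp only: divide_inverse)
        qed (use c in simp)
        finally show ?thesis .
      qed
      have "(\<lambda>n. 30 / c * (D + m * inverse (real (Suc n)))) \<longlonglongrightarrow> 30 / c * (D + m * 0)"
        by (intro tendsto_intros LIMSEQ_inverse_real_of_nat)
      moreover have "(\<lambda>n. \<bar>s (r n) (T u x) - s (r n) (T w x)\<bar>) \<longlonglongrightarrow> \<bar>h (T u x) - h (T w x)\<bar>"
        by (intro tendsto_rabs tendsto_diff *[rule_format])
      ultimately show "\<bar>h (T u x) - h (T w x)\<bar> \<le> 30 / c * (orbit_dist B u w + \<bar>offset u - offset w\<bar>)"
        using bound unfolding D_def[symmetric] by (intro LIMSEQ_le) auto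
    qed
  qed
qed

end

section \<open>From discrete spectrum to equicontinuity in the mean\<close>

text \<open>The intersection over an empty \<open>I\<close> is \<open>UNIV\<close>, which
  \<open>space M\<close> cuts down to an event.\<close>

lemma (in prob_space) prob_INT_finite:
  assumes "finite I" and A: "\<And>i. i \<in> I \<Longrightarrow> A i \<in> events" and t: "\<And>i. i \<in> I \<Longrightarrow> prob (A i) \<ge> 1 - t i"
  shows "space M \<inter> (\<Inter>i\<in>I. A i) \<in> events" "prob (space M \<inter> (\<Inter>i\<in>I. A i)) \<ge> 1 - (\<Sum>i\<in>I. t i)"
proof -
  have eq: "space M \<inter> (\<Inter>i\<in>I. A i) = space M - (\<Union>i\<in>I. space M - A i)"
    by blast
  have U: "(\<Union>i\<in>I. space M - A i) \<in> events"
    by (intro sets.finite_UN sets.compl_sets assms)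
  show "space M \<inter> (\<Inter>i\<in>I. A i) \<in> events" unfolding eq by (rule sets.compl_sets[OF U])
  have "prob (\<Union>i\<in>I. space M - A i) \<le> (\<Sum>i\<in>I. prob (space M - A i))"
    using \<open>finite I\<close> A by (intro finite_measure_subadditive_finite) auto
  also have "\<dots> \<le> (\<Sum>i\<in>I. t i)"
  proof (rule sum_mono)
    fix i assume "i \<in> I"
    thus "prob (space M - A i) \<le> t i" using prob_compl[OF A] t by fastforce
  qed
  finally show "prob (space M \<inter> (\<Inter>i\<in>I. A i)) \<ge> 1 - (\<Sum>i\<in>I. t i)"
    unfolding eq using prob_compl[OF U] by linarith
qed

lemma (in prob_space) prob_INT_countable:
  fixes A :: "nat \<Rightarrow> 'a set"
  assumes "\<And>n. A n \<in> events" "\<And>n. prob (A n) \<ge> 1 - t n" "t sums s"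
  shows "prob (\<Inter>n. A n) \<ge> 1 - s"
proof -
  have eq: "(\<Inter>n. A n) = space M - (\<Union>n. space M - A n)"
    using sets.sets_into_space[OF assms(1)] by blast
  have le: "prob (space M - A n) \<le> t n" for n using assms(1,2)[of n] by (simp add: prob_compl)
  have sm: "summable (\<lambda>n. prob (space M - A n))"
    by (rule summable_comparison_test'[OF sums_summable[OF assms(3)], of 0]) (use le in auto)
  have "prob (\<Union>n. space M - A n) \<le> (\<Sum>n. prob (space M - A n))"
    by (rule finite_measure_subadditive_countably[OF _ sm]) (use assms(1) in auto)
  also have "\<dots> \<le> s" unfolding sums_unique[OF assms(3)]
    by (intro suminf_le le sm sums_summable[OF assms(3)])
  finally show ?thesis unfolding eq using assms(1) by (subst prob_compl) auto
qed

context Z2_system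
begin

text \<open>Colour a point by a nearby net point and by its offset cell of length
  \<open>e / 2\<close>, and keep one representative of each colour. The sum of both distances is
  what bounds the oscillation of \<open>h\<close> in
  \<open>almost_periodic_approximation\<close>.\<close>

lemma combined_net:
  assumes B: "B \<in> sets borel" "orbit_tb B b" and "e > 0"
  obtains W where "finite W" "\<And>w. w \<in> strip \<beta> b \<Longrightarrow> \<exists>v\<in>W. orbit_dist B w v + \<bar>offset w - offset v\<bar> < e"
proof -
  obtain V where V: "finite V" "\<forall>w\<in>strip \<beta> b. \<exists>v\<in>V. orbit_dist B w v < e / 4"
    using B(2) \<open>e > 0\<close> unfolding orbit_tb_def by (meson divide_pos_pos zero_less_numeral)
  obtain \<nu> where \<nu>: "\<And>w. w \<in> strip \<beta> b \<Longrightarrow> \<nu> w \<in> V \<and> orbit_dist B w (\<nu> w) < e / 4"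
    using V(2) by metis
  define \<kappa> where "\<kappa> = (\<lambda>w. (\<nu> w, \<lfloor>offset w / (e / 2)\<rfloor>))"
  have "\<kappa> ` strip \<beta> b \<subseteq> V \<times> {\<lfloor>- b / (e / 2)\<rfloor>..\<lfloor>b / (e / 2)\<rfloor>}"
  proof (rule image_subsetI)
    fix w assume w: "w \<in> strip \<beta> b"
    have "- b / (e / 2) \<le> offset w / (e / 2)" "offset w / (e / 2) \<le> b / (e / 2)"
      using w \<open>e > 0\<close> by (intro divide_right_mono; auto simp: strip_offset abs_le_iff)+
    thus "\<kappa> w \<in> V \<times> {\<lfloor>- b / (e / 2)\<rfloor>..\<lfloor>b / (e / 2)\<rfloor>}"
      using \<nu>[OF w] unfolding \<kappa>_def by (auto simp del: minus_divide_left intro!: floor_mono)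
  qed
  hence fin: "finite (\<kappa> ` strip \<beta> b)" using V(1) by (rule finite_subset[OF _ finite_cartesian_product]) auto
  have "\<exists>r. \<forall>y\<in>\<kappa> ` strip \<beta> b. r y \<in> strip \<beta> b \<and> \<kappa> (r y) = y"
    by (rule bchoice) auto
  then obtain r where r: "\<And>w. w \<in> strip \<beta> b \<Longrightarrow> r (\<kappa> w) \<in> strip \<beta> b \<and> \<kappa> (r (\<kappa> w)) = \<kappa> w" by blast
  show thesis
  proof (rule that[of "r ` \<kappa> ` strip \<beta> b"])
    show "finite (r ` \<kappa> ` strip \<beta> b)" using fin by simp
    fix w assume w: "w \<in> strip \<beta> b"
    define v where "v = r (\<kappa> w)"
    have v: "v \<in> strip \<beta> b" "\<nu> v = \<nu> w" "\<lfloor>offset v / (e / 2)\<rfloor> = \<lfloor>offset w / (e / 2)\<rfloor>"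
      using r[OF w] by (auto simp: v_def \<kappa>_def)
    have "orbit_dist B w v \<le> orbit_dist B w (\<nu> w) + orbit_dist B (\<nu> w) v"
      by (rule orbit_dist_triangle[OF B(1)])
    also have "\<dots> < e / 2"
      using \<nu>[OF w] \<nu>[OF v(1)] v(2) orbit_dist_commute[of B "\<nu> w" v] by simp
    finally have "orbit_dist B w v < e / 2" .
    moreover have "\<bar>offset w / (e / 2) - offset v / (e / 2)\<bar> \<le> 1" using v(3) by linarith
    hence "\<bar>offset w * 2 - offset v * 2\<bar> \<le> e"
      using \<open>e > 0\<close> by (simp add: diff_divide_distrib[symmetric])
    hence "\<bar>offset w - offset v\<bar> \<le> e / 2" by linarith
    ultimately show "\<exists>v\<in>r ` \<kappa> ` strip \<beta> b. orbit_dist B w v + \<bar>offset w - offset v\<bar> < e"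
      using w unfolding v_def by (intro bexI[of _ "r (\<kappa> w)"]) auto
  qed
qed

lemma indicator_averages_equicontinuous:
  fixes b \<epsilon> \<tau> :: real
  assumes B: "B \<in> sets borel" "\<And>b. b > 0 \<Longrightarrow> orbit_tb B b" and "b > 0" "\<epsilon> > 0" "\<tau> > 0"
  obtains K \<delta> where "K \<in> sets \<mu>" "prob K \<ge> 1 - \<tau>" "\<delta> > 0"
    "\<And>x y k. \<lbrakk>x \<in> K; y \<in> K; dist x y < \<delta>; k \<ge> 1\<rbrakk> \<Longrightarrow>
      (\<Sum>w\<in>slab 0 (int k) b. \<bar>indicat_real B (T w x) - indicator B (T w y)\<bar>) \<le> \<epsilon> * card (slab 0 (int k) b)"
proof -
  obtain c where c: "c > 0" "\<And>k. k \<ge> 1 \<Longrightarrow> c * real k \<le> card (slab 0 (int k) b)"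
    using slab_density[OF \<open>b > 0\<close>] by blast
  \<comment> \<open>Five shares: the averages of \<open>g\<close> along the orbits of
    \<open>x\<close> and \<open>y\<close>, the step from \<open>w\<close> to a net point
    \<open>v\<close> at \<open>x\<close> and at \<open>y\<close>, and the uniform continuity of h o
    T^v.\<close>
  define \<theta> where "\<theta> = \<epsilon> / 5"
  have \<theta>: "\<theta> > 0" using \<open>\<epsilon> > 0\<close> by (simp add: \<theta>_def)
  \<comment> \<open>Chosen so that the maximal inequality for \<open>g\<close> bounds
    \<open>prob E\<close> by \<open>\<tau> / 2\<close>.\<close>
  define \<eta> where "\<eta> = \<theta> * c * \<tau> / (2 * (2 * b + 3))"
  have \<eta>: "\<eta> > 0" unfolding \<eta>_def using \<theta> c(1) \<open>\<tau> > 0\<close> \<open>b > 0\<close> by simp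
  obtain h C where h: "C \<ge> 0" "integrable \<mu> h" "(\<integral>x. \<bar>indicator B x - h x\<bar> \<partial>\<mu>) \<le> \<eta>"
    and ap: "AE x in \<mu>. \<forall>u w. \<bar>h (T u x) - h (T w x)\<bar> \<le> C * (orbit_dist B u w + \<bar>offset u - offset w\<bar>)"
    by (rule almost_periodic_approximation[OF B(1) B(2)[OF zero_less_one] \<eta>])
  have [measurable]: "h \<in> borel_measurable \<mu>" using h by auto
  define g where "g = (\<lambda>x. \<bar>indicator B x - h x\<bar>)"
  have Bm: "B \<in> sets \<mu>" using B sets_M by simp
  have g: "integrable \<mu> g" "\<And>x. g x \<ge> 0"
    unfolding g_def using integrable_ind[OF Bm] h(2) by auto
  define E where "E = {x. \<exists>k\<ge>1. \<theta> * card (slab 0 (int k) b) < (\<Sum>w\<in>slab 0 (int k) b. g (T w x))}"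
  note max = maximal_inequality[OF g \<open>b > 0\<close> \<theta> c, folded E_def]
  have "\<theta> * c * prob E \<le> (2 * b + 3) * \<eta>"
    using max(2) h(3) \<open>b > 0\<close> unfolding g_def
    by (meson mult_left_mono order_trans add_nonneg_nonneg less_imp_le mult_nonneg_nonneg zero_le_numeral)
  also have "\<dots> = \<theta> * c * (\<tau> / 2)" using \<open>b > 0\<close> by (simp add: \<eta>_def field_simps)
  finally have PE: "prob E \<le> \<tau> / 2" using \<theta> c(1) by (simp add: mult_le_cancel_left)
  from ap obtain Z where Z: "{x \<in> space \<mu>. \<not> (\<forall>u w. \<bar>h (T u x) - h (T w x)\<bar> \<le> C * (orbit_dist B u w + \<bar>offset u - offset w\<bar>))} \<subseteq> Z"
      "emeasure \<mu> Z = 0" "Z \<in> sets \<mu>" by (rule AE_E)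
  \<comment> \<open>\<open>C\<close> depends on \<open>\<eta>\<close>, so the net can be chosen only
    now; \<open>C + 1\<close> also covers \<open>C = 0\<close>.\<close>
  have "\<theta> / (C + 1) > 0" using \<theta> h(1) by simp
  then obtain W where W: "finite W"
      "\<And>w. w \<in> strip \<beta> b \<Longrightarrow> \<exists>v\<in>W. orbit_dist B w v + \<bar>offset w - offset v\<bar> < \<theta> / (C + 1)"
    using combined_net[OF B(1) B(2)[OF \<open>b > 0\<close>]] by blast
  define \<tau>' where "\<tau>' = \<tau> / (2 * (card W + 1))"
  have \<tau>': "\<tau>' > 0" using \<open>\<tau> > 0\<close> by (simp add: \<tau>'_def)
  have "\<exists>K\<in>sets \<mu>. prob K > 1 - \<tau>' \<and> uniformly_continuous_on K (\<lambda>x. h (T v x))" for v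
    by (rule Lusin[OF integrable_T[OF h(2)] \<tau>'])
  then obtain L where L: "\<And>v. L v \<in> sets \<mu>" "\<And>v. prob (L v) > 1 - \<tau>'"
      "\<And>v. uniformly_continuous_on (L v) (\<lambda>x. h (T v x))" by metis
  have "\<exists>d>0. \<forall>x\<in>L v. \<forall>y\<in>L v. dist y x < d \<longrightarrow> dist (h (T v y)) (h (T v x)) < \<theta>" for v
    using L(3)[of v] \<theta> unfolding uniformly_continuous_on_def by blast
  then obtain d where d: "\<And>v. d v > 0"
      "\<And>v x y. x \<in> L v \<Longrightarrow> y \<in> L v \<Longrightarrow> dist y x < d v \<Longrightarrow> dist (h (T v y)) (h (T v x)) < \<theta>" by metis
  define \<delta> where "\<delta> = Min (insert 1 (d ` W))"
  have \<delta>: "\<delta> > 0" "\<And>v. v \<in> W \<Longrightarrow> \<delta> \<le> d v"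
    unfolding \<delta>_def using W(1) d(1) by auto
  define K1 where "K1 = space \<mu> \<inter> (\<Inter>v\<in>W. L v)"
  have LW: "\<And>v. v \<in> W \<Longrightarrow> prob (L v) \<ge> 1 - \<tau>'" using L(2) by (rule less_imp_le)
  have K1: "K1 \<in> sets \<mu>" unfolding K1_def by (rule prob_INT_finite(1)[OF W(1) L(1) LW])
  have PK1: "prob K1 \<ge> 1 - \<tau> / 2"
  proof -
    have "prob K1 \<ge> 1 - (\<Sum>v\<in>W. \<tau>')" unfolding K1_def
      by (rule prob_INT_finite(2)[OF W(1) L(1) LW])
    moreover have "(\<Sum>v\<in>W. \<tau>') \<le> \<tau> / 2" using \<open>\<tau> > 0\<close> by (simp add: \<tau>'_def field_simps)
    ultimately show ?thesis by linarith
  qed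
  define K where "K = K1 - Z - E"
  show thesis
  proof (rule that[of K \<delta>])
    show Km: "K \<in> sets \<mu>" unfolding K_def using K1 Z(3) max(1) by auto
    have "prob K1 \<le> prob (K \<union> E \<union> Z)"
    proof (rule finite_measure_mono)
      show "K1 \<subseteq> K \<union> E \<union> Z" by (auto simp: K_def)
    qed (intro sets.Un Km max(1) Z(3))
    also have "\<dots> \<le> prob (K \<union> E) + prob Z" using Km max(1) Z(3) by (intro measure_Un_le) auto
    also have "prob (K \<union> E) \<le> prob K + prob E" using Km max(1) by (intro measure_Un_le) auto
    also have "prob Z = 0" using Z(2) by (simp add: measure_def)
    finally show "prob K \<ge> 1 - \<tau>" using PK1 PE by linarith
    show "\<delta> > 0" by (rule \<delta>(1))
    fix x y k assume xy: "x \<in> K" "y \<in> K" "dist x y < \<delta>" and k: "k \<ge> (1::nat)"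
    have pt: "\<bar>indicat_real B (T w x) - indicator B (T w y)\<bar> \<le> g (T w x) + g (T w y) + 3 * \<theta>"
      if w: "w \<in> slab 0 (int k) b" for w
    proof -
      have "w \<in> strip \<beta> b" using w by (simp add: slab_def strip_offset)
      then obtain v where v: "v \<in> W" "orbit_dist B w v + \<bar>offset w - offset v\<bar> < \<theta> / (C + 1)"
        using W(2) by blast
      have "C * (orbit_dist B w v + \<bar>offset w - offset v\<bar>) \<le> C * (\<theta> / (C + 1))"
        using v(2) h(1) by (intro mult_left_mono) auto
      also have "\<dots> \<le> \<theta>" using h(1) \<theta> by (simp add: field_simps)
      finally have "C * (orbit_dist B w v + \<bar>offset w - offset v\<bar>) \<le> \<theta>" .
      have near: "\<bar>h (T w z) - h (T v z)\<bar> \<le> \<theta>" if "z \<in> K" for z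
      proof -
        have "\<bar>h (T w z) - h (T v z)\<bar> \<le> C * (orbit_dist B w v + \<bar>offset w - offset v\<bar>)"
        proof -
          have "z \<notin> Z" using that by (simp add: K_def)
          thus ?thesis using Z(1) unfolding space_M by blast
        qed
        thus ?thesis using \<open>C * (orbit_dist B w v + \<bar>offset w - offset v\<bar>) \<le> \<theta>\<close> by linarith
      qed
      have "x \<in> L v" "y \<in> L v" using xy v(1) by (auto simp: K_def K1_def)
      hence "\<bar>h (T v x) - h (T v y)\<bar> < \<theta>"
        using d(2)[of y v x] xy(3) \<delta>(2)[OF v(1)] by (simp add: dist_real_def)
      thus ?thesis using near[OF xy(1)] near[OF xy(2)] unfolding g_def by linarith
    qed
    define n where "n = real (card (slab 0 (int k) b))"
    have avg: "(\<Sum>w\<in>slab 0 (int k) b. g (T w z)) \<le> \<theta> * n" if "z \<in> K" for z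
      using that k unfolding K_def E_def n_def by (auto simp: not_less)
    have "(\<Sum>w\<in>slab 0 (int k) b. \<bar>indicat_real B (T w x) - indicator B (T w y)\<bar>)
        \<le> (\<Sum>w\<in>slab 0 (int k) b. g (T w x) + g (T w y) + 3 * \<theta>)" by (intro sum_mono pt)
    also have "\<dots> = (\<Sum>w\<in>slab 0 (int k) b. g (T w x)) + (\<Sum>w\<in>slab 0 (int k) b. g (T w y)) + n * (3 * \<theta>)"
      by (simp add: sum.distrib n_def)
    also have "\<dots> \<le> \<epsilon> * n" using avg[OF xy(1)] avg[OF xy(2)] by (simp add: \<theta>_def algebra_simps)
    finally show "(\<Sum>w\<in>slab 0 (int k) b. \<bar>indicat_real B (T w x) - indicator B (T w y)\<bar>)
        \<le> \<epsilon> * card (slab 0 (int k) b)" unfolding n_def .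
  qed
qed

section \<open>From indicators of balls to averages of the metric\<close>

lemma compact_UNIV: "compact (UNIV :: 'a set)"
  using tds by (simp add: Z2_tds_def)

lemma dist_bounded: obtains D where "D > 0" "\<And>x y :: 'a. dist x y \<le> D"
proof -
  obtain e where e: "\<And>x y :: 'a. dist x y \<le> e"
    using compact_imp_bounded[OF compact_UNIV] unfolding bounded_two_points by blast
  show thesis
    by (rule that[of "\<bar>e\<bar> + 1"]) (use e in \<open>auto intro: order_trans[OF e]\<close>)
qed

lemma finite_ball_cover:
  assumes "e > 0"
  obtains P :: "'a set" where "finite P" "UNIV = (\<Union>p\<in>P. ball p e)"
proof -
  have "\<exists>k. finite k \<and> (k :: 'a set) \<subseteq> UNIV \<and> UNIV \<subseteq> (\<Union>x\<in>k. ball x e)"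
    using compact_UNIV assms unfolding compact_eq_totally_bounded by blast
  thus thesis using that by blast
qed

lemma card_strip_upto_pos: "b > 0 \<Longrightarrow> k \<ge> 1 \<Longrightarrow> card (strip_upto \<beta> b k) > 0"
  using strip_upto_origin[of b k \<beta>] finite_strip_upto[of \<beta> b k] by (auto simp: card_gt_0_iff)

text \<open>Take a ball of a finite cover that contains the first point: either the second lies in
  it too, and the two are within \<open>\<epsilon> / 4\<close>, or the indicator of the ball tells
  them apart, at a cost of at most \<open>D\<close>. This reduces the metric to finitely many
  indicators.\<close>

lemma dbar_equicontinuous:
  assumes ds: "\<And>B b. B \<in> sets borel \<Longrightarrow> b > 0 \<Longrightarrow> orbit_tb B b" and "b > 0" "\<epsilon> > 0" "\<tau> > 0"
  shows "\<exists>K \<delta>. K \<in> sets \<mu> \<and> prob K \<ge> 1 - \<tau> \<and> \<delta> > 0 \<and>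
    (\<forall>x y k. x \<in> K \<longrightarrow> y \<in> K \<longrightarrow> dist x y < \<delta> \<longrightarrow> k \<ge> 1 \<longrightarrow> dbar T \<beta> b k x y < \<epsilon>)"
proof -
  obtain D where D: "D > 0" "\<And>x y :: 'a. dist x y \<le> D" using dist_bounded by blast
  obtain P :: "'a set" where P: "finite P" "UNIV = (\<Union>p\<in>P. ball p (\<epsilon> / 8))"
    using finite_ball_cover[of "\<epsilon> / 8"] \<open>\<epsilon> > 0\<close> by auto
  define N where "N = real (card P) + 1"
  have N: "N > 0" by (simp add: N_def)
  \<comment> \<open>The indicator terms then contribute at most
    \<open>D * N * \<epsilon>' = \<epsilon> / 4\<close> to the average.\<close>
  define \<epsilon>' where "\<epsilon>' = \<epsilon> / (4 * D * N)"
  have "\<epsilon>' > 0" using \<open>\<epsilon> > 0\<close> D(1) N by (simp add: \<epsilon>'_def)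
  moreover have "\<tau> / N > 0" using \<open>\<tau> > 0\<close> N by simp
  ultimately have ex: "\<exists>K \<delta>. K \<in> sets \<mu> \<and> prob K \<ge> 1 - \<tau> / N \<and> \<delta> > 0 \<and>
    (\<forall>x y k. x \<in> K \<longrightarrow> y \<in> K \<longrightarrow> dist x y < \<delta> \<longrightarrow> k \<ge> 1 \<longrightarrow>
      (\<Sum>w\<in>slab 0 (int k) b. \<bar>indicat_real (ball p (\<epsilon> / 8)) (T w x) - indicator (ball p (\<epsilon> / 8)) (T w y)\<bar>)
        \<le> \<epsilon>' * card (slab 0 (int k) b))" for p
  proof -
    assume pos: "\<epsilon>' > 0" "\<tau> / N > 0"
    have bs: "ball p (\<epsilon> / 8) \<in> sets borel" by simp
    show ?thesis
      by (rule indicator_averages_equicontinuous[OF bs ds[OF bs] \<open>b > 0\<close> pos]) blast+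
  qed
  from choice[OF allI[OF ex]] obtain K where "\<forall>p. \<exists>\<delta>. K p \<in> sets \<mu> \<and> prob (K p) \<ge> 1 - \<tau> / N \<and> \<delta> > 0 \<and>
    (\<forall>x y k. x \<in> K p \<longrightarrow> y \<in> K p \<longrightarrow> dist x y < \<delta> \<longrightarrow> k \<ge> 1 \<longrightarrow>
      (\<Sum>w\<in>slab 0 (int k) b. \<bar>indicat_real (ball p (\<epsilon> / 8)) (T w x) - indicator (ball p (\<epsilon> / 8)) (T w y)\<bar>)
        \<le> \<epsilon>' * card (slab 0 (int k) b))" ..
  from choice[OF this] obtain \<delta> where K: "\<And>p. K p \<in> sets \<mu>" "\<And>p. prob (K p) \<ge> 1 - \<tau> / N" "\<And>p. \<delta> p > 0"
    and avg: "\<And>p x y k. \<lbrakk>x \<in> K p; y \<in> K p; dist x y < \<delta> p; k \<ge> 1\<rbrakk> \<Longrightarrow>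
      (\<Sum>w\<in>slab 0 (int k) b. \<bar>indicat_real (ball p (\<epsilon> / 8)) (T w x) - indicator (ball p (\<epsilon> / 8)) (T w y)\<bar>)
        \<le> \<epsilon>' * card (slab 0 (int k) b)"
    by blast
  define K' where "K' = space \<mu> \<inter> (\<Inter>p\<in>P. K p)"
  define \<delta>' where "\<delta>' = Min (insert 1 (\<delta> ` P))"
  show ?thesis
  proof (intro exI[of _ K'] exI[of _ \<delta>'] conjI allI impI)
    show "K' \<in> sets \<mu>" unfolding K'_def by (rule prob_INT_finite(1)[OF P(1) K(1,2)])
    have "prob K' \<ge> 1 - (\<Sum>p\<in>P. \<tau> / N)" unfolding K'_def
      by (rule prob_INT_finite(2)[OF P(1) K(1,2)])
    moreover have "(\<Sum>p\<in>P. \<tau> / N) \<le> \<tau>" using N \<open>\<tau> > 0\<close> by (simp add: N_def field_simps)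
    ultimately show "prob K' \<ge> 1 - \<tau>" by linarith
    show "\<delta>' > 0" unfolding \<delta>'_def using P(1) K(3) by auto
    fix x y k assume xy: "x \<in> K'" "y \<in> K'" "dist x y < \<delta>'" and k: "k \<ge> (1::nat)"
    define n where "n = real (card (slab 0 (int k) b))"
    have n: "n > 0" using card_strip_upto_pos[OF \<open>b > 0\<close> k] by (simp add: n_def strip_upto_slab)
    have pt: "dist u v \<le> \<epsilon> / 4 + D * (\<Sum>p\<in>P. \<bar>indicat_real (ball p (\<epsilon> / 8)) u - indicator (ball p (\<epsilon> / 8)) v\<bar>)" for u v
    proof -
      obtain p where p: "p \<in> P" "u \<in> ball p (\<epsilon> / 8)" using P(2) by blast
      have s0: "(\<Sum>p\<in>P. \<bar>indicat_real (ball p (\<epsilon> / 8)) u - indicator (ball p (\<epsilon> / 8)) v\<bar>) \<ge> 0"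
        by (intro sum_nonneg) auto
      show ?thesis
      proof (cases "v \<in> ball p (\<epsilon> / 8)")
        case True
        have "dist u v \<le> dist p u + dist p v" by (rule dist_triangle3)
        also have "\<dots> \<le> \<epsilon> / 4" using True p(2) by simp
        finally show ?thesis using s0 D(1) by (simp add: add_increasing2)
      next
        case False
        hence "1 = \<bar>indicat_real (ball p (\<epsilon> / 8)) u - indicator (ball p (\<epsilon> / 8)) v\<bar>" using p(2) by simp
        also have "\<dots> \<le> (\<Sum>p\<in>P. \<bar>indicat_real (ball p (\<epsilon> / 8)) u - indicator (ball p (\<epsilon> / 8)) v\<bar>)"
          by (rule member_le_sum[OF p(1) _ P(1)]) auto
        finally have "D * 1 \<le> D * (\<Sum>p\<in>P. \<bar>indicat_real (ball p (\<epsilon> / 8)) u - indicator (ball p (\<epsilon> / 8)) v\<bar>)"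
          using D(1) by (intro mult_left_mono) auto
        thus ?thesis using D(2)[of u v] \<open>\<epsilon> > 0\<close> by linarith
      qed
    qed
    have "(\<Sum>w\<in>slab 0 (int k) b. dist (T w x) (T w y))
        \<le> (\<Sum>w\<in>slab 0 (int k) b. \<epsilon> / 4 + D * (\<Sum>p\<in>P. \<bar>indicat_real (ball p (\<epsilon> / 8)) (T w x) - indicator (ball p (\<epsilon> / 8)) (T w y)\<bar>))"
      by (intro sum_mono pt)
    also have "\<dots> = n * (\<epsilon> / 4) + D * (\<Sum>p\<in>P. \<Sum>w\<in>slab 0 (int k) b.
        \<bar>indicat_real (ball p (\<epsilon> / 8)) (T w x) - indicator (ball p (\<epsilon> / 8)) (T w y)\<bar>)"
      unfolding sum.distrib sum_distrib_left[symmetric] n_def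
      by (subst sum.swap) simp
    also have "\<dots> \<le> n * (\<epsilon> / 4) + D * (\<Sum>p\<in>P. \<epsilon>' * n)"
    proof (intro add_left_mono mult_left_mono sum_mono)
      fix p assume p: "p \<in> P"
      have "\<delta>' \<le> \<delta> p" unfolding \<delta>'_def using P(1) p by (intro Min_le) auto
      thus "(\<Sum>w\<in>slab 0 (int k) b. \<bar>indicat_real (ball p (\<epsilon> / 8)) (T w x) - indicator (ball p (\<epsilon> / 8)) (T w y)\<bar>) \<le> \<epsilon>' * n"
        unfolding n_def using xy p k by (intro avg) (auto simp: K'_def)
    qed (use D(1) in simp)
    also have "\<dots> \<le> n * (\<epsilon> / 4) + n * (\<epsilon> / 4)"
    proof -
      have "D * (\<Sum>p\<in>P. \<epsilon>' * n) = (D * real (card P) * \<epsilon>') * n" by simp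
      also have "\<dots> \<le> (D * N * \<epsilon>') * n"
        using D(1) n \<open>\<epsilon>' > 0\<close> by (intro mult_right_mono mult_left_mono) (auto simp: N_def)
      also have "D * N * \<epsilon>' = \<epsilon> / 4" using D(1) N by (simp add: \<epsilon>'_def field_simps)
      finally show ?thesis by (simp add: mult.commute)
    qed
    also have "\<dots> < \<epsilon> * n" using n \<open>\<epsilon> > 0\<close> by simp
    finally show "dbar T \<beta> b k x y < \<epsilon>"
      unfolding dbar_def strip_upto_slab n_def[symmetric] using n by (simp add: divide_less_eq)
  qed
qed

lemma orbit_tb_of_discrete_spectrum:
  assumes "discrete_spectrum T \<beta> \<mu>" "B \<in> sets borel" "b > 0"
  shows "orbit_tb B b"
proof -
  have "B \<in> Kronecker_strip T \<beta> 1 \<mu>"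
    using assms by (simp add: discrete_spectrum_def Kronecker_algebra_def)
  thus ?thesis
    using Kronecker_strip_width[OF tds inv zero_less_one assms(3)] Kronecker_strip_iff[OF assms(2)] by blast
qed

text \<open>\<open>K\<close> must serve every \<open>\<epsilon>\<close>, so the sets for
  \<open>\<epsilon> = 1 / (n + 1)\<close> are intersected, with losses of measure summing to
  \<open>\<tau> / 2\<close>. As \<open>dbar\<close> is small for all \<open>k \<ge> 1\<close> at
  once, so is \<open>dhat\<close>.\<close>

lemma discrete_spectrum_imp_equicontinuous_in_mean:
  assumes ds: "discrete_spectrum T \<beta> \<mu>" and "b > 0"
  shows "equicontinuous_in_mean T \<mu> \<beta> b"
  unfolding equicontinuous_in_mean_def
proof (intro allI impI)
  fix \<tau> :: real assume "\<tau> > 0"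
  have "\<exists>K \<delta>. K \<in> sets \<mu> \<and> prob K \<ge> 1 - (\<tau> / 2) * (1/2) ^ Suc n \<and> \<delta> > 0 \<and>
    (\<forall>x y k. x \<in> K \<longrightarrow> y \<in> K \<longrightarrow> dist x y < \<delta> \<longrightarrow> k \<ge> 1 \<longrightarrow> dbar T \<beta> b k x y < inverse (real (Suc n)))" for n
    by (rule dbar_equicontinuous[OF orbit_tb_of_discrete_spectrum[OF ds] \<open>b > 0\<close>]) (use \<open>\<tau> > 0\<close> in auto)
  then obtain K \<delta> where K: "\<And>n. K n \<in> sets \<mu>" "\<And>n. prob (K n) \<ge> 1 - (\<tau> / 2) * (1/2) ^ Suc n" "\<And>n. \<delta> n > 0"
    and eq: "\<And>n x y k. \<lbrakk>x \<in> K n; y \<in> K n; dist x y < \<delta> n; k \<ge> 1\<rbrakk> \<Longrightarrow> dbar T \<beta> b k x y < inverse (real (Suc n))"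
    by metis
  have "prob (\<Inter>n. K n) \<ge> 1 - (\<tau> / 2) * 1"
    by (rule prob_INT_countable[OF K(1,2)]) (intro sums_mult power_half_series)
  show "\<exists>K\<in>sets borel. prob K > 1 - \<tau> \<and> equicontinuous_in_mean_on T \<beta> b K"
  proof (intro bexI[of _ "\<Inter>n. K n"] conjI)
    show "(\<Inter>n. K n) \<in> sets borel" using K(1) sets_M by auto
    show "prob (\<Inter>n. K n) > 1 - \<tau>" using \<open>prob (\<Inter>n. K n) \<ge> 1 - (\<tau> / 2) * 1\<close> \<open>\<tau> > 0\<close> by linarith
    show "equicontinuous_in_mean_on T \<beta> b (\<Inter>n. K n)"
      unfolding equicontinuous_in_mean_on_def
    proof (intro allI impI)
      fix \<epsilon> :: real assume "\<epsilon> > 0"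
      then obtain n where n: "inverse (real (Suc n)) < \<epsilon>" using reals_Archimedean by blast
      show "\<exists>\<delta>>0. \<forall>k\<ge>1. \<forall>x\<in>\<Inter>n. K n. \<forall>y\<in>\<Inter>n. K n. dist x y < \<delta> \<longrightarrow> dhat T \<beta> b k x y < \<epsilon>"
      proof (intro exI[of _ "\<delta> n"] conjI allI impI ballI)
        fix k x y assume *: "(1::nat) \<le> k" "x \<in> (\<Inter>n. K n)" "y \<in> (\<Inter>n. K n)" "dist x y < \<delta> n"
        have "dbar T \<beta> b i x y < \<epsilon>" if "i \<in> {1..k}" for i
          using eq[of x n y i] * that n by auto
        thus "dhat T \<beta> b k x y < \<epsilon>" unfolding dhat_def using *(1) by (subst Max_less_iff) auto
      qed (rule K(3))
    qed
  qed
qed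

end

section \<open>From bounded complexity to discrete spectrum\<close>

text \<open>Padding to \<open>C\<close> indices, possibly with points outside \<open>F\<close>, lets
  the colours for different \<open>k\<close> be functions on one index set.\<close>

lemma finite_subset_enumeration:
  assumes "finite F" "card F \<le> C"
  obtains p :: "nat \<Rightarrow> 'a" where "F \<subseteq> p ` {..<C}"
proof -
  obtain h where "bij_betw h {0..<card F} F" using ex_bij_betw_nat_finite[OF assms(1)] by blast
  hence "F = h ` {0..<card F}" by (simp add: bij_betw_def)
  also have "\<dots> \<subseteq> h ` {..<C}" using assms(2) by (intro image_mono) auto
  finally show thesis by (rule that)
qed

context Z2_system
begin

lemma continuous_dbar: "continuous_on UNIV (\<lambda>y. dbar T \<beta> b k x y)"
  unfolding dbar_def divide_inverse by (intro continuous_intros continuous_T)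

lemma open_dbar_ball: "open {y. dbar T \<beta> b k x y < \<epsilon>}"
  by (rule open_Collect_less[OF continuous_dbar continuous_on_const])

lemma dbar_ball_sets: "{y. dbar T \<beta> b k x y < \<epsilon>} \<in> sets \<mu>"
  using open_dbar_ball sets_M by auto

lemma dbar_measurable [measurable]: "(\<lambda>y. dbar T \<beta> b k x y) \<in> borel_measurable \<mu>"
  by (intro borel_measurable_M borel_measurable_continuous_onI continuous_dbar)

lemma dbar_self [simp]: "dbar T \<beta> b k x x = 0"
  by (simp add: dbar_def)

definition fun_dist :: "('a \<Rightarrow> real) \<Rightarrow> int \<times> int \<Rightarrow> int \<times> int \<Rightarrow> real" where
  "fun_dist f u w = (\<integral>x. \<bar>f (T u x) - f (T w x)\<bar> \<partial>\<mu>)"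

text \<open>The colour of \<open>w\<close> records the values of \<open>f \<circ> T w\<close> at the centres of the balls up to \<open>\<eta>\<close>. The
  set of colours does not depend on \<open>k\<close>.\<close>

lemma strip_colouring:
  fixes b \<eta> :: real
  assumes bc: "bounded_complexity \<mu> (dbar T \<beta> b)" and "b > 0" "\<eta> > 0"
    and f: "Lipschitz_bounded f"
  obtains Y :: "(nat \<Rightarrow> int) set" where "finite Y"
    "\<And>k. k \<ge> 1 \<Longrightarrow> \<exists>col Bad. Bad \<subseteq> slab 0 (int k) b \<and> real (card Bad) \<le> \<eta> * card (slab 0 (int k) b) \<and>
      (\<forall>w. col w \<in> Y) \<and>
      (\<forall>u\<in>slab 0 (int k) b - Bad. \<forall>w\<in>slab 0 (int k) b - Bad. col u = col w \<longrightarrow> fun_dist f u w \<le> 4 * \<eta>)"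
proof -
  obtain L where L: "L \<ge> 0" "\<And>x y. \<bar>f x - f y\<bar> \<le> L * dist x y"
    using f by (auto simp: Lipschitz_bounded_def)
  obtain M where M: "\<And>x. \<bar>f x\<bar> \<le> M" using f by (auto simp: Lipschitz_bounded_def)
  have M0: "M \<ge> 0" using M[of undefined] by linarith
  note [measurable] = Lipschitz_bounded_integrable(1)[OF f]
  \<comment> \<open>The first entry gives the average \<open>\<eta>\<^sup>2\<close> that Markov's
    inequality needs; the second makes the points outside the balls contribute at most
    \<open>\<eta>\<close>.\<close>
  define \<epsilon> where "\<epsilon> = min (\<eta>\<^sup>2 / (L + 1)) (\<eta> / (2 * M + 1))"
  have \<epsilon>: "\<epsilon> > 0" using \<open>\<eta> > 0\<close> L(1) M0 by (simp add: \<epsilon>_def)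
  have "L * \<epsilon> \<le> L * (\<eta>\<^sup>2 / (L + 1))" using L(1) by (intro mult_left_mono) (auto simp: \<epsilon>_def)
  also have "\<dots> \<le> \<eta>\<^sup>2" using L(1) by (simp add: field_simps)
  finally have \<epsilon>1: "L * \<epsilon> \<le> \<eta>\<^sup>2" .
  have "2 * M * \<epsilon> \<le> 2 * M * (\<eta> / (2 * M + 1))" using M0 by (intro mult_left_mono) (auto simp: \<epsilon>_def)
  also have "\<dots> \<le> \<eta>" using M0 \<open>\<eta> > 0\<close> by (simp add: field_simps)
  finally have \<epsilon>2: "2 * M * \<epsilon> \<le> \<eta>" .
  obtain C where C: "\<And>k. k \<ge> 1 \<Longrightarrow> \<exists>F. finite F \<and> card F \<le> C \<and> prob (\<Union>x\<in>F. {y. dbar T \<beta> b k x y < \<epsilon>}) > 1 - \<epsilon>"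
    using bc \<epsilon> unfolding bounded_complexity_def by blast
  define Y where "Y = PiE {..<C} (\<lambda>_. {\<lfloor>- M / \<eta>\<rfloor>..\<lfloor>M / \<eta>\<rfloor>})"
  show thesis
  proof (rule that[of Y])
    show "finite Y" unfolding Y_def by (intro finite_PiE) auto
    fix k :: nat assume k: "k \<ge> 1"
    obtain F where F: "finite F" "card F \<le> C" "prob (\<Union>x\<in>F. {y. dbar T \<beta> b k x y < \<epsilon>}) > 1 - \<epsilon>"
      using C[OF k] by blast
    obtain p where p: "F \<subseteq> p ` {..<C}" using finite_subset_enumeration[OF F(1,2)] by blast
    define U where "U = (\<Union>i<C. {y. dbar T \<beta> b k (p i) y < \<epsilon>})"
    have U [measurable]: "U \<in> sets \<mu>" unfolding U_def by (intro sets.finite_UN dbar_ball_sets) auto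
    have "prob (\<Union>x\<in>F. {y. dbar T \<beta> b k x y < \<epsilon>}) \<le> prob U"
      by (rule finite_measure_mono[OF _ U]) (use p in \<open>auto simp: U_def\<close>)
    hence PU: "prob U > 1 - \<epsilon>" using F(3) by linarith
    have cU [measurable]: "UNIV - U \<in> sets \<mu>" using sets.compl_sets[OF U] by simp
    \<comment> \<open>Taking the least index makes the choice of a centre measurable.\<close>
    define I where "I = (\<lambda>y. LEAST i. dbar T \<beta> b k (p i) y < \<epsilon>)"
    have Im [measurable]: "I \<in> measurable \<mu> (count_space UNIV)" unfolding I_def by measurable
    have IU: "I y < C" "dbar T \<beta> b k (p (I y)) y < \<epsilon>" if y: "y \<in> U" for y
    proof -
      obtain i where i: "i < C" "dbar T \<beta> b k (p i) y < \<epsilon>" using y by (auto simp: U_def)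
      show "dbar T \<beta> b k (p (I y)) y < \<epsilon>" unfolding I_def by (rule LeastI[of "\<lambda>i. dbar T \<beta> b k (p i) y < \<epsilon>", OF i(2)])
      have "I y \<le> i" unfolding I_def by (rule Least_le[of "\<lambda>i. dbar T \<beta> b k (p i) y < \<epsilon>", OF i(2)])
      thus "I y < C" using i(1) by linarith
    qed
    define \<phi> where "\<phi> = (\<lambda>w x. indicator U x * \<bar>f (T w x) - f (T w (p (I x)))\<bar>)"
    have \<phi>m [measurable]: "\<phi> w \<in> borel_measurable \<mu>" for w
    proof -
      have "(\<lambda>x. f (T w (p (I x)))) \<in> borel_measurable \<mu>"
        by (rule measurable_compose[OF Im]) simp
      thus ?thesis unfolding \<phi>_def by measurable
    qed
    have \<phi>0: "\<phi> w x \<ge> 0" for w x by (simp add: \<phi>_def)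
    have \<phi>i: "integrable \<mu> (\<phi> w)" for w
    proof (rule integrable_const_bound[of _ "2 * M"])
      show "AE x in \<mu>. norm (\<phi> w x) \<le> 2 * M"
      proof (intro AE_I2)
        fix x show "norm (\<phi> w x) \<le> 2 * M"
          using M[of "T w x"] M[of "T w (p (I x))"] M0 abs_triangle_ineq4[of "f (T w x)" "f (T w (p (I x)))"]
          by (simp add: \<phi>_def indicator_def)
      qed
    qed measurable
    define e where "e = (\<lambda>w. \<integral>x. \<phi> w x \<partial>\<mu>)"
    define n where "n = real (card (slab 0 (int k) b))"
    have n: "n > 0" using card_strip_upto_pos[OF \<open>b > 0\<close> k] by (simp add: n_def strip_upto_slab)
    have sum_\<phi>: "(\<Sum>w\<in>slab 0 (int k) b. \<phi> w x) \<le> n * \<eta>\<^sup>2" for x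
    proof (cases "x \<in> U")
      case True
      have "(\<Sum>w\<in>slab 0 (int k) b. \<phi> w x) \<le> (\<Sum>w\<in>slab 0 (int k) b. L * dist (T w (p (I x))) (T w x))"
        using True L(2) by (intro sum_mono) (simp add: \<phi>_def dist_commute)
      also have "\<dots> = n * (L * dbar T \<beta> b k (p (I x)) x)"
        using n by (simp add: dbar_def strip_upto_slab n_def sum_distrib_left[symmetric])
      also have "\<dots> \<le> n * (L * \<epsilon>)" using n L(1) IU(2)[OF True] by (intro mult_left_mono) auto
      also have "\<dots> \<le> n * \<eta>\<^sup>2" using n \<epsilon>1 by (intro mult_left_mono) auto
      finally show ?thesis .
    qed (use n in \<open>simp add: \<phi>_def\<close>)
    \<comment> \<open>Markov's inequality over \<open>w\<close>: the \<open>e w\<close> average to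
      at most \<open>\<eta>\<^sup>2\<close>, so they exceed \<open>\<eta>\<close> on at most a
      proportion \<open>\<eta>\<close> of the slab.\<close>
    define Bad where "Bad = {w \<in> slab 0 (int k) b. e w > \<eta>}"
    have "\<eta> * real (card Bad) = (\<Sum>w\<in>Bad. \<eta>)" by simp
    also have "\<dots> \<le> (\<Sum>w\<in>Bad. e w)" by (intro sum_mono) (auto simp: Bad_def)
    also have "\<dots> \<le> (\<Sum>w\<in>slab 0 (int k) b. e w)"
      by (rule sum_mono2) (auto simp: Bad_def e_def intro!: Bochner_Integration.integral_nonneg \<phi>0)
    also have "\<dots> = (\<integral>x. (\<Sum>w\<in>slab 0 (int k) b. \<phi> w x) \<partial>\<mu>)"
      unfolding e_def by (rule Bochner_Integration.integral_sum[symmetric]) (rule \<phi>i)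
    also have "\<dots> \<le> (\<integral>x. n * \<eta>\<^sup>2 \<partial>\<mu>)"
      by (intro integral_mono Bochner_Integration.integrable_sum \<phi>i sum_\<phi>) simp
    also have "\<dots> = \<eta> * (\<eta> * n)" by (simp add: power2_eq_square)
    finally have bad: "real (card Bad) \<le> \<eta> * n" using \<open>\<eta> > 0\<close> by (simp add: mult_le_cancel_left)
    define col where "col = (\<lambda>w. \<lambda>i\<in>{..<C}. \<lfloor>f (T w (p i)) / \<eta>\<rfloor>)"
    have colY: "col w \<in> Y" for w
      unfolding col_def Y_def
    proof (rule restrict_PiE_iff[THEN iffD2], intro ballI)
      fix i
      have "- M / \<eta> \<le> f (T w (p i)) / \<eta>" "f (T w (p i)) / \<eta> \<le> M / \<eta>"
        using M[of "T w (p i)"] \<open>\<eta> > 0\<close> by (intro divide_right_mono; auto simp: abs_le_iff)+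
      thus "\<lfloor>f (T w (p i)) / \<eta>\<rfloor> \<in> {\<lfloor>- M / \<eta>\<rfloor>..\<lfloor>M / \<eta>\<rfloor>}"
        by (auto simp del: minus_divide_left intro!: floor_mono)
    qed
    have good: "fun_dist f u w \<le> 4 * \<eta>"
      if uw: "u \<in> slab 0 (int k) b - Bad" "w \<in> slab 0 (int k) b - Bad" "col u = col w" for u w
    proof -
      \<comment> \<open>After integration one \<open>\<eta>\<close> each comes from
        \<open>u\<close>, from \<open>w\<close>, from the rounding in the colours and from the
        points outside \<open>U\<close>: hence the factor 4.\<close>
      have pt: "\<bar>f (T u x) - f (T w x)\<bar> \<le> \<phi> u x + \<phi> w x + \<eta> + 2 * M * indicator (UNIV - U) x" for x
      proof (cases "x \<in> U")
        case True
        have "\<lfloor>f (T u (p (I x))) / \<eta>\<rfloor> = \<lfloor>f (T w (p (I x))) / \<eta>\<rfloor>"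
          using fun_cong[OF uw(3), of "I x"] IU(1)[OF True] by (simp add: col_def)
        hence "\<bar>f (T u (p (I x))) / \<eta> - f (T w (p (I x))) / \<eta>\<bar> \<le> 1" by linarith
        hence "\<bar>f (T u (p (I x))) - f (T w (p (I x)))\<bar> \<le> \<eta>"
          using \<open>\<eta> > 0\<close> by (simp add: diff_divide_distrib[symmetric] divide_le_eq)
        thus ?thesis using True by (simp add: \<phi>_def)
      next
        case False
        thus ?thesis using M[of "T u x"] M[of "T w x"] \<open>\<eta> > 0\<close> by (simp add: \<phi>_def)
      qed
      have fi: "integrable \<mu> (\<lambda>x. \<bar>f (T u x) - f (T w x)\<bar>)"
        by (intro integrable_abs Bochner_Integration.integrable_diff integrable_T Lipschitz_bounded_integrable f)
      have ii: "integrable \<mu> (\<lambda>x. 2 * M * indicat_real (UNIV - U) x)"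
        by (intro integrable_mult_right integrable_ind cU)
      have "fun_dist f u w \<le> (\<integral>x. \<phi> u x + \<phi> w x + \<eta> + 2 * M * indicator (UNIV - U) x \<partial>\<mu>)"
        unfolding fun_dist_def
        by (intro integral_mono fi pt Bochner_Integration.integrable_add \<phi>i ii) simp
      also have "\<dots> = e u + e w + \<eta> + 2 * M * prob (UNIV - U)"
        using \<phi>i ii cU unfolding e_def by simp
      also have "\<dots> \<le> \<eta> + \<eta> + \<eta> + 2 * M * \<epsilon>"
      proof (intro add_mono mult_left_mono)
        show "e u \<le> \<eta>" "e w \<le> \<eta>" using uw by (auto simp: Bad_def)
        show "prob (UNIV - U) \<le> \<epsilon>" using PU prob_compl[OF U] by simp
      qed (use M0 in auto)
      finally show ?thesis using \<epsilon>2 by linarith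
    qed
    show "\<exists>col Bad. Bad \<subseteq> slab 0 (int k) b \<and> real (card Bad) \<le> \<eta> * card (slab 0 (int k) b) \<and>
      (\<forall>w. col w \<in> Y) \<and>
      (\<forall>u\<in>slab 0 (int k) b - Bad. \<forall>w\<in>slab 0 (int k) b - Bad. col u = col w \<longrightarrow> fun_dist f u w \<le> 4 * \<eta>)"
      using bad good colY unfolding n_def by (intro exI[of _ col] exI[of _ Bad]) (auto simp: Bad_def)
  qed
qed

lemma fun_dist_shift:
  assumes [measurable]: "f \<in> borel_measurable \<mu>"
  shows "fun_dist f (u + v) (w + v) = fun_dist f u w"
  unfolding fun_dist_def T_add
  by (rule integral_T[where w = v and f = "\<lambda>x. \<bar>f (T u x) - f (T w x)\<bar>"]) measurable

lemma bounded_complexity_imp_net: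
  fixes b \<epsilon> :: real
  assumes bc: "bounded_complexity \<mu> (dbar T \<beta> b)" and "b > 0" "\<epsilon> > 0"
    and f: "Lipschitz_bounded f"
  obtains W where "finite W" "W \<subseteq> strip \<beta> (b / 2)" "\<And>w. w \<in> strip \<beta> (b / 2) \<Longrightarrow> \<exists>v\<in>W. fun_dist f w v < \<epsilon>"
proof -
  note fm = Lipschitz_bounded_integrable(1)[OF f]
  have "\<exists>W. finite W \<and> W \<subseteq> strip \<beta> (b / 2) \<and> (\<forall>w\<in>strip \<beta> (b / 2). \<exists>v\<in>W. fun_dist f w v < \<epsilon>)"
  proof (rule ccontr)
    assume no_net: "\<not> ?thesis"
    \<comment> \<open>Without a finite net, separated sets of any size can be built
      greedily.\<close>
    have sep: "\<exists>S. finite S \<and> card S = M \<and> S \<subseteq> strip \<beta> (b / 2) \<and> (\<forall>u\<in>S. \<forall>w\<in>S. u \<noteq> w \<longrightarrow> fun_dist f u w \<ge> \<epsilon>)" for M :: nat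
    proof (induction M)
      case 0
      show ?case by (intro exI[of _ "{}"]) auto
    next
      case (Suc M)
      then obtain S where S: "finite S" "card S = M" "S \<subseteq> strip \<beta> (b / 2)"
        "\<forall>u\<in>S. \<forall>w\<in>S. u \<noteq> w \<longrightarrow> fun_dist f u w \<ge> \<epsilon>" by (elim exE conjE)
      obtain w where w: "w \<in> strip \<beta> (b / 2)" "\<And>v. v \<in> S \<Longrightarrow> fun_dist f w v \<ge> \<epsilon>"
        using no_net S(1,3) by (meson not_less)
      have "w \<notin> S" using w(2)[of w] \<open>\<epsilon> > 0\<close> by (auto simp: fun_dist_def)
      moreover have "fun_dist f v w \<ge> \<epsilon>" if "v \<in> S" for v
        using w(2)[OF that] by (simp add: fun_dist_def abs_minus_commute)
      ultimately show ?case using S w by (intro exI[of _ "insert w S"]) auto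
    qed
    obtain c where c: "c > 0" "\<And>k. k \<ge> 1 \<Longrightarrow> c * real k \<le> card (slab 0 (int k) (b / 2))"
      using slab_density[of "b / 2"] \<open>b > 0\<close> by auto
    \<comment> \<open>The first entry makes equal colours contradict the separation
      \<open>\<epsilon>\<close>. The second gives
      \<open>2 * \<eta> * (2 * b + 1) \<le> c / 2\<close>, against the lower bound \<open>c\<close>
      from the count below.\<close>
    define \<eta> where "\<eta> = min (\<epsilon> / 5) (c / (4 * (2 * b + 1)))"
    have \<eta>: "\<eta> > 0" "4 * \<eta> < \<epsilon>" using \<open>\<epsilon> > 0\<close> c(1) \<open>b > 0\<close> by (auto simp: \<eta>_def min_def)
    have "\<eta> \<le> c / (4 * (2 * b + 1))" by (simp add: \<eta>_def)
    hence \<eta>c: "2 * \<eta> * (2 * b + 1) \<le> c / 2" using \<open>b > 0\<close> by (simp add: field_simps)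
    obtain Y :: "(nat \<Rightarrow> int) set" where Y: "finite Y"
      "\<And>k. k \<ge> 1 \<Longrightarrow> \<exists>col Bad. Bad \<subseteq> slab 0 (int k) b \<and> real (card Bad) \<le> \<eta> * card (slab 0 (int k) b) \<and>
      (\<forall>w. col w \<in> Y) \<and>
      (\<forall>u\<in>slab 0 (int k) b - Bad. \<forall>w\<in>slab 0 (int k) b - Bad. col u = col w \<longrightarrow> fun_dist f u w \<le> 4 * \<eta>)"
      using strip_colouring[OF bc \<open>b > 0\<close> \<eta>(1) f] by blast
    \<comment> \<open>Good translates of one point have distinct colours, so at most
      \<open>card Y\<close> of the \<open>M\<close> translates are good and at least half of them
      are bad.\<close>
    define M where "M = 2 * (card Y + 1)"
    obtain S where S: "finite S" "card S = M" "S \<subseteq> strip \<beta> (b / 2)"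
      and S_sep: "\<forall>u\<in>S. \<forall>w\<in>S. u \<noteq> w \<longrightarrow> fun_dist f u w \<ge> \<epsilon>"
      using sep[of M] by (elim exE conjE)
    have "\<exists>s :: nat. \<forall>w\<in>S. \<bar>fst w\<bar> \<le> int s"
    proof (intro exI[of _ "nat (\<Sum>w\<in>S. \<bar>fst w\<bar>)"] ballI)
      fix w assume "w \<in> S"
      hence "\<bar>fst w\<bar> \<le> (\<Sum>w\<in>S. \<bar>fst w\<bar>)" by (intro member_le_sum S(1)) auto
      thus "\<bar>fst w\<bar> \<le> int (nat (\<Sum>w\<in>S. \<bar>fst w\<bar>))" by linarith
    qed
    then obtain s :: nat where s: "\<And>w. w \<in> S \<Longrightarrow> \<bar>fst w\<bar> \<le> int s" by blast
    have "c \<le> 2 * \<eta> * (2 * b + 1)"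
    proof (rule le_of_asymptotic)
      fix R :: nat assume "R \<ge> 1"
      \<comment> \<open>A margin of \<open>s\<close> columns on either side keeps the translates w +
        u inside \<open>Q\<close>; their half widths add up to \<open>b\<close>.\<close>
      define k where "k = R + 2 * s"
      have k: "k \<ge> 1" using \<open>R \<ge> 1\<close> by (simp add: k_def)
      define Q where "Q = slab 0 (int k) b"
      obtain col Bad where Bad: "Bad \<subseteq> Q" "real (card Bad) \<le> \<eta> * card Q"
        and col: "\<And>w. col w \<in> Y"
          "\<And>u w. u \<in> Q - Bad \<Longrightarrow> w \<in> Q - Bad \<Longrightarrow> col u = col w \<Longrightarrow> fun_dist f u w \<le> 4 * \<eta>"
        using Y(2)[OF k] unfolding Q_def by blast
      have finBad: "finite Bad" using Bad(1) by (rule finite_subset) (simp add: Q_def)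
      define V where "V = slab (int s) (int (R + s)) (b / 2)"
      have finV: "finite V" by (simp add: V_def)
      have inQ: "w + u \<in> Q" if "w \<in> S" "u \<in> V" for w u
      proof -
        have "\<bar>offset w\<bar> \<le> b / 2" using S(3) that(1) unfolding strip_offset by blast
        moreover have "\<bar>offset u\<bar> \<le> b / 2" using that(2) by (simp add: V_def slab_def)
        ultimately have "\<bar>offset (w + u)\<bar> \<le> b" unfolding offset_add by linarith
        thus ?thesis using s[OF that(1)] that(2) by (auto simp: Q_def V_def slab_def k_def abs_le_iff)
      qed
      have low: "card {w \<in> S. w + u \<in> Bad} * 2 \<ge> M" if u: "u \<in> V" for u
      proof -
        define G where "G = {w \<in> S. w + u \<notin> Bad}"
        have "inj_on (\<lambda>w. col (w + u)) G"
        proof (rule inj_onI, rule ccontr)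
          fix w v assume wv: "w \<in> G" "v \<in> G" "col (w + u) = col (v + u)" "w \<noteq> v"
          have "fun_dist f (w + u) (v + u) \<le> 4 * \<eta>"
            using wv inQ[OF _ u] by (intro col) (auto simp: G_def)
          moreover have "fun_dist f w v \<ge> \<epsilon>" using wv S_sep by (auto simp: G_def)
          ultimately show False using \<eta>(2) by (simp add: fun_dist_shift[OF fm])
        qed
        moreover have "(\<lambda>w. col (w + u)) ` G \<subseteq> Y" by (rule image_subsetI) (rule col(1))
        ultimately have "card G \<le> card Y" by (rule card_inj_on_le[OF _ _ Y(1)])
        moreover have "card S = card G + card {w \<in> S. w + u \<in> Bad}"
          unfolding G_def using S(1) by (subst card_Un_disjoint[symmetric]) (auto intro: arg_cong[of _ _ card])
        moreover have "m \<le> t * 2" if "g \<le> c" "m = g + t" "m = 2 * (c + 1)" for m g t c :: nat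
          using that by arith
        ultimately show ?thesis using S(2) M_def by metis
      qed
      have up: "card {u \<in> V. w + u \<in> Bad} \<le> card Bad" for w
        by (rule card_inj_on_le[of "\<lambda>u. w + u"]) (auto simp: inj_on_def finBad)
      \<comment> \<open>Count the pairs (w, u) with w + u in \<open>Bad\<close> in both
        orders.\<close>
      have "M * card V = (\<Sum>u\<in>V. M)" by simp
      also have "\<dots> \<le> (\<Sum>u\<in>V. card {w \<in> S. w + u \<in> Bad} * 2)" by (intro sum_mono low)
      also have "\<dots> = (\<Sum>u\<in>V. \<Sum>w\<in>S. of_bool (w + u \<in> Bad)) * 2"
        using S(1) by (simp add: sum_distrib_right[symmetric] of_bool_def sum.If_cases Int_def)
      also have "(\<Sum>u\<in>V. \<Sum>w\<in>S. of_bool (w + u \<in> Bad)) = (\<Sum>w\<in>S. \<Sum>u\<in>V. of_bool (w + u \<in> Bad) :: nat)"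
        by (rule sum.swap)
      also have "\<dots> = (\<Sum>w\<in>S. card {u \<in> V. w + u \<in> Bad})"
        using finV by (simp add: of_bool_def sum.If_cases Int_def)
      also have "\<dots> \<le> (\<Sum>w\<in>S. card Bad)" by (intro sum_mono up)
      also have "\<dots> = M * card Bad" using S(2) by simp
      finally have "M * card V \<le> M * (card Bad * 2)" by simp
      moreover have "M > 0" by (simp add: M_def)
      ultimately have VB: "card V \<le> card Bad * 2" by simp
      \<comment> \<open>The density bound starts at column 0, so the first \<open>s\<close> columns
        are included, at a cost independent of \<open>R\<close>.\<close>
      have "slab 0 (int (R + s)) (b / 2) \<subseteq> slab 0 (int s) (b / 2) \<union> V" by (auto simp: slab_def V_def)
      hence "card (slab 0 (int (R + s)) (b / 2)) \<le> card (slab 0 (int s) (b / 2) \<union> V)"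
        by (intro card_mono) (auto simp: finV)
      also have "\<dots> \<le> card (slab 0 (int s) (b / 2)) + card V" by (rule card_Un_le)
      finally have "real (card (slab 0 (int (R + s)) (b / 2))) \<le> real (card (slab 0 (int s) (b / 2))) + real (card V)"
        by linarith
      moreover have "c * real (R + s) \<le> real (card (slab 0 (int (R + s)) (b / 2)))"
        using \<open>R \<ge> 1\<close> by (intro c) simp
      moreover have "real (card (slab 0 (int s) (b / 2))) \<le> (b + 1) * real s"
        using card_slab_le[of 0 "int s" "b / 2"] \<open>b > 0\<close> by simp
      moreover have "real (card V) \<le> 2 * (\<eta> * ((2 * b + 1) * real k))"
      proof -
        have "real (card V) \<le> 2 * real (card Bad)" using VB by linarith
        also have "\<dots> \<le> 2 * (\<eta> * real (card Q))" using Bad(2) by simp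
        also have "\<dots> \<le> 2 * (\<eta> * ((2 * b + 1) * real k))"
          using card_slab_le[of 0 "int k" b] \<open>b > 0\<close> \<eta>(1) unfolding Q_def by (intro mult_left_mono) auto
        finally show ?thesis .
      qed
      moreover have "c * real s \<ge> 0" using c(1) by simp
      ultimately show "real R * c \<le> real R * (2 * \<eta> * (2 * b + 1)) + ((b + 1) * real s + 2 * (\<eta> * ((2 * b + 1) * (2 * real s))))"
        unfolding k_def by (simp add: algebra_simps)
    qed
    thus False using \<eta>c c(1) by linarith
  qed
  thus thesis using that by blast
qed

text \<open>By invariance, replacing 1_B by a Lipschitz function costs the same in L^1 at every
  \<open>w\<close>, so nets for Lipschitz functions suffice.\<close>

lemma bounded_complexity_imp_orbit_tb:
  assumes bc: "bounded_complexity \<mu> (dbar T \<beta> b)" and "b > 0" and B: "B \<in> sets borel"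
  shows "orbit_tb B (b / 2)"
  unfolding orbit_tb_def
proof (intro allI impI)
  fix e :: real assume "e > 0"
  have Bm: "B \<in> sets \<mu>" using B sets_M by simp
  obtain f where f: "Lipschitz_bounded f" "(\<integral>x. \<bar>indicator B x - f x\<bar> \<partial>\<mu>) < e / 3"
    using indicator_Lipschitz_L1[OF B, of "e / 3"] \<open>e > 0\<close> by auto
  note fi = Lipschitz_bounded_integrable[OF f(1)]
  note [measurable] = Bm fi(1)
  obtain W where W: "finite W" "W \<subseteq> strip \<beta> (b / 2)" "\<And>w. w \<in> strip \<beta> (b / 2) \<Longrightarrow> \<exists>v\<in>W. fun_dist f w v < e / 3"
    using bounded_complexity_imp_net[OF bc \<open>b > 0\<close> _ f(1), of "e / 3"] \<open>e > 0\<close> by auto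
  have i1: "integrable \<mu> (\<lambda>x. \<bar>indicat_real B (T w x) - f (T w x)\<bar>)" for w
    by (intro integrable_abs Bochner_Integration.integrable_diff integrable_T integrable_ind_T B fi)
  have i2: "integrable \<mu> (\<lambda>x. \<bar>f (T w x) - f (T v x)\<bar>)" for v w
    by (intro integrable_abs Bochner_Integration.integrable_diff integrable_T fi)
  have i3: "integrable \<mu> (\<lambda>x. \<bar>indicat_real B (T w x) - indicat_real B (T v x)\<bar>)" for v w
    by (intro integrable_abs Bochner_Integration.integrable_diff integrable_ind_T B)
  have close: "(\<integral>x. \<bar>indicator B (T w x) - f (T w x)\<bar> \<partial>\<mu>) < e / 3" for w
    using f(2) integral_T[of "\<lambda>x. \<bar>indicator B x - f x\<bar>" w] by simp
  have "orbit_dist B w v < e" if "fun_dist f w v < e / 3" for w v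
  proof -
    have "orbit_dist B w v \<le> (\<integral>x. \<bar>indicator B (T w x) - f (T w x)\<bar> + \<bar>f (T w x) - f (T v x)\<bar> + \<bar>indicator B (T v x) - f (T v x)\<bar> \<partial>\<mu>)"
      unfolding orbit_dist_def
      by (intro integral_mono Bochner_Integration.integrable_add i1 i2 i3) linarith
    also have "\<dots> = (\<integral>x. \<bar>indicator B (T w x) - f (T w x)\<bar> \<partial>\<mu>) + fun_dist f w v + (\<integral>x. \<bar>indicator B (T v x) - f (T v x)\<bar> \<partial>\<mu>)"
      unfolding fun_dist_def using i1 i2 by simp
    finally show ?thesis using close[of w] close[of v] that by linarith
  qed
  hence "\<exists>v\<in>W. orbit_dist B w v < e" if "w \<in> strip \<beta> (b / 2)" for w
    using W(3)[OF that] by blast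
  thus "\<exists>W. finite W \<and> W \<subseteq> strip \<beta> (b / 2) \<and> (\<forall>w\<in>strip \<beta> (b / 2). \<exists>v\<in>W. orbit_dist B w v < e)"
    by (intro exI[of _ W] conjI ballI W)
qed

text \<open>\<open>Kronecker_strip_subset\<close> repairs the loss of half the width.\<close>

lemma bounded_complexity_imp_discrete_spectrum:
  assumes "bounded_complexity \<mu> (dbar T \<beta> b)" "b > 0"
  shows "discrete_spectrum T \<beta> \<mu>"
proof -
  have "B \<in> Kronecker_strip T \<beta> 1 \<mu>" if B: "B \<in> sets borel" for B
  proof -
    have "B \<in> Kronecker_strip T \<beta> (b / 2) \<mu>"
      using Kronecker_strip_iff[OF B] bounded_complexity_imp_orbit_tb[OF assms B] by blast
    thus ?thesis using Kronecker_strip_subset[OF tds inv, of "b / 2" 1] assms(2) by auto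
  qed
  thus ?thesis unfolding discrete_spectrum_def Kronecker_algebra_def
    by (auto simp: Kronecker_strip_def)
qed

section \<open>The equivalences\<close>


lemma dbar_le_dhat: "k \<ge> 1 \<Longrightarrow> dbar T \<beta> b k x y \<le> dhat T \<beta> b k x y"
  unfolding dhat_def by (intro Max_ge) auto

lemma dhat_less_iff: "k \<ge> 1 \<Longrightarrow> dhat T \<beta> b k x y < \<epsilon> \<longleftrightarrow> (\<forall>i\<in>{1..k}. dbar T \<beta> b i x y < \<epsilon>)"
  unfolding dhat_def by (subst Max_less_iff) auto

lemma dhat_ball_sets:
  assumes "k \<ge> 1"
  shows "{y. dhat T \<beta> b k x y < \<epsilon>} \<in> sets \<mu>"
proof -
  have "{y. dhat T \<beta> b k x y < \<epsilon>} = (\<Inter>i\<in>{1..k}. {y. dbar T \<beta> b i x y < \<epsilon>})"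
    using dhat_less_iff[OF assms] by blast
  thus ?thesis using assms dbar_ball_sets by (auto intro!: sets.finite_INT)
qed

lemma bounded_complexity_dhat_imp_dbar:
  assumes "bounded_complexity \<mu> (dhat T \<beta> b)"
  shows "bounded_complexity \<mu> (dbar T \<beta> b)"
  unfolding bounded_complexity_def
proof (intro allI impI)
  fix \<epsilon> :: real assume "\<epsilon> > 0"
  then obtain C where C: "C > 0" "\<And>k. k \<ge> 1 \<Longrightarrow> \<exists>F. finite F \<and> card F \<le> C \<and> prob (\<Union>x\<in>F. {y. dhat T \<beta> b k x y < \<epsilon>}) > 1 - \<epsilon>"
    using assms unfolding bounded_complexity_def by blast
  show "\<exists>C>0. \<forall>k\<ge>1. \<exists>F. finite F \<and> card F \<le> C \<and> prob (\<Union>x\<in>F. {y. dbar T \<beta> b k x y < \<epsilon>}) > 1 - \<epsilon>"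
  proof (intro exI[of _ C] conjI allI impI C(1))
    fix k :: nat assume k: "k \<ge> 1"
    obtain F where F: "finite F" "card F \<le> C" "prob (\<Union>x\<in>F. {y. dhat T \<beta> b k x y < \<epsilon>}) > 1 - \<epsilon>"
      using C(2)[OF k] by blast
    have "prob (\<Union>x\<in>F. {y. dhat T \<beta> b k x y < \<epsilon>}) \<le> prob (\<Union>x\<in>F. {y. dbar T \<beta> b k x y < \<epsilon>})"
    proof (rule finite_measure_mono)
      show "(\<Union>x\<in>F. {y. dhat T \<beta> b k x y < \<epsilon>}) \<subseteq> (\<Union>x\<in>F. {y. dbar T \<beta> b k x y < \<epsilon>})"
        using dbar_le_dhat[OF k] by (blast intro: le_less_trans)
    qed (intro sets.finite_UN F dbar_ball_sets)
    thus "\<exists>F. finite F \<and> card F \<le> C \<and> prob (\<Union>x\<in>F. {y. dbar T \<beta> b k x y < \<epsilon>}) > 1 - \<epsilon>"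
      using F by (intro exI[of _ F]) auto
  qed
qed

lemma equicontinuous_imp_mean_equicontinuous:
  assumes "equicontinuous_in_mean T \<mu> \<beta> b"
  shows "mean_equicontinuous T \<mu> \<beta> b"
proof -
  have "mean_equicontinuous_on T \<beta> b K" if K: "equicontinuous_in_mean_on T \<beta> b K" for K
    unfolding mean_equicontinuous_on_def
  proof (intro allI impI)
    fix \<epsilon> :: real assume \<epsilon>: "\<epsilon> > 0"
    then obtain \<delta> where \<delta>: "\<delta> > 0"
        "\<forall>k\<ge>1. \<forall>x\<in>K. \<forall>y\<in>K. dist x y < \<delta> \<longrightarrow> dhat T \<beta> b k x y < \<epsilon> / 2"
      using K unfolding equicontinuous_in_mean_on_def by (meson half_gt_zero)
    have "limsup (\<lambda>k. ereal (dbar T \<beta> b k x y)) < ereal \<epsilon>"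
      if xy: "x \<in> K" "y \<in> K" "dist x y < \<delta>" for x y
    proof -
      have "dbar T \<beta> b k x y \<le> \<epsilon> / 2" if k: "k \<ge> 1" for k
        using dbar_le_dhat[OF k, of b x y] \<delta>(2) k xy by fastforce
      hence "limsup (\<lambda>k. ereal (dbar T \<beta> b k x y)) \<le> ereal (\<epsilon> / 2)"
        by (intro Limsup_bounded) (auto simp: eventually_sequentially intro!: exI[of _ 1])
      also have "\<dots> < ereal \<epsilon>" using \<epsilon> by simp
      finally show ?thesis .
    qed
    thus "\<exists>\<delta>>0. \<forall>x\<in>K. \<forall>y\<in>K. dist x y < \<delta> \<longrightarrow> limsup (\<lambda>k. ereal (dbar T \<beta> b k x y)) < ereal \<epsilon>"
      using \<delta>(1) by blast
  qed
  thus ?thesis using assms unfolding equicontinuous_in_mean_def mean_equicontinuous_def by blast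
qed

text \<open>Equicontinuity compares points of \<open>K\<close> only, so the centres of a cover are
  moved into \<open>K\<close>; covering with half the radius pays for the move.\<close>

lemma finite_net_in:
  fixes K :: "'a set"
  assumes "\<delta> > 0"
  obtains F where "finite F" "F \<subseteq> K" "\<And>y. y \<in> K \<Longrightarrow> \<exists>x\<in>F. dist x y < \<delta>"
proof -
  obtain P :: "'a set" where P: "finite P" "UNIV = (\<Union>p\<in>P. ball p (\<delta> / 2))"
    using finite_ball_cover[of "\<delta> / 2"] assms by auto
  define Q where "Q = {p \<in> P. ball p (\<delta> / 2) \<inter> K \<noteq> {}}"
  have "\<forall>p\<in>Q. \<exists>x. x \<in> ball p (\<delta> / 2) \<inter> K" by (auto simp: Q_def)
  then obtain q where q: "\<And>p. p \<in> Q \<Longrightarrow> q p \<in> ball p (\<delta> / 2) \<inter> K" by metis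
  show thesis
  proof (rule that[of "q ` Q"])
    show "finite (q ` Q)" using P(1) by (simp add: Q_def)
    show "q ` Q \<subseteq> K" using q by blast
    fix y assume y: "y \<in> K"
    obtain p where p: "p \<in> P" "y \<in> ball p (\<delta> / 2)" using P(2) by blast
    hence pQ: "p \<in> Q" using y by (auto simp: Q_def)
    have "dist (q p) y \<le> dist p (q p) + dist p y" by (rule dist_triangle3)
    also have "\<dots> < \<delta>" using q[OF pQ] p(2) by simp
    finally show "\<exists>x\<in>q ` Q. dist x y < \<delta>" using pQ by blast
  qed
qed

text \<open>\<open>\<delta>\<close> does not depend on \<open>k\<close>, so one finite
  \<open>\<delta>\<close>-net of \<open>K\<close> supplies the centres for all
  \<open>k\<close>.\<close>

lemma equicontinuous_imp_bounded_complexity: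
  assumes "equicontinuous_in_mean T \<mu> \<beta> b"
  shows "bounded_complexity \<mu> (dhat T \<beta> b)"
  unfolding bounded_complexity_def
proof (intro allI impI)
  fix \<epsilon> :: real assume \<epsilon>: "\<epsilon> > 0"
  obtain K where K: "K \<in> sets borel" "prob K > 1 - \<epsilon>" "equicontinuous_in_mean_on T \<beta> b K"
    using assms \<epsilon> unfolding equicontinuous_in_mean_def by blast
  obtain \<delta> where \<delta>: "\<delta> > 0" "\<forall>k\<ge>1. \<forall>x\<in>K. \<forall>y\<in>K. dist x y < \<delta> \<longrightarrow> dhat T \<beta> b k x y < \<epsilon>"
    using K(3) \<epsilon> unfolding equicontinuous_in_mean_on_def by blast
  obtain F where F: "finite F" "F \<subseteq> K" "\<And>y. y \<in> K \<Longrightarrow> \<exists>x\<in>F. dist x y < \<delta>"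
    using finite_net_in[OF \<delta>(1)] by blast
  have "prob (\<Union>x\<in>F. {y. dhat T \<beta> b k x y < \<epsilon>}) > 1 - \<epsilon>" if k: "k \<ge> 1" for k
  proof -
    have "prob K \<le> prob (\<Union>x\<in>F. {y. dhat T \<beta> b k x y < \<epsilon>})"
    proof (rule finite_measure_mono)
      show "K \<subseteq> (\<Union>x\<in>F. {y. dhat T \<beta> b k x y < \<epsilon>})"
        using F(2,3) \<delta>(2) k by blast
    qed (intro sets.finite_UN F dhat_ball_sets k)
    thus ?thesis using K(2) by linarith
  qed
  thus "\<exists>C>0. \<forall>k\<ge>1. \<exists>F. finite F \<and> card F \<le> C \<and> prob (\<Union>x\<in>F. {y. dhat T \<beta> b k x y < \<epsilon>}) > 1 - \<epsilon>"
    using F(1) by (intro exI[of _ "card F + 1"]) auto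
qed

lemma dbar_finite_cover:
  assumes "\<epsilon> > 0"
  obtains F where "finite F" "(\<Union>x\<in>F. {y. dbar T \<beta> b k x y < \<epsilon>}) = UNIV"
proof -
  have "UNIV \<subseteq> (\<Union>x\<in>UNIV. {y. dbar T \<beta> b k x y < \<epsilon>})" using assms by auto
  then obtain F where "finite F" "UNIV \<subseteq> (\<Union>x\<in>F. {y. dbar T \<beta> b k x y < \<epsilon>})"
    by (rule compactE_image[OF compact_UNIV open_dbar_ball])
  thus thesis by (intro that[of F]) auto
qed

text \<open>A limsup controls only large \<open>k\<close>, from an index that depends on the point.
  On a set of measure above \<open>1 - \<epsilon>\<close> one index \<open>N\<close> works for all
  points, and for the finitely many \<open>k < N\<close> compactness supplies finite covers.\<close>

lemma mean_equicontinuous_imp_bounded_complexity: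
  assumes "mean_equicontinuous T \<mu> \<beta> b"
  shows "bounded_complexity \<mu> (dbar T \<beta> b)"
  unfolding bounded_complexity_def
proof (intro allI impI)
  fix \<epsilon> :: real assume \<epsilon>: "\<epsilon> > 0"
  obtain K where K: "K \<in> sets borel" "prob K > 1 - \<epsilon>" "mean_equicontinuous_on T \<beta> b K"
    using assms \<epsilon> unfolding mean_equicontinuous_def by blast
  obtain \<delta> where \<delta>: "\<delta> > 0"
      "\<forall>x\<in>K. \<forall>y\<in>K. dist x y < \<delta> \<longrightarrow> limsup (\<lambda>k. ereal (dbar T \<beta> b k x y)) < ereal \<epsilon>"
    using K(3) \<epsilon> unfolding mean_equicontinuous_on_def by blast
  obtain F where F: "finite F" "F \<subseteq> K" "\<And>y. y \<in> K \<Longrightarrow> \<exists>x\<in>F. dist x y < \<delta>"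
    using finite_net_in[OF \<delta>(1)] by blast
  define A where "A = (\<lambda>N. {y \<in> space \<mu>. \<exists>x\<in>F. \<forall>k\<ge>N. dbar T \<beta> b k x y < \<epsilon>})"
  have Am: "A N \<in> sets \<mu>" for N
  proof -
    have "A N = (\<Union>x\<in>F. {y \<in> space \<mu>. \<forall>k. k \<ge> N \<longrightarrow> dbar T \<beta> b k x y < \<epsilon>})" by (auto simp: A_def)
    moreover have "{y \<in> space \<mu>. \<forall>k. k \<ge> N \<longrightarrow> dbar T \<beta> b k x y < \<epsilon>} \<in> sets \<mu>" for x by measurable
    ultimately show ?thesis using F(1) by (auto intro!: sets.finite_UN)
  qed
  have "A m \<subseteq> A n" if "m \<le> n" for m n
    unfolding A_def using order_trans[OF that] by blast
  hence "incseq A" by (simp add: incseq_def)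
  hence lim: "(\<lambda>N. prob (A N)) \<longlonglongrightarrow> prob (\<Union>N. A N)" using Am by (intro finite_Lim_measure_incseq) auto
  have "K \<subseteq> (\<Union>N. A N)"
  proof
    fix y assume y: "y \<in> K"
    obtain x where x: "x \<in> F" "dist x y < \<delta>" using F(3)[OF y] by blast
    have "limsup (\<lambda>k. ereal (dbar T \<beta> b k x y)) < ereal \<epsilon>" using \<delta>(2) x y F(2) by blast
    hence "eventually (\<lambda>k. ereal (dbar T \<beta> b k x y) < ereal \<epsilon>) sequentially" by (rule Limsup_lessD)
    then obtain N where "\<forall>k\<ge>N. dbar T \<beta> b k x y < \<epsilon>" by (auto simp: eventually_sequentially)
    thus "y \<in> (\<Union>N. A N)" using x(1) by (auto simp: A_def)
  qed
  hence "prob K \<le> prob (\<Union>N. A N)" using Am by (intro finite_measure_mono) auto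
  hence "1 - \<epsilon> < prob (\<Union>N. A N)" using K(2) by linarith
  from order_tendstoD(1)[OF lim this] obtain N where N: "prob (A N) > 1 - \<epsilon>"
    by (auto simp: eventually_sequentially)
  have "\<forall>k. \<exists>G. finite G \<and> (\<Union>x\<in>G. {y. dbar T \<beta> b k x y < \<epsilon>}) = UNIV"
    using dbar_finite_cover[OF \<epsilon>] by metis
  then obtain G where G: "\<And>k. finite (G k)" "\<And>k. (\<Union>x\<in>G k. {y. dbar T \<beta> b k x y < \<epsilon>}) = UNIV" by metis
  define C where "C = card F + (\<Sum>k<N. card (G k)) + 1"
  have "\<exists>F. finite F \<and> card F \<le> C \<and> prob (\<Union>x\<in>F. {y. dbar T \<beta> b k x y < \<epsilon>}) > 1 - \<epsilon>" for k
  proof (cases "k < N")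
    case True
    have "card (G k) \<le> (\<Sum>k<N. card (G k))" using True by (intro member_le_sum) auto
    thus ?thesis using G \<epsilon> by (intro exI[of _ "G k"]) (simp add: C_def)
  next
    case False
    have "prob (A N) \<le> prob (\<Union>x\<in>F. {y. dbar T \<beta> b k x y < \<epsilon>})"
    proof (rule finite_measure_mono)
      show "A N \<subseteq> (\<Union>x\<in>F. {y. dbar T \<beta> b k x y < \<epsilon>})" using False by (auto simp: A_def)
    qed (intro sets.finite_UN F dbar_ball_sets)
    thus ?thesis using F(1) N by (intro exI[of _ F]) (auto simp: C_def)
  qed
  thus "\<exists>C>0. \<forall>k\<ge>1. \<exists>F. finite F \<and> card F \<le> C \<and> prob (\<Union>x\<in>F. {y. dbar T \<beta> b k x y < \<epsilon>}) > 1 - \<epsilon>"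
    by (intro exI[of _ C]) (auto simp: C_def)
qed

end

theorem theorem1p3:
  fixes T :: "int \<times> int \<Rightarrow> 'a::metric_space \<Rightarrow> 'a"
    and \<mu> :: "'a measure"
    and \<beta> :: real
  assumes "Z2_tds T"
    and "\<mu> \<in> invariant_measures T"
  shows "((\<exists>b>0. bounded_complexity \<mu> (dhat T \<beta> b)) \<longleftrightarrow> discrete_spectrum T \<beta> \<mu>)
       \<and> ((\<forall>b>0. bounded_complexity \<mu> (dhat T \<beta> b)) \<longleftrightarrow> discrete_spectrum T \<beta> \<mu>)
       \<and> ((\<exists>b>0. bounded_complexity \<mu> (dbar T \<beta> b)) \<longleftrightarrow> discrete_spectrum T \<beta> \<mu>)
       \<and> ((\<forall>b>0. bounded_complexity \<mu> (dbar T \<beta> b)) \<longleftrightarrow> discrete_spectrum T \<beta> \<mu>)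
       \<and> ((\<exists>b>0. equicontinuous_in_mean T \<mu> \<beta> b) \<longleftrightarrow> discrete_spectrum T \<beta> \<mu>)
       \<and> ((\<forall>b>0. equicontinuous_in_mean T \<mu> \<beta> b) \<longleftrightarrow> discrete_spectrum T \<beta> \<mu>)
       \<and> ((\<exists>b>0. mean_equicontinuous T \<mu> \<beta> b) \<longleftrightarrow> discrete_spectrum T \<beta> \<mu>)
       \<and> ((\<forall>b>0. mean_equicontinuous T \<mu> \<beta> b) \<longleftrightarrow> discrete_spectrum T \<beta> \<mu>)"
proof -
  interpret Z2_system T \<mu> \<beta> by unfold_locales (fact assms)+
  let ?DS = "discrete_spectrum T \<beta> \<mu>"
  \<comment> \<open>All implications into discrete spectrum end in \<open>b\<close>, and all
    implications out of it start with \<open>d'\<close>.\<close>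
  have b: "?DS" if "bounded_complexity \<mu> (dbar T \<beta> b)" "b > 0" for b
    by (rule bounded_complexity_imp_discrete_spectrum[OF that])
  have a: "?DS" if "bounded_complexity \<mu> (dhat T \<beta> b)" "b > 0" for b
    by (rule b[OF bounded_complexity_dhat_imp_dbar[OF that(1)] that(2)])
  have d: "?DS" if "equicontinuous_in_mean T \<mu> \<beta> b" "b > 0" for b
    by (rule a[OF equicontinuous_imp_bounded_complexity[OF that(1)] that(2)])
  have e: "?DS" if "mean_equicontinuous T \<mu> \<beta> b" "b > 0" for b
    by (rule b[OF mean_equicontinuous_imp_bounded_complexity[OF that(1)] that(2)])
  have d': "equicontinuous_in_mean T \<mu> \<beta> b" if "?DS" "b > 0" for b
    by (rule discrete_spectrum_imp_equicontinuous_in_mean[OF that])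
  have a': "bounded_complexity \<mu> (dhat T \<beta> b)" if "?DS" "b > 0" for b
    by (rule equicontinuous_imp_bounded_complexity[OF d'[OF that]])
  have b': "bounded_complexity \<mu> (dbar T \<beta> b)" if "?DS" "b > 0" for b
    by (rule bounded_complexity_dhat_imp_dbar[OF a'[OF that]])
  have e': "mean_equicontinuous T \<mu> \<beta> b" if "?DS" "b > 0" for b
    by (rule equicontinuous_imp_mean_equicontinuous[OF d'[OF that]])
  \<comment> \<open>Width 1 serves as the witness for some \<open>b\<close> and as the instance of
    all \<open>b\<close>.\<close>
  have some: "(\<exists>b>0. P b) \<longleftrightarrow> ?DS" and all: "(\<forall>b>0. P b) \<longleftrightarrow> ?DS"
    if "\<And>b. P b \<Longrightarrow> b > 0 \<Longrightarrow> ?DS" "\<And>b. ?DS \<Longrightarrow> b > 0 \<Longrightarrow> P b" for P :: "real \<Rightarrow> bool"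
    using that zero_less_one by blast+
  show ?thesis
    by (intro conjI some all; erule (1) a a' b b' d d' e e')
qed

end
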